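(* Let $G$ be a unimodular lcsc group with Haar measure $m_G$, acting by a Borel action on a standard Borel space $X$, let $Y\subset X$ be a separated cross section, let $\mathcal G=(K_n)$ be a fundamental exhaustion of $G$ by compact sets and let $\mathcal Y=(Y_n)$ be a Borel exhaustion of $Y$. There exist mutually inverse bijections $${}^{G}\mathrm{res}^{X}_{Y}:M(X,\mathcal Y_{\mathcal G})^G\to M(Y,\mathcal Y)^{R_{G,Y}}\quad\text{and}\quad {}^{G}\mathrm{ind}^{X}_{Y}:M(Y,\mathcal Y)^{R_{G,Y}}\to M(X,\mathcal Y_{\mathcal G})^G$$ such that the following hold for all pairs $(\mu,\nu)$ with $\mu\in M(X,\mathcal Y_{\mathcal G})^G$ and $\nu={}^{G}\mathrm{res}^{X}_{Y}(\mu)$: (i) For every bounded non-negative Borel function $f$ on $Y$ we have $\displaystyle \nu(f)=\int_X\sum_{g\in Y_x}f(g.x)\,d\mu(x)$. (ii) More generally, for every bounded non-negative Borel function $F$ on $G\times Y$ we have $\displaystyle (m_G\otimes\nu)(F)=\int_X\sum_{g\in Y_x}F(g^{-1},g.x)\,d\mu(x)$. (iii) If $C\subset G\times Y$ is a Borel subset such that $a:C\to X$, $(g,y)\mapsto g.y$, is injective, then $\mu(a(C))=(m_G\otimes\nu)(C)$. (iv) If $B$ is a $G$-invariant Borel set in $X$, then $\mu(B)=0\iff\nu(B\cap Y)=0$.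
   Context: lcsc = locally compact second countable. Borel measures take values in $[0,\infty]$; for a measure $\nu$ and a non-negative Borel function $f$, $\nu(f)$ denotes the integral of $f$ with respect to $\nu$. A Borel set $Y\subset X$ is a cross section if $G.Y=X$; it is separated if $\{g\in G:g.Y\cap Y\neq\emptyset\}\cap U=\{e\}$ for some identity neighbourhood $U$. $Y_x:=\{g\in G:g.x\in Y\}$ for $x\in X$. A Borel exhaustion of a standard Borel space $S$ is an increasing sequence $\mathcal S=(S_n)$ of Borel sets with $S=\bigcup_nS_n$; $M(S,\mathcal S)$ is the set of Borel measures on $S$ that are finite on every $S_n$. A fundamental exhaustion $\mathcal G=(K_n)$ of $G$ by compact sets is an increasing sequence of compact sets with union $G$ such that every compact subset of $G$ lies in some $K_n$. $\mathcal Y_{\mathcal G}:=(K_n.Y_n)$ is then a Borel exhaustion of $X$. $M(X,\mathcal Y_{\mathcal G})^G$ is the set of $G$-invariant elements of $M(X,\mathcal Y_{\mathcal G})$. $R_{G,Y}:=\{(y,y')\in Y\times Y:y\in G.y'\}$ is the cross section equivalence relation, a countable Borel equivalence relation on $Y$. A Borel measure $\nu$ on $Y$ is $R_{G,Y}$-invariant if $\nu(A)=\nu(B)$ whenever $A,B\subset Y$ are Borel and there is a Borel bijection $\varphi:A\to B$ with $(y,\varphi(y))\in R_{G,Y}$ for all $y\in A$. $M(Y,\mathcal Y)^{R_{G,Y}}$ is the set of $R_{G,Y}$-invariant elements of $M(Y,\mathcal Y)$.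
   Formalization: Item (i) as printed fails unless m_G(G)=1 (e.g. G=R on R/Z, Y={0}, f=1 gives an infinite right side); it is replaced by ν(f)=∫_X Σ_{g∈Y_x} ρ(g^{-1}) f(g.x) dμ(x) for every non-negative Borel ρ on G with m_G(ρ)=1. *)

theory Defs
  imports "HOL-Analysis.Analysis"
begin

(* Groups are types of class topological_group_add. The group is written additively but is NOT
   assumed commutative (group_add is the noncommutative class): 0 is the identity e,
   g + h is the product gh, and - g is the inverse. *)

definition haar_measure :: "'g::{topological_group_add, t2_space} measure \<Rightarrow> bool" where
  "haar_measure m \<longleftrightarrow>
     sets m = sets borel \<and>
     (\<forall>g. \<forall>A\<in>sets borel. emeasure m ((\<lambda>h. g + h) ` A) = emeasure m A) \<and>
     (\<forall>K. compact K \<longrightarrow> emeasure m K < \<infinity>) \<and>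
     emeasure m UNIV \<noteq> 0"

definition unimodular :: "'g::{topological_group_add, t2_space} itself \<Rightarrow> bool" where
  "unimodular _ \<longleftrightarrow>
     (\<forall>m :: 'g measure. haar_measure m \<longrightarrow>
        (\<forall>g. \<forall>A\<in>sets borel. emeasure m ((\<lambda>h. h + g) ` A) = emeasure m A))"

(* Only space and sets of M matter here and below; its emeasure is ignored. *)
definition standard_borel_space :: "'x measure \<Rightarrow> bool" where
  "standard_borel_space M \<longleftrightarrow>
     (\<exists>T. topspace T = space M \<and> completely_metrizable_space T \<and> separable_space T \<and>
        sets M = sigma_sets (topspace T) {U. openin T U})"

definition borel_action ::
    "('g::{topological_group_add, t2_space} \<Rightarrow> 'x \<Rightarrow> 'x) \<Rightarrow> 'x measure \<Rightarrow> bool" where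
  "borel_action act X \<longleftrightarrow>
     (\<lambda>(g, x). act g x) \<in> (borel \<Otimes>\<^sub>M X) \<rightarrow>\<^sub>M X \<and>
     (\<forall>x\<in>space X. act 0 x = x) \<and>
     (\<forall>g h. \<forall>x\<in>space X. act (g + h) x = act g (act h x))"

(* K.A *)
definition translates :: "('g \<Rightarrow> 'x \<Rightarrow> 'x) \<Rightarrow> 'g set \<Rightarrow> 'x set \<Rightarrow> 'x set" where
  "translates act K A = (\<Union>g\<in>K. act g ` A)"

definition cross_section :: "('g \<Rightarrow> 'x \<Rightarrow> 'x) \<Rightarrow> 'x measure \<Rightarrow> 'x set \<Rightarrow> bool" where
  "cross_section act X Y \<longleftrightarrow> Y \<in> sets X \<and> translates act UNIV Y = space X"

definition separated ::
    "('g::{topological_group_add, t2_space} \<Rightarrow> 'x \<Rightarrow> 'x) \<Rightarrow> 'x set \<Rightarrow> bool" where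
  "separated act Y \<longleftrightarrow>
     (\<exists>U. open U \<and> 0 \<in> U \<and> {g. act g ` Y \<inter> Y \<noteq> {}} \<inter> U = {0})"

(* Y_x *)
definition return_set :: "('g \<Rightarrow> 'x \<Rightarrow> 'x) \<Rightarrow> 'x set \<Rightarrow> 'x \<Rightarrow> 'g set" where
  "return_set act Y x = {g. act g x \<in> Y}"

definition borel_exhaustion :: "'x measure \<Rightarrow> (nat \<Rightarrow> 'x set) \<Rightarrow> bool" where
  "borel_exhaustion S E \<longleftrightarrow> (\<forall>n. E n \<in> sets S) \<and> incseq E \<and> (\<Union>n. E n) = space S"

definition fundamental_exhaustion :: "(nat \<Rightarrow> 'g::topological_space set) \<Rightarrow> bool" where
  "fundamental_exhaustion K \<longleftrightarrow>
     (\<forall>n. compact (K n)) \<and> incseq K \<and> (\<Union>n. K n) = UNIV \<and>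
     (\<forall>C. compact C \<longrightarrow> (\<exists>n. C \<subseteq> K n))"

(* M(S, E) *)
definition measures_finite_on :: "'x measure \<Rightarrow> (nat \<Rightarrow> 'x set) \<Rightarrow> 'x measure set" where
  "measures_finite_on S E = {\<mu>. sets \<mu> = sets S \<and> (\<forall>n. emeasure \<mu> (E n) < \<infinity>)}"

definition invariant_measure :: "('g \<Rightarrow> 'x \<Rightarrow> 'x) \<Rightarrow> 'x measure \<Rightarrow> bool" where
  "invariant_measure act \<mu> \<longleftrightarrow>
     (\<forall>g. \<forall>A\<in>sets \<mu>. emeasure \<mu> (act g ` A) = emeasure \<mu> A)"

(* R_{G,Y} *)
definition cross_section_rel :: "('g \<Rightarrow> 'x \<Rightarrow> 'x) \<Rightarrow> 'x set \<Rightarrow> ('x \<times> 'x) set" where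
  "cross_section_rel act Y = {(y, y'). y \<in> Y \<and> y' \<in> Y \<and> (\<exists>g. y = act g y')}"

definition rel_invariant_measure :: "('x \<times> 'x) set \<Rightarrow> 'x measure \<Rightarrow> bool" where
  "rel_invariant_measure R \<nu> \<longleftrightarrow>
     (\<forall>A\<in>sets \<nu>. \<forall>B\<in>sets \<nu>. \<forall>\<phi>.
        bij_betw \<phi> A B \<and> \<phi> \<in> restrict_space \<nu> A \<rightarrow>\<^sub>M restrict_space \<nu> B \<and>
        (\<forall>y\<in>A. (y, \<phi> y) \<in> R) \<longrightarrow> emeasure \<nu> A = emeasure \<nu> B)"

(* M(X, Y_G)^G, where Y_G = (K_n.Y_n) *)
definition invariant_measures ::
    "('g \<Rightarrow> 'x \<Rightarrow> 'x) \<Rightarrow> 'x measure \<Rightarrow> (nat \<Rightarrow> 'g set) \<Rightarrow> (nat \<Rightarrow> 'x set) \<Rightarrow> 'x measure set" where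
  "invariant_measures act X K E =
     {\<mu> \<in> measures_finite_on X (\<lambda>n. translates act (K n) (E n)). invariant_measure act \<mu>}"

(* M(Y, (Y_n))^R; Y carries the trace sigma-algebra of X *)
definition transverse_measures ::
    "('g \<Rightarrow> 'x \<Rightarrow> 'x) \<Rightarrow> 'x measure \<Rightarrow> 'x set \<Rightarrow> (nat \<Rightarrow> 'x set) \<Rightarrow> 'x measure set" where
  "transverse_measures act X Y E =
     {\<nu> \<in> measures_finite_on (restrict_space X Y) E.
        rel_invariant_measure (cross_section_rel act Y) \<nu>}"

end

theory Submission
  imports Defs
begin

text \<open>Separatedness makes the returns of a point to \<open>Y\<close> locally finite, and a Lusin--Souslin
  argument enumerates them by countably many measurable functions. Hence a \<open>G\<close>-invariant
  \<open>\<mu>\<close> induces on \<open>G \<times> Y\<close> the measure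
  \<open>C \<mapsto> \<integral> card {g. g.x \<in> Y \<and> (- g, g.x) \<in> C} d\<mu>(x)\<close>, which is invariant under left translation of
  \<open>G\<close>; uniqueness of Haar measure turns it into a product \<open>m \<otimes> \<nu>\<close>, and \<open>\<nu>\<close> is the restriction.
  Conversely, pushing \<open>m \<otimes> \<nu>\<close> forward from a set meeting every fibre of \<open>(g, y) \<mapsto> g.y\<close> in exactly
  one point inverts this construction; the \<open>R\<close>-invariance of \<open>\<nu>\<close> and the right invariance of
  \<open>m\<close> enter through a mass transport argument.\<close>

section \<open>Lusin separation\<close>

text \<open>Behind everything stands the action map from G x Y to X: \<open>trans_sum F x\<close> is
  the sum of F over the fibre of x. A translation of X lifts to a left translation of G, so on that
  side left invariance suffices. Moving inside a fibre, from (g, y) to (g - h, h.y), translates the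
  group coordinate on the right by an element that depends on y; this is why right invariance of m
  and R-invariance of \<nu> occur together. The obstacle is measurability: the fibre varies with x,
  and images of measurable sets have to be measurable again. Relatively compact pieces of G that
  hold at most one return of each point reduce this to sets with one-point sections inside C x X, C
  compact, where analytic sets can be coded by compact sets. In (i) the weight \<rho> of m-integral
  1 is a normalisation: (ii) for F(g, y) = f(y) yields m(G) \<nu>(f), while F(g, y) = \<rho>(g) f(y)
  yields \<nu>(f), whatever the choice of \<rho>.\<close>

text \<open>In a scheme \<open>R\<close>, the set \<open>R k \<sigma>\<close> depends on finitely many terms of \<open>\<sigma>\<close>, but not
  necessarily on the first \<open>k\<close>: with this freedom, countable intersections of analytic sets only
  need a pairing of indices.\<close>

definition compact_analytic :: "'a::topological_space set \<Rightarrow> bool" where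
  "compact_analytic A \<longleftrightarrow>
     (\<exists>R :: nat \<Rightarrow> (nat \<Rightarrow> nat) \<Rightarrow> 'a set. (\<forall>k \<sigma>. compact (R k \<sigma>)) \<and>
        (\<forall>k \<sigma>. \<exists>b. \<forall>\<tau>. (\<forall>j<b. \<tau> j = \<sigma> j) \<longrightarrow> R k \<tau> = R k \<sigma>) \<and>
        A = (\<Union>\<sigma>. \<Inter>k. R k \<sigma>))"

lemma compact_analyticI:
  assumes "\<And>k \<sigma>. compact (R k \<sigma>)"
    and "\<And>k \<sigma>. \<exists>b. \<forall>\<tau>. (\<forall>j<b. \<tau> j = \<sigma> j) \<longrightarrow> R k \<tau> = R k \<sigma>"
    and "A = (\<Union>\<sigma>::nat \<Rightarrow> nat. \<Inter>k::nat. R k \<sigma>)"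
  shows "compact_analytic A"
  using assms unfolding compact_analytic_def by blast

lemma compact_analytic_compact: "compact A \<Longrightarrow> compact_analytic A"
  by (rule compact_analyticI[of "\<lambda>_ _. A"]) auto

text \<open>The first term of the sequence picks the index n; the remaining terms are a branch of
  the scheme of \<open>A n\<close>.\<close>

lemma compact_analytic_UN:
  fixes A :: "nat \<Rightarrow> 'a::topological_space set"
  assumes "\<And>n. compact_analytic (A n)"
  shows "compact_analytic (\<Union>n. A n)"
proof -
  from assms have "\<forall>n. \<exists>R. (\<forall>k \<sigma>. compact (R k \<sigma>)) \<and>
        (\<forall>k \<sigma>. \<exists>b. \<forall>\<tau>. (\<forall>j<b. \<tau> j = \<sigma> j) \<longrightarrow> R k \<tau> = R k \<sigma>) \<and>
        A n = (\<Union>\<sigma>::nat \<Rightarrow> nat. \<Inter>k::nat. R k \<sigma>)"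
    unfolding compact_analytic_def by blast
  then obtain R where R: "\<And>n k \<sigma>. compact (R n k \<sigma>)"
    "\<And>n k \<sigma>. \<exists>b. \<forall>\<tau>. (\<forall>j<b. \<tau> j = \<sigma> j) \<longrightarrow> R n k \<tau> = R n k \<sigma>"
    "\<And>n. A n = (\<Union>\<sigma>::nat \<Rightarrow> nat. \<Inter>k::nat. R n k \<sigma>)"
    by metis
  show ?thesis
  proof (rule compact_analyticI[of "\<lambda>k \<sigma>. R (\<sigma> 0) k (\<lambda>j. \<sigma> (Suc j))"])
    fix k and \<sigma> :: "nat \<Rightarrow> nat"
    show "compact (R (\<sigma> 0) k (\<lambda>j. \<sigma> (Suc j)))" by (rule R)
    obtain b where b: "\<And>\<tau>. (\<And>j. j < b \<Longrightarrow> \<tau> j = \<sigma> (Suc j)) \<Longrightarrow>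
        R (\<sigma> 0) k \<tau> = R (\<sigma> 0) k (\<lambda>j. \<sigma> (Suc j))"
      using R(2)[of "\<lambda>j. \<sigma> (Suc j)" "\<sigma> 0" k] by blast
    show "\<exists>b. \<forall>\<tau>. (\<forall>j<b. \<tau> j = \<sigma> j) \<longrightarrow>
        R (\<tau> 0) k (\<lambda>j. \<tau> (Suc j)) = R (\<sigma> 0) k (\<lambda>j. \<sigma> (Suc j))"
      by (rule exI[of _ "Suc b"]) (auto intro!: b)
  next
    show "(\<Union>n. A n) = (\<Union>\<sigma>. \<Inter>k. R (\<sigma> 0) k (\<lambda>j. \<sigma> (Suc j)))"
    proof (intro equalityI subsetI)
      fix x assume "x \<in> (\<Union>n. A n)"
      then obtain n \<sigma> where "\<And>k. x \<in> R n k \<sigma>" unfolding R(3) by auto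
      then show "x \<in> (\<Union>\<sigma>. \<Inter>k. R (\<sigma> 0) k (\<lambda>j. \<sigma> (Suc j)))"
        by (intro UN_I[of "case_nat n \<sigma>"]) auto
    qed (auto simp: R(3))
  qed
qed

text \<open>A single sequence carries one branch for every n, in its column of positions
  \<open>prod_encode (n, j)\<close>; level p tests one level of one of the schemes.\<close>

lemma compact_analytic_INT:
  fixes A :: "nat \<Rightarrow> 'a::topological_space set"
  assumes "\<And>n. compact_analytic (A n)"
  shows "compact_analytic (\<Inter>n. A n)"
proof -
  from assms have "\<forall>n. \<exists>R. (\<forall>k \<sigma>. compact (R k \<sigma>)) \<and>
        (\<forall>k \<sigma>. \<exists>b. \<forall>\<tau>. (\<forall>j<b. \<tau> j = \<sigma> j) \<longrightarrow> R k \<tau> = R k \<sigma>) \<and>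
        A n = (\<Union>\<sigma>::nat \<Rightarrow> nat. \<Inter>k::nat. R k \<sigma>)"
    unfolding compact_analytic_def by blast
  then obtain R where R: "\<And>n k \<sigma>. compact (R n k \<sigma>)"
    "\<And>n k \<sigma>. \<exists>b. \<forall>\<tau>. (\<forall>j<b. \<tau> j = \<sigma> j) \<longrightarrow> R n k \<tau> = R n k \<sigma>"
    "\<And>n. A n = (\<Union>\<sigma>::nat \<Rightarrow> nat. \<Inter>k::nat. R n k \<sigma>)"
    by metis
  define Q where "Q p \<sigma> = R (fst (prod_decode p)) (snd (prod_decode p))
      (\<lambda>j. \<sigma> (prod_encode (fst (prod_decode p), j)))" for p \<sigma>
  show ?thesis
  proof (rule compact_analyticI[of Q])
    fix p and \<sigma> :: "nat \<Rightarrow> nat"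
    show "compact (Q p \<sigma>)" unfolding Q_def by (rule R)
    let ?n = "fst (prod_decode p)" and ?k = "snd (prod_decode p)"
    obtain b where b: "\<And>\<tau>. (\<And>j. j < b \<Longrightarrow> \<tau> j = \<sigma> (prod_encode (?n, j))) \<Longrightarrow>
        R ?n ?k \<tau> = R ?n ?k (\<lambda>j. \<sigma> (prod_encode (?n, j)))"
      using R(2)[of "\<lambda>j. \<sigma> (prod_encode (?n, j))" ?n ?k] by blast
    show "\<exists>b. \<forall>\<tau>. (\<forall>j<b. \<tau> j = \<sigma> j) \<longrightarrow> Q p \<tau> = Q p \<sigma>"
    proof (intro exI allI impI)
      \<comment> \<open>The first \<open>b\<close> entries of the column occupy positions up to this
        maximum; \<open>insert 0\<close> keeps the maximum defined when \<open>b\<close> is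
        0.\<close>
      fix \<tau> assume "\<forall>j<Suc (Max (insert 0 ((\<lambda>j. prod_encode (?n, j)) ` {..<b}))). \<tau> j = \<sigma> j"
      then show "Q p \<tau> = Q p \<sigma>" unfolding Q_def
        by (intro b) (auto simp: less_Suc_eq_le intro!: Max_ge)
    qed
  next
    show "(\<Inter>n. A n) = (\<Union>\<sigma>. \<Inter>p. Q p \<sigma>)"
    proof (intro equalityI subsetI)
      fix x assume "x \<in> (\<Inter>n. A n)"
      then have "\<forall>n. \<exists>\<sigma>. \<forall>k. x \<in> R n k \<sigma>" unfolding R(3) by auto
      then obtain s where s: "\<And>n k. x \<in> R n k (s n)" by metis
      show "x \<in> (\<Union>\<sigma>. \<Inter>p. Q p \<sigma>)"
        by (rule UN_I[of "\<lambda>q. s (fst (prod_decode q)) (snd (prod_decode q))"])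
          (auto simp: Q_def s)
    next
      fix x assume "x \<in> (\<Union>\<sigma>. \<Inter>p. Q p \<sigma>)"
      then obtain \<sigma> where \<sigma>: "\<And>p. x \<in> Q p \<sigma>" by auto
      have "x \<in> R n k (\<lambda>j. \<sigma> (prod_encode (n, j)))" for n k
        using \<sigma>[of "prod_encode (n, k)"] by (simp add: Q_def)
      then show "x \<in> (\<Inter>n. A n)" unfolding R(3) by blast
    qed
  qed
qed

lemma Hausdorff_space_euclidean_t2: "Hausdorff_space (euclidean :: 'a::t2_space topology)"
  unfolding Hausdorff_space_def disjnt_def using hausdorff by (metis open_openin)

text \<open>No metric and no regularity of the whole space is at hand, so closed neighbourhoods are
  borrowed from C: a point of U \<inter> C and the compact set C - U have disjoint open
  neighbourhoods. Second countability makes the resulting cover countable.\<close>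

lemma open_Int_compact_UN_compact:
  fixes U C :: "'a::{t2_space, second_countable_topology} set"
  assumes "open U" "compact C"
  obtains F :: "nat \<Rightarrow> 'a set" where "\<And>n. compact (F n)" "U \<inter> C = (\<Union>n. F n)"
proof -
  obtain \<B> :: "'a set set" where \<B>: "countable \<B>" "topological_basis \<B>"
    using ex_countable_basis by blast
  define \<W> where "\<W> = {W \<in> \<B>. closure W \<inter> C \<subseteq> U}"
  have "\<exists>W\<in>\<W>. p \<in> W" if p: "p \<in> U \<inter> C" for p
  proof -
    have "compact (C - U)" using assms by (simp add: compact_diff)
    moreover have "disjnt {p} (C - U)" using p by auto
    ultimately obtain V V' where V: "open V" "open V'" "p \<in> V" "C - U \<subseteq> V'" "disjnt V V'"
      using Hausdorff_space_compact_separation[OF Hausdorff_space_euclidean_t2, of "{p}" "C - U"]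
      by (metis compactin_euclidean_iff compact_sing insert_subset open_openin)
    obtain W where W: "W \<in> \<B>" "p \<in> W" "W \<subseteq> V" using topological_basisE[OF \<B>(2) V(1,3)] by blast
    have "closure W \<subseteq> - V'"
      using W(3) V by (intro closure_minimal) (auto simp: disjnt_def closed_Compl)
    with V(4) W show ?thesis unfolding \<W>_def by blast
  qed
  note cover = this
  have "closure W \<inter> C \<subseteq> U" if "W \<in> \<W>" for W
    using that unfolding \<W>_def by blast
  then have eq: "U \<inter> C = (\<Union>W\<in>\<W>. closure W \<inter> C)"
  proof (intro equalityI subsetI)
    fix p assume p: "p \<in> U \<inter> C"
    then obtain W where W: "W \<in> \<W>" "p \<in> W" using cover by blast
    then have "p \<in> closure W" using closure_subset by (rule_tac subsetD)
    with p W(1) show "p \<in> (\<Union>W\<in>\<W>. closure W \<inter> C)" by blast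
  qed blast
  show ?thesis
  proof (cases "\<W> = {}")
    case True
    then show ?thesis using eq by (intro that[of "\<lambda>_. {}"]) auto
  next
    case False
    have "countable \<W>" using \<B>(1) unfolding \<W>_def by simp
    with False have r: "range (from_nat_into \<W>) = \<W>" by (rule range_from_nat_into)
    show ?thesis
    proof (rule that[of "\<lambda>n. closure (from_nat_into \<W> n) \<inter> C"])
      show "U \<inter> C = (\<Union>n. closure (from_nat_into \<W> n) \<inter> C)"
        unfolding eq by (subst r[symmetric]) blast
    qed (use assms(2) in \<open>auto intro: closed_Int_compact\<close>)
  qed
qed

text \<open>Compact analytic sets are not closed under complements, so the induction over the Borel
  sets carries B and - B together and the complement case only swaps them. Traces on a sigma-compact
  set are taken because schemes consist of compact sets.\<close>

lemma compact_analytic_borel: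
  fixes B :: "'a::{t2_space, second_countable_topology} set" and C :: "nat \<Rightarrow> 'a set"
  assumes C: "\<And>n. compact (C n)" and B: "B \<in> sets borel"
  shows "compact_analytic (B \<inter> (\<Union>n. C n))"
proof -
  let ?O = "\<Union>n. C n"
  have opn: "compact_analytic (U \<inter> ?O)" if "open U" for U
  proof -
    have "compact_analytic (U \<inter> C n)" for n
    proof -
      obtain F where "\<And>k. compact (F k)" "U \<inter> C n = (\<Union>k::nat. F k)"
        using open_Int_compact_UN_compact[OF \<open>open U\<close> C] by metis
      then show ?thesis by (simp add: compact_analytic_UN compact_analytic_compact)
    qed
    then have "compact_analytic (\<Union>n. U \<inter> C n)" by (rule compact_analytic_UN)
    then show ?thesis by (simp only: Int_UN_distrib)
  qed
  have cls: "compact_analytic (U \<inter> ?O)" if "closed U" for U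
  proof -
    have "compact_analytic (\<Union>n. U \<inter> C n)"
      by (rule compact_analytic_UN) (rule compact_analytic_compact[OF closed_Int_compact[OF that C]])
    then show ?thesis by (simp only: Int_UN_distrib)
  qed
  have "B \<in> sigma_sets UNIV {S. open S}" using B by (simp add: sets_borel)
  then have "compact_analytic (B \<inter> ?O) \<and> compact_analytic ((- B) \<inter> ?O)"
  proof induction
    case (Basic a)
    then show ?case using opn[of a] cls[of "- a"] by (simp add: closed_Compl)
  next
    case Empty
    then show ?case using opn[of UNIV] by (simp add: compact_analytic_compact)
  next
    case (Compl a)
    then show ?case by (simp add: Compl_eq_Diff_UNIV[symmetric])
  next
    case (Union a)
    have "compact_analytic (\<Inter>n. - a n \<inter> ?O)" "compact_analytic (\<Union>n. a n \<inter> ?O)"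
      using Union.IH by (blast intro: compact_analytic_INT, blast intro: compact_analytic_UN)
    moreover have "(\<Inter>n. - a n \<inter> ?O) = - (\<Union>n. a n) \<inter> ?O"
      "(\<Union>n. a n \<inter> ?O) = (\<Union>n. a n) \<inter> ?O" by auto
    ultimately show ?case by simp
  qed
  then show ?thesis by simp
qed

section \<open>Separation of continuous images by Borel sets\<close>

definition borel_separable :: "'a::topological_space set \<Rightarrow> 'a set \<Rightarrow> bool" where
  "borel_separable P Q \<longleftrightarrow> (\<exists>B\<in>sets borel. P \<subseteq> B \<and> B \<inter> Q = {})"

text \<open>Used in contrapositive form: if two countable unions cannot be separated, neither can
  some pair of their pieces. This drives the choice of ever longer cylinders below.\<close>

lemma borel_separable_UN:
  assumes "\<And>n m. borel_separable (P n) (Q m)"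
  shows "borel_separable (\<Union>n::nat. P n) (\<Union>m::nat. Q m)"
proof -
  obtain B where B: "\<And>n m. B n m \<in> sets borel" "\<And>n m. P n \<subseteq> B n m" "\<And>n m. B n m \<inter> Q m = {}"
    using assms unfolding borel_separable_def by metis
  show ?thesis unfolding borel_separable_def
  proof (rule bexI[of _ "\<Union>n. \<Inter>m. B n m"])
    show "(\<Union>n. \<Inter>m. B n m) \<in> sets borel" using B(1) by auto
    have "x \<notin> Q m" if "\<forall>m. x \<in> B n m" for x n m
      using that B(3)[of n m] by auto
    then have "(\<Union>n. \<Inter>m. B n m) \<inter> (\<Union>m. Q m) = {}" by fast
    moreover have "(\<Union>n. P n) \<subseteq> (\<Union>n. \<Inter>m. B n m)"
      using B(2) by (intro UN_mono INT_greatest) auto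
    ultimately show "(\<Union>n. P n) \<subseteq> (\<Union>n. \<Inter>m. B n m) \<and> (\<Union>n. \<Inter>m. B n m) \<inter> (\<Union>m. Q m) = {}"
      by blast
  qed
qed

text \<open>Since \<pi> need not be injective, an intersection of images says little about the image
  of the intersection. Compactness is therefore applied to the closed set of pairs with equal image,
  inside the products \<open>C k \<times> D k\<close>.\<close>

lemma compact_INT_images_meet:
  fixes C D :: "nat \<Rightarrow> 'a::t2_space set" and \<pi> :: "'a \<Rightarrow> 'b::t2_space"
  assumes C: "\<And>k. compact (C k)" and D: "\<And>k. compact (D k)" and \<pi>: "continuous_on UNIV \<pi>"
    and ne: "\<And>N. \<pi> ` (\<Inter>k\<le>N. C k) \<inter> \<pi> ` (\<Inter>k\<le>N. D k) \<noteq> {}"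
  shows "\<pi> ` (\<Inter>k. C k) \<inter> \<pi> ` (\<Inter>k. D k) \<noteq> {}"
proof -
  define F where "F k = C k \<times> D k" for k :: nat
  have "closed {z. \<pi> (fst z) = \<pi> (snd z)}"
    by (intro closed_Collect_eq continuous_on_compose2[OF \<pi>] continuous_intros) auto
  moreover have "compact (F k)" for k unfolding F_def using C D by (rule compact_Times)
  ultimately have c0: "compact (F 0 \<inter> {z. \<pi> (fst z) = \<pi> (snd z)})"
    by (intro compact_Int_closed)
  have "(F 0 \<inter> {z. \<pi> (fst z) = \<pi> (snd z)}) \<inter> (\<Inter>(range F)) \<noteq> {}"
  proof (rule compact_imp_fip[OF c0])
    fix T assume "T \<in> range F"
    then show "closed T" using \<open>\<And>k. compact (F k)\<close> compact_imp_closed by blast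
  next
    fix F' assume "finite F'" "F' \<subseteq> range F"
    then obtain I where I: "finite I" "F' = F ` I" by (meson finite_subset_image)
    then obtain N where N: "\<And>i. i \<in> I \<Longrightarrow> i \<le> N" using finite_nat_set_iff_bounded_le by auto
    obtain p q where pq: "p \<in> (\<Inter>k\<le>N. C k)" "q \<in> (\<Inter>k\<le>N. D k)" "\<pi> p = \<pi> q"
      using ne[of N] by blast
    then have "(p, q) \<in> (F 0 \<inter> {z. \<pi> (fst z) = \<pi> (snd z)}) \<inter> \<Inter>F'"
      using N unfolding I F_def by auto
    then show "(F 0 \<inter> {z. \<pi> (fst z) = \<pi> (snd z)}) \<inter> \<Inter>F' \<noteq> {}" by blast
  qed
  then obtain z where "z \<in> \<Inter>(range F)" "\<pi> (fst z) = \<pi> (snd z)" by auto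
  then show ?thesis unfolding F_def by (auto simp: mem_Times_iff)
qed

text \<open>If the images were not separable, neither would be those of ever finer pairs of cylinders;
  compactness makes the two limit points have a common image.\<close>

theorem Lusin_separation:
  fixes \<pi> :: "'a::t2_space \<Rightarrow> 'b::t2_space"
  assumes A: "compact_analytic A" and B: "compact_analytic B" and \<pi>: "continuous_on UNIV \<pi>"
    and disj: "\<pi> ` A \<inter> \<pi> ` B = {}"
  shows "borel_separable (\<pi> ` A) (\<pi> ` B)"
proof (rule ccontr)
  assume neg: "\<not> borel_separable (\<pi> ` A) (\<pi> ` B)"
  obtain R where R: "\<And>k \<sigma>. compact (R k \<sigma>)"
    "\<And>k \<sigma>. \<exists>b. \<forall>\<tau>. (\<forall>j<b. \<tau> j = \<sigma> j) \<longrightarrow> R k \<tau> = R k \<sigma>"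
    "A = (\<Union>\<sigma>::nat \<Rightarrow> nat. \<Inter>k::nat. R k \<sigma>)"
    using A unfolding compact_analytic_def by metis
  obtain S where S: "\<And>k \<sigma>. compact (S k \<sigma>)"
    "\<And>k \<sigma>. \<exists>b. \<forall>\<tau>. (\<forall>j<b. \<tau> j = \<sigma> j) \<longrightarrow> S k \<tau> = S k \<sigma>"
    "B = (\<Union>\<sigma>::nat \<Rightarrow> nat. \<Inter>k::nat. S k \<sigma>)"
    using B unfolding compact_analytic_def by metis
  define cyl where "cyl b \<sigma> = {\<tau>. \<forall>j<b. \<tau> j = \<sigma> j}" for b and \<sigma> :: "nat \<Rightarrow> nat"
  have cyl_Suc: "cyl b \<sigma> = (\<Union>n. cyl (Suc b) (\<sigma>(b := n)))" for b \<sigma>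
    unfolding cyl_def by (auto simp: less_Suc_eq)
  define RA where "RA X = \<pi> ` (\<Union>\<sigma>\<in>X. \<Inter>k. R k \<sigma>)" for X
  define SB where "SB X = \<pi> ` (\<Union>\<sigma>\<in>X. \<Inter>k. S k \<sigma>)" for X
  define ns where "ns b p \<longleftrightarrow> \<not> borel_separable (RA (cyl b (fst p))) (SB (cyl b (snd p)))" for b p
  have "\<exists>f. \<forall>b. ns b (f b) \<and>
      (\<exists>n m. f (Suc b) = ((fst (f b))(b := n), (snd (f b))(b := m)))"
  proof (rule dependent_nat_choice)
    have "cyl 0 (\<lambda>_. 0) = UNIV" by (auto simp: cyl_def)
    then have "ns 0 (\<lambda>_. 0, \<lambda>_. 0)"
      using neg unfolding ns_def RA_def SB_def R(3) S(3) by simp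
    then show "\<exists>p. ns 0 p" by blast
  next
    fix p b assume "ns b p"
    obtain \<sigma> \<tau> where p: "p = (\<sigma>, \<tau>)" by fastforce
    have "RA (cyl b \<sigma>) = (\<Union>n. RA (cyl (Suc b) (\<sigma>(b := n))))"
      "SB (cyl b \<tau>) = (\<Union>m. SB (cyl (Suc b) (\<tau>(b := m))))"
      unfolding RA_def SB_def cyl_Suc[of b] by (auto simp only: UN_UN_flatten image_UN)
    with \<open>ns b p\<close> obtain n m
      where "\<not> borel_separable (RA (cyl (Suc b) (\<sigma>(b := n)))) (SB (cyl (Suc b) (\<tau>(b := m))))"
      unfolding ns_def p fst_conv snd_conv using borel_separable_UN by metis
    then show "\<exists>y. ns (Suc b) y \<and> (\<exists>n m. y = ((fst p)(b := n), (snd p)(b := m)))"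
      unfolding ns_def p by auto
  qed
  then obtain f where f: "\<And>b. ns b (f b)"
    "\<And>b. \<exists>n m. f (Suc b) = ((fst (f b))(b := n), (snd (f b))(b := m))" by blast
  \<comment> \<open>Step b overwrites coordinate b only, so coordinate j has its final value from
    stage \<open>Suc j\<close> on.\<close>
  define \<sigma> where "\<sigma> j = fst (f (Suc j)) j" for j
  define \<tau> where "\<tau> j = snd (f (Suc j)) j" for j
  have st: "fst (f b) j = \<sigma> j \<and> snd (f b) j = \<tau> j" if "j < b" for b j
    using that
  proof (induction b)
    case (Suc b)
    then show ?case using f(2)[of b] by (cases "j = b") (auto simp: \<sigma>_def \<tau>_def)
  qed simp
  have ns: "\<not> borel_separable (RA (cyl b \<sigma>)) (SB (cyl b \<tau>))" for b
  proof -
    have "cyl b (fst (f b)) = cyl b \<sigma>" "cyl b (snd (f b)) = cyl b \<tau>"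
      using st[of _ b] unfolding cyl_def by auto
    with f(1)[of b] show ?thesis unfolding ns_def by simp
  qed
  obtain bR where bR: "\<And>k \<rho>. \<rho> \<in> cyl (bR k) \<sigma> \<Longrightarrow> R k \<rho> = R k \<sigma>"
    using R(2)[of \<sigma>] unfolding cyl_def mem_Collect_eq by metis
  obtain bS where bS: "\<And>k \<rho>. \<rho> \<in> cyl (bS k) \<tau> \<Longrightarrow> S k \<rho> = S k \<tau>"
    using S(2)[of \<tau>] unfolding cyl_def mem_Collect_eq by metis
  have "\<pi> ` (\<Inter>k\<le>N. R k \<sigma>) \<inter> \<pi> ` (\<Inter>k\<le>N. S k \<tau>) \<noteq> {}" for N
  proof
    assume empty: "\<pi> ` (\<Inter>k\<le>N. R k \<sigma>) \<inter> \<pi> ` (\<Inter>k\<le>N. S k \<tau>) = {}"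
    \<comment> \<open>A common length: the sum dominates every \<open>bR k\<close> and
      \<open>bS k\<close> with k \<le> N, so on cylinders of length \<open>b\<close> these finitely
      many compact sets no longer change. The image of their intersection is then a compact, hence
      Borel, separating set.\<close>
    define b where "b = (\<Sum>k\<le>N. bR k + bS k)"
    have le: "bR k \<le> b" "bS k \<le> b" if "k \<le> N" for k
      using member_le_sum[of k "{..N}" "\<lambda>k. bR k + bS k"] that unfolding b_def by auto
    have "(\<Inter>k. R k \<rho>) \<subseteq> R k \<sigma>" if "k \<le> N" "\<rho> \<in> cyl b \<sigma>" for k \<rho>
    proof -
      have "R k \<rho> = R k \<sigma>" using that le[of k] by (intro bR) (auto simp: cyl_def)
      then show ?thesis by auto
    qed
    then have RA: "RA (cyl b \<sigma>) \<subseteq> \<pi> ` (\<Inter>k\<le>N. R k \<sigma>)" unfolding RA_def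
      by (intro image_mono UN_least INT_greatest) simp
    have "(\<Inter>k. S k \<rho>) \<subseteq> S k \<tau>" if "k \<le> N" "\<rho> \<in> cyl b \<tau>" for k \<rho>
    proof -
      have "S k \<rho> = S k \<tau>" using that le[of k] by (intro bS) (auto simp: cyl_def)
      then show ?thesis by auto
    qed
    then have SB: "SB (cyl b \<tau>) \<subseteq> \<pi> ` (\<Inter>k\<le>N. S k \<tau>)" unfolding SB_def
      by (intro image_mono UN_least INT_greatest) simp
    have "compact (R 0 \<sigma> \<inter> (\<Inter>k\<le>N. R k \<sigma>))"
      using R(1) compact_imp_closed by (intro compact_Int_closed closed_INT) auto
    also have "R 0 \<sigma> \<inter> (\<Inter>k\<le>N. R k \<sigma>) = (\<Inter>k\<le>N. R k \<sigma>)" by auto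
    finally have "compact (\<Inter>k\<le>N. R k \<sigma>)" .
    then have "compact (\<pi> ` (\<Inter>k\<le>N. R k \<sigma>))"
      by (intro compact_continuous_image continuous_on_subset[OF \<pi>]) auto
    then have "\<pi> ` (\<Inter>k\<le>N. R k \<sigma>) \<in> sets borel"
      by (rule borel_compact)
    moreover have "\<pi> ` (\<Inter>k\<le>N. R k \<sigma>) \<inter> SB (cyl b \<tau>) = {}"
      using SB empty by (metis Int_mono order_refl subset_empty)
    ultimately have "borel_separable (RA (cyl b \<sigma>)) (SB (cyl b \<tau>))"
      using RA unfolding borel_separable_def by metis
    with ns show False by blast
  qed
  with R(1) S(1) have "\<pi> ` (\<Inter>k. R k \<sigma>) \<inter> \<pi> ` (\<Inter>k. S k \<tau>) \<noteq> {}"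
    by (intro compact_INT_images_meet \<pi>)
  moreover have "\<pi> ` (\<Inter>k. R k \<sigma>) \<subseteq> \<pi> ` A" "\<pi> ` (\<Inter>k. S k \<tau>) \<subseteq> \<pi> ` B"
    unfolding R(3) S(3) by (intro image_mono UN_upper UNIV_I)+
  ultimately show False using disj by (metis Int_mono subset_empty)
qed

section \<open>Measurable sections over standard Borel spaces\<close>

text \<open>Lets sets that are measurable over a trace space, such as the set of codes or the cross
  section, be used over the ambient space.\<close>

lemma sets_pair_restrict_space:
  assumes \<Omega>: "\<Omega> \<in> sets N" and C: "C \<in> sets (M \<Otimes>\<^sub>M restrict_space N \<Omega>)"
  shows "C \<in> sets (M \<Otimes>\<^sub>M N)"
proof -
  have sub: "space (restrict_space N \<Omega>) = \<Omega>"
    using sets.sets_into_space[OF \<Omega>] by (simp add: space_restrict_space Int_absorb2)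
  have "C \<in> sigma_sets (space M \<times> \<Omega>) {a \<times> b |a b. a \<in> sets M \<and> b \<in> sets (restrict_space N \<Omega>)}"
    using C unfolding sets_pair_measure sub .
  then show ?thesis
  proof induction
    case (Basic a)
    then show ?case using \<Omega> by (auto simp: sets_restrict_space_iff)
  next
    case (Compl a)
    have "space M \<times> \<Omega> \<in> sets (M \<Otimes>\<^sub>M N)" using \<Omega> by auto
    with Compl.IH show ?case by blast
  qed auto
qed

lemma compact_cube: "compact {z :: nat \<Rightarrow> real. \<forall>n. z n \<in> {0..1}}"
proof -
  have "{z :: nat \<Rightarrow> real. \<forall>n. z n \<in> {0..1}} = PiE UNIV (\<lambda>_. {0..1})"
    by (auto simp: PiE_def Pi_def)
  moreover have "compactin (product_topology (\<lambda>_. euclidean) UNIV) (PiE UNIV (\<lambda>_ :: nat. {0..1 :: real}))"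
    by (subst compactin_PiE) auto
  ultimately show ?thesis
    by (simp add: euclidean_product_topology)
qed

text \<open>A point is encoded by its truncated distances to the members of a dense sequence; the
  encodings are exactly the tuples in the cube that obey the triangle inequalities and come
  arbitrarily close to 0, so that the range of the encoding is visibly Borel.\<close>

lemma standard_borel_embedding:
  fixes X :: "'x measure"
  assumes "standard_borel_space X"
  obtains e :: "'x \<Rightarrow> nat \<Rightarrow> real" and r P where
    "e \<in> X \<rightarrow>\<^sub>M borel" "P \<in> sets borel" "P \<subseteq> {z. \<forall>n. z n \<in> {0..1}}"
    "r \<in> restrict_space borel P \<rightarrow>\<^sub>M X"
    "\<And>x. x \<in> space X \<Longrightarrow> e x \<in> P" "\<And>x. x \<in> space X \<Longrightarrow> r (e x) = x"
    "\<And>z. z \<in> P \<Longrightarrow> e (r z) = z"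
proof (cases "space X = {}")
  case True
  show ?thesis
  proof (rule that[of "\<lambda>_ _. 0" "{}" "\<lambda>_. undefined"])
    show "(\<lambda>_. undefined) \<in> restrict_space borel {} \<rightarrow>\<^sub>M X"
      using True by (simp add: measurable_empty_iff space_restrict_space)
  qed (auto simp: True)
next
  case False
  obtain T where T: "topspace T = space X" "completely_metrizable_space T" "separable_space T"
    "sets X = sigma_sets (topspace T) {U. openin T U}"
    using assms unfolding standard_borel_space_def by blast
  obtain M d where M: "Metric_space M d" "Metric_space.mcomplete M d" "T = Metric_space.mtopology M d"
    using T(2) unfolding completely_metrizable_space_def by auto
  interpret Metric_space M d by (rule M(1))
  have sp: "space X = M" and setsX: "sets X = sigma_sets M {U. openin mtopology U}"
    using T(1,4) unfolding M(3) topspace_mtopology by simp_all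
  obtain Q where Q: "countable Q" "Q \<subseteq> M" "mtopology closure_of Q = M"
    using T(3) unfolding separable_space_def M(3) by auto
  have "Q \<noteq> {}" using Q(3) False sp by auto
  define q where "q = from_nat_into Q"
  have qM: "q n \<in> M" for n
    using Q(2) \<open>Q \<noteq> {}\<close> unfolding q_def by (meson from_nat_into subsetD)
  have dense: "\<exists>n. d x (q n) < \<epsilon>" if "x \<in> M" "\<epsilon> > 0" for x \<epsilon>
  proof -
    have "x \<in> mtopology closure_of Q" using that Q by simp
    then obtain y where "y \<in> Q" "y \<in> mball x \<epsilon>"
      using \<open>\<epsilon> > 0\<close> unfolding metric_closure_of by auto
    then show ?thesis unfolding q_def using from_nat_into_surj[OF Q(1)] by (metis in_mball)
  qed
  \<comment> \<open>Truncation at 1 places the codes in a compact cube and leaves balls of radius at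
    most 1 unchanged.\<close>
  define \<delta> where "\<delta> x y = min 1 (d x y)" for x y
  have \<delta>0: "0 \<le> \<delta> x y" "\<delta> x y \<le> 1" "\<delta> x y = \<delta> y x" for x y
    unfolding \<delta>_def using commute by auto
  have tri: "\<delta> x z \<le> \<delta> x y + \<delta> y z" if "x \<in> M" "y \<in> M" "z \<in> M" for x y z
    unfolding \<delta>_def using triangle[OF that] nonneg[of x y] nonneg[of y z] by linarith
  define e where "e x n = \<delta> x (q n)" for x n
  \<comment> \<open>The last two conditions make z a Katetov function on the dense sequence: the
    distances of a possible new point. The second one, that z has infimum 0, forces this point into
    the completion, hence into the space.\<close>
  define P where "P = {z. (\<forall>n. 0 \<le> z n \<and> z n \<le> 1) \<and> (\<forall>k. \<exists>n. z n < inverse (real (Suc k))) \<and>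
     (\<forall>n m. \<delta> (q n) (q m) \<le> z n + z m \<and> z n \<le> \<delta> (q n) (q m) + z m)}"
  have small: "\<exists>n. e x n < \<epsilon>" if "x \<in> M" "\<epsilon> > 0" for x \<epsilon>
    using dense[OF that] unfolding e_def \<delta>_def min_less_iff_disj by blast
  have eP: "e x \<in> P" if "x \<in> M" for x
    unfolding P_def
  proof (intro CollectI conjI allI)
    fix n m
    show "\<delta> (q n) (q m) \<le> e x n + e x m"
      using tri[OF qM[of n] that qM[of m]] \<delta>0(3)[of x] by (simp add: e_def)
    show "e x n \<le> \<delta> (q n) (q m) + e x m"
      using tri[OF that qM[of m] qM[of n]] \<delta>0(3)[of "q m"] by (simp add: e_def)
  qed (use \<delta>0 small[OF that] in \<open>auto simp: e_def\<close>)
  have inj: "x = y" if xy: "x \<in> M" "y \<in> M" "e x = e y" for x y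
  proof -
    have "\<delta> x y \<le> 0"
    proof (rule field_le_epsilon)
      fix \<epsilon> :: real assume "\<epsilon> > 0"
      then obtain n where "e x n < \<epsilon> / 2" using small[OF xy(1), of "\<epsilon> / 2"] by auto
      moreover have "\<delta> x y \<le> e x n + e y n"
        using tri[OF xy(1) qM[of n] xy(2)] \<delta>0(3)[of y] by (simp add: e_def)
      ultimately show "\<delta> x y \<le> 0 + \<epsilon>" using xy(3) by simp
    qed
    then have "d x y \<le> 0" unfolding \<delta>_def by linarith
    then show ?thesis using zero[OF xy(1,2)] nonneg[of x y] by simp
  qed
  have surj: "\<exists>x\<in>M. e x = z" if z: "z \<in> P" for z
  proof -
    have "\<forall>k. \<exists>n. z n < inverse (real (Suc k))" using z unfolding P_def by blast
    then obtain n where n: "\<And>k. z (n k) < inverse (real (Suc k))" by metis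
    have small: "\<exists>N. \<forall>k\<ge>N. z (n k) < \<epsilon>" if "\<epsilon> > 0" for \<epsilon>
    proof -
      obtain N where N: "inverse (real (Suc N)) < \<epsilon>" using reals_Archimedean[OF \<open>\<epsilon> > 0\<close>] by auto
      have "z (n k) < \<epsilon>" if "k \<ge> N" for k
      proof -
        have "inverse (real (Suc k)) \<le> inverse (real (Suc N))" using that by simp
        with n[of k] N show ?thesis by linarith
      qed
      then show ?thesis by blast
    qed
    have "MCauchy (\<lambda>k. q (n k))" unfolding MCauchy_def
    proof (intro conjI allI impI)
      fix \<epsilon> :: real assume "\<epsilon> > 0"
      \<comment> \<open>A truncated distance below 1 is the true distance, hence the minimum with
        1.\<close>
      then obtain N where N: "\<And>k. k \<ge> N \<Longrightarrow> z (n k) < min \<epsilon> 1 / 2" using small[of "min \<epsilon> 1 / 2"] by auto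
      have "d (q (n k)) (q (n j)) < \<epsilon>" if "N \<le> k" "N \<le> j" for k j
      proof -
        have "\<delta> (q (n k)) (q (n j)) \<le> z (n k) + z (n j)" using z unfolding P_def by blast
        then have "\<delta> (q (n k)) (q (n j)) < min \<epsilon> 1" using N[OF that(1)] N[OF that(2)] by linarith
        then show ?thesis unfolding \<delta>_def by linarith
      qed
      then show "\<exists>N. \<forall>k j. N \<le> k \<longrightarrow> N \<le> j \<longrightarrow> d (q (n k)) (q (n j)) < \<epsilon>" by blast
    qed (use qM in auto)
    then obtain x where x: "limitin mtopology (\<lambda>k. q (n k)) x sequentially"
      using M(2) unfolding mcomplete_def by blast
    then have xM: "x \<in> M" and lim: "\<And>\<epsilon>. \<epsilon> > 0 \<Longrightarrow> \<exists>N. \<forall>k\<ge>N. d (q (n k)) x < \<epsilon>"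
      unfolding limit_metric_sequentially by blast+
    have "e x m = z m" for m
    proof -
      have ex: "\<exists>k. z (n k) < \<epsilon> \<and> \<delta> x (q (n k)) < \<epsilon>" if e0: "\<epsilon> > 0" for \<epsilon>
      proof -
        obtain N N' where "\<And>k. k \<ge> N \<Longrightarrow> z (n k) < \<epsilon>" "\<And>k. k \<ge> N' \<Longrightarrow> d (q (n k)) x < \<epsilon>"
          using small[OF e0] lim[OF e0] by blast
        then have "z (n (max N N')) < \<epsilon>" "d (q (n (max N N'))) x < \<epsilon>" by simp_all
        then show ?thesis unfolding \<delta>_def using commute by (metis min.strict_coboundedI2)
      qed
      have "e x m \<le> z m"
      proof (rule field_le_epsilon)
        fix \<epsilon> :: real assume "\<epsilon> > 0"
        then obtain k where k: "z (n k) < \<epsilon> / 2" "\<delta> x (q (n k)) < \<epsilon> / 2" using ex[of "\<epsilon> / 2"] by auto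
        have "\<delta> (q (n k)) (q m) \<le> z (n k) + z m" using z unfolding P_def by blast
        with tri[OF xM qM[of "n k"] qM[of m]] k show "e x m \<le> z m + \<epsilon>" unfolding e_def by linarith
      qed
      moreover have "z m \<le> e x m"
      proof (rule field_le_epsilon)
        fix \<epsilon> :: real assume "\<epsilon> > 0"
        then obtain k where k: "z (n k) < \<epsilon> / 2" "\<delta> x (q (n k)) < \<epsilon> / 2" using ex[of "\<epsilon> / 2"] by auto
        have "z m \<le> \<delta> (q m) (q (n k)) + z (n k)" using z unfolding P_def by blast
        with tri[OF qM[of m] xM qM[of "n k"]] k \<delta>0(3)[of x "q m"] show "z m \<le> e x m + \<epsilon>"
          unfolding e_def by linarith
      qed
      ultimately show ?thesis by simp
    qed
    with xM show ?thesis by blast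
  qed
  have lt: "e x n < a \<longleftrightarrow> d (q n) x < a" if "a \<le> 1" for x n a
    unfolding e_def \<delta>_def using that commute[of x "q n"] by auto
  have coord: "(\<lambda>x. e x n) \<in> borel_measurable X" for n
  proof (rule borel_measurableI_less)
    fix a
    show "{x \<in> space X. e x n < a} \<in> sets X"
    proof (cases "a \<le> 1")
      case True
      have "{x \<in> space X. e x n < a} = mball (q n) a"
        using lt[OF True] qM sp by (auto simp: mball_def)
      then show ?thesis unfolding setsX by (auto intro: sigma_sets.Basic)
    next
      case False
      then have "{x \<in> space X. e x n < a} = space X"
        using \<delta>0(2) unfolding e_def by (auto simp: not_le intro: le_less_trans)
      then show ?thesis by simp
    qed
  qed
  have e_meas: "e \<in> X \<rightarrow>\<^sub>M borel"
    by (rule measurable_coordinatewise_then_product) (rule coord)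
  have P_borel: "P \<in> sets borel"
  proof -
    have eq: "P = (\<Inter>n. {z. 0 \<le> z n} \<inter> {z. z n \<le> 1}) \<inter> (\<Inter>k. \<Union>n. {z. z n < inverse (real (Suc k))}) \<inter>
        (\<Inter>n. \<Inter>m. {z. \<delta> (q n) (q m) \<le> z n + z m} \<inter> {z. z n \<le> \<delta> (q n) (q m) + z m})"
      unfolding P_def by (intro set_eqI) (simp only: mem_Collect_eq Int_iff INT_iff UN_iff ball_UNIV bex_UNIV conj_assoc)
    have 1: "{z :: nat \<Rightarrow> real. 0 \<le> z n} \<inter> {z. z n \<le> 1} \<in> sets borel" for n
      by (intro sets.Int borel_closed closed_Collect_le continuous_intros continuous_on_product_coordinates)
    have 2: "{z :: nat \<Rightarrow> real. z n < inverse (real (Suc k))} \<in> sets borel" for n k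
      by (intro borel_open open_Collect_less continuous_intros continuous_on_product_coordinates)
    have 3: "{z :: nat \<Rightarrow> real. \<delta> (q n) (q m) \<le> z n + z m} \<inter> {z. z n \<le> \<delta> (q n) (q m) + z m} \<in> sets borel" for n m
      by (intro sets.Int borel_closed closed_Collect_le continuous_intros continuous_on_product_coordinates)
    show ?thesis unfolding eq
      by (intro sets.Int sets.countable_INT'' sets.countable_UN'' 1 2 3) simp_all
  qed
  \<comment> \<open>This is what makes the decoding map measurable. An open U is the union of the
    balls around dense points with radius 1/(j+1) that it contains, and membership in such a ball is
    a condition on one coordinate of the code.\<close>
  have pull: "\<exists>B\<in>sets borel. A = {x \<in> M. e x \<in> B}" if "A \<in> sets X" for A
    using that unfolding setsX
  proof induction
    case (Basic U)
    then have U: "openin mtopology U" by simp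
    define I where "I = {(n, j). mball (q n) (inverse (real (Suc j))) \<subseteq> U}"
    define B where "B = (\<Union>(n, j)\<in>I. {z :: nat \<Rightarrow> real. z n < inverse (real (Suc j))})"
    have "open B" unfolding B_def
      by (intro open_UN ballI)
        (auto split: prod.split intro!: open_Collect_less continuous_intros continuous_on_product_coordinates)
    moreover have "U = {x \<in> M. e x \<in> B}"
    proof (intro equalityI subsetI)
      fix x assume x: "x \<in> U"
      then have xM: "x \<in> M" using U openin_mtopology by blast
      obtain \<epsilon> where \<epsilon>: "\<epsilon> > 0" "mball x \<epsilon> \<subseteq> U" using U x openin_mtopology by blast
      obtain j where j: "inverse (real (Suc j)) < \<epsilon> / 2" using reals_Archimedean[of "\<epsilon> / 2"] \<epsilon> by auto
      obtain n where n: "d x (q n) < inverse (real (Suc j))" using dense[OF xM, of "inverse (real (Suc j))"] by auto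
      have "mball (q n) (inverse (real (Suc j))) \<subseteq> mball x \<epsilon>"
      proof
        fix y assume "y \<in> mball (q n) (inverse (real (Suc j)))"
        then have y: "y \<in> M" "d (q n) y < inverse (real (Suc j))" by auto
        with triangle[OF xM qM[of n] y(1)] n j have "d x y < \<epsilon>" by linarith
        with xM y show "y \<in> mball x \<epsilon>" by simp
      qed
      with \<epsilon> have "(n, j) \<in> I" unfolding I_def by auto
      moreover have "e x n < inverse (real (Suc j))"
        using n commute by (subst lt) (auto simp: inverse_le_1_iff)
      ultimately show "x \<in> {x \<in> M. e x \<in> B}" using xM unfolding B_def by auto
    next
      fix x assume "x \<in> {x \<in> M. e x \<in> B}"
      then obtain n j where nj: "x \<in> M" "(n, j) \<in> I" "e x n < inverse (real (Suc j))"
        unfolding B_def by auto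
      then have "d (q n) x < inverse (real (Suc j))"
        by (subst (asm) lt) (auto simp: inverse_le_1_iff)
      with nj qM show "x \<in> U" unfolding I_def by auto
    qed
    ultimately show ?case by (intro bexI[of _ B]) auto
  next
    case Empty
    then show ?case by (intro bexI[of _ "{}"]) auto
  next
    case (Compl A)
    then obtain B where "B \<in> sets borel" "A = {x \<in> M. e x \<in> B}" by blast
    then show ?case by (intro bexI[of _ "- B"]) auto
  next
    case (Union A)
    then obtain B where "\<And>i. B i \<in> sets borel" "\<And>i. A i = {x \<in> M. e x \<in> B i}" by metis
    then show ?case by (intro bexI[of _ "\<Union>i. B i"]) auto
  qed
  define r where "r = inv_into M e"
  have re: "r (e x) = x" if "x \<in> M" for x
    unfolding r_def using that inj by (intro inv_into_f_f inj_onI) auto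
  have er: "e (r z) = z" "r z \<in> M" if "z \<in> P" for z
    using surj[OF that] re by auto
  have "r \<in> restrict_space borel P \<rightarrow>\<^sub>M X"
  proof (rule measurableI)
    fix z assume "z \<in> space (restrict_space borel P)"
    then show "r z \<in> space X" using er sp by (simp add: space_restrict_space)
  next
    fix A assume "A \<in> sets X"
    then obtain B where B: "B \<in> sets borel" "A = {x \<in> M. e x \<in> B}" using pull by blast
    have "r -` A \<inter> space (restrict_space borel P) = P \<inter> B"
      using B(2) er by (auto simp: space_restrict_space)
    then show "r -` A \<inter> space (restrict_space borel P) \<in> sets (restrict_space borel P)"
      using B(1) P_borel by (simp add: sets_restrict_space_iff)
  qed
  moreover have "P \<subseteq> {z. \<forall>n. z n \<in> {0..1}}" unfolding P_def by auto
  ultimately show ?thesis using e_meas P_borel eP re er(1) sp by (intro that[of e P r]) auto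
qed

text \<open>Coding the second coordinate moves both sets into the compact product of C with the
  cube, where Borel sets are compact analytic; the projection to the codes is the continuous map of
  \<open>Lusin_separation\<close>.\<close>

lemma standard_borel_separation:
  fixes D\<^sub>1 D\<^sub>2 :: "('g::{t2_space, second_countable_topology} \<times> 'x) set"
  assumes X: "standard_borel_space X" and C: "compact C"
    and D: "D\<^sub>1 \<in> sets (borel \<Otimes>\<^sub>M X)" "D\<^sub>2 \<in> sets (borel \<Otimes>\<^sub>M X)"
    and sub: "D\<^sub>1 \<subseteq> C \<times> UNIV" "D\<^sub>2 \<subseteq> C \<times> UNIV"
    and disj: "snd ` D\<^sub>1 \<inter> snd ` D\<^sub>2 = {}"
  shows "\<exists>A\<in>sets X. snd ` D\<^sub>1 \<subseteq> A \<and> A \<inter> snd ` D\<^sub>2 = {}"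
proof -
  obtain e :: "'x \<Rightarrow> nat \<Rightarrow> real" and r P where e: "e \<in> X \<rightarrow>\<^sub>M borel" and P: "P \<in> sets borel"
    "P \<subseteq> {z. \<forall>n. z n \<in> {0..1}}" and r: "r \<in> restrict_space borel P \<rightarrow>\<^sub>M X"
    and er: "\<And>x. x \<in> space X \<Longrightarrow> e x \<in> P" "\<And>x. x \<in> space X \<Longrightarrow> r (e x) = x"
    "\<And>z. z \<in> P \<Longrightarrow> e (r z) = z"
    by (rule standard_borel_embedding[OF X]) (rule that; assumption)
  let ?H = "C \<times> {z :: nat \<Rightarrow> real. \<forall>n. z n \<in> {0..1}}"
  \<comment> \<open>Written as a preimage under the decoding map, not as an image under the coding
    map, so that it is visibly measurable.\<close>
  define I where "I D = {(g, z). z \<in> P \<and> (g, r z) \<in> D}" for D :: "('g \<times> 'x) set"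
  have I: "compact_analytic (I D) \<and> snd ` I D = e ` snd ` D"
    if D: "D \<in> sets (borel \<Otimes>\<^sub>M X)" and "D \<subseteq> C \<times> UNIV" for D
  proof
    have sp: "x \<in> space X" if "(g, x) \<in> D" for g x
      using sets.sets_into_space[OF D] that by (auto simp: space_pair_measure)
    have "(\<lambda>p. (fst p, r (snd p))) \<in> (borel :: 'g measure) \<Otimes>\<^sub>M restrict_space borel P \<rightarrow>\<^sub>M borel \<Otimes>\<^sub>M X"
      using r by measurable
    from measurable_sets[OF this D]
    have "I D \<in> sets ((borel :: 'g measure) \<Otimes>\<^sub>M restrict_space borel P)"
      by (rule back_subst[of "\<lambda>A. A \<in> sets _"])
        (auto simp: I_def space_pair_measure space_restrict_space)
    then have "I D \<in> sets (borel \<Otimes>\<^sub>M borel)" by (rule sets_pair_restrict_space[OF P(1)])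
    then have "I D \<in> sets borel" unfolding borel_prod .
    moreover have "compact ?H" by (intro compact_Times C compact_cube)
    ultimately have "compact_analytic (I D \<inter> (\<Union>n::nat. ?H))"
      by (intro compact_analytic_borel)
    moreover have "I D \<subseteq> ?H" using P(2) \<open>D \<subseteq> C \<times> UNIV\<close> unfolding I_def by auto
    ultimately show "compact_analytic (I D)" by (simp add: Int_absorb2)
    show "snd ` I D = e ` snd ` D"
    proof (intro equalityI subsetI)
      fix z assume "z \<in> snd ` I D"
      then obtain g where "z \<in> P" "(g, r z) \<in> D" unfolding I_def by auto
      then show "z \<in> e ` snd ` D" using er(3)[of z] by force
    next
      fix z assume "z \<in> e ` snd ` D"
      then obtain g x where "(g, x) \<in> D" "z = e x" by auto
      then have "(g, z) \<in> I D" using er sp unfolding I_def by auto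
      then show "z \<in> snd ` I D" by force
    qed
  qed
  have inj: "inj_on e (space X)" by (rule inj_on_inverseI[of _ r]) (rule er(2))
  have spX: "snd ` D\<^sub>1 \<subseteq> space X" "snd ` D\<^sub>2 \<subseteq> space X"
    using D[THEN sets.sets_into_space] by (auto simp: space_pair_measure)
  have "borel_separable (snd ` I D\<^sub>1) (snd ` I D\<^sub>2)"
  proof (rule Lusin_separation)
    have "e ` snd ` D\<^sub>1 \<inter> e ` snd ` D\<^sub>2 = e ` (snd ` D\<^sub>1 \<inter> snd ` D\<^sub>2)"
      using inj_on_image_Int[OF inj spX] by simp
    then show "snd ` I D\<^sub>1 \<inter> snd ` I D\<^sub>2 = {}" using I D sub disj by simp
  qed (use I D sub in \<open>auto intro: continuous_intros\<close>)
  then obtain B where B: "B \<in> sets borel" "e ` snd ` D\<^sub>1 \<subseteq> B" "B \<inter> e ` snd ` D\<^sub>2 = {}"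
    unfolding borel_separable_def using I D sub by auto
  show ?thesis
  proof (intro bexI conjI)
    show "e -` B \<inter> space X \<in> sets X" by (rule measurable_sets[OF e B(1)])
    show "snd ` D\<^sub>1 \<subseteq> e -` B \<inter> space X" using B(2) spX by auto
    show "e -` B \<inter> space X \<inter> snd ` D\<^sub>2 = {}" using B(3) by blast
  qed
qed

text \<open>A form of the Lusin--Souslin theorem. The separating sets \<open>A W\<close> decide membership of the
  unique section point in each basic open set \<open>W\<close>; compactness makes the set \<open>L x\<close> of points
  compatible with these decisions depend measurably on \<open>x\<close>.\<close>

theorem measurable_unique_section:
  fixes D :: "('g::{t2_space, second_countable_topology} \<times> 'x) set"
  assumes X: "standard_borel_space X" and C: "compact C"
    and D: "D \<in> sets (borel \<Otimes>\<^sub>M X)" and sub: "D \<subseteq> C \<times> UNIV"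
    and uniq: "\<And>g h x. (g, x) \<in> D \<Longrightarrow> (h, x) \<in> D \<Longrightarrow> g = h"
  shows "snd ` D \<in> sets X \<and> (\<exists>l \<in> X \<rightarrow>\<^sub>M borel. \<forall>x\<in>snd ` D. (l x, x) \<in> D)"
proof -
  obtain \<B> :: "'g set set" where \<B>: "countable \<B>" "topological_basis \<B>"
    using ex_countable_basis by blast
  have \<B>_open: "open W" if "W \<in> \<B>" for W using topological_basis_open[OF \<B>(2) that] .
  have "\<exists>A\<in>sets X. snd ` (D \<inter> (W \<times> space X)) \<subseteq> A \<and> A \<inter> snd ` (D - W \<times> space X) = {}"
    if "W \<in> \<B>" for W
  proof (rule standard_borel_separation[OF X C])
    have W: "W \<times> space X \<in> sets (borel \<Otimes>\<^sub>M X)" using \<B>_open[OF that] by auto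
    show "D \<inter> (W \<times> space X) \<in> sets (borel \<Otimes>\<^sub>M X)" "D - W \<times> space X \<in> sets (borel \<Otimes>\<^sub>M X)"
      using D W by auto
    show "snd ` (D \<inter> (W \<times> space X)) \<inter> snd ` (D - W \<times> space X) = {}"
      using uniq by fastforce
  qed (use sub in auto)
  then obtain A where A: "\<And>W. W \<in> \<B> \<Longrightarrow> A W \<in> sets X"
    "\<And>W. W \<in> \<B> \<Longrightarrow> snd ` (D \<inter> (W \<times> space X)) \<subseteq> A W"
    "\<And>W. W \<in> \<B> \<Longrightarrow> A W \<inter> snd ` (D - W \<times> space X) = {}" by metis
  have spD: "x \<in> space X" if "(g, x) \<in> D" for g x
    using sets.sets_into_space[OF D] that by (auto simp: space_pair_measure)
  have iff: "x \<in> A W \<longleftrightarrow> g \<in> W" if "(g, x) \<in> D" "W \<in> \<B>" for g x W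
  proof
    assume "g \<in> W"
    then have "(g, x) \<in> D \<inter> (W \<times> space X)" using that spD by auto
    then show "x \<in> A W" using A(2)[OF that(2)] by force
  next
    assume "x \<in> A W"
    show "g \<in> W"
    proof (rule ccontr)
      assume "g \<notin> W"
      then have "(g, x) \<in> D - W \<times> space X" using that by auto
      then have "x \<in> snd ` (D - W \<times> space X)" by force
      then show False using \<open>x \<in> A W\<close> A(3)[OF that(2)] by auto
    qed
  qed
  define L where "L x = C - \<Union>{W \<in> \<B>. x \<notin> A W}" for x
  define hit where "hit F = {x \<in> space X. L x \<inter> F \<noteq> {}}" for F
  have hit: "hit F \<in> sets X" if "closed F" for F
  proof -
    have cF: "compact (C \<inter> F)" using C that by (rule compact_Int_closed)
    \<comment> \<open>By compactness, \<open>L x\<close> misses F exactly when finitely many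
      rejected basic sets cover C \<inter> F. There are only countably many finite families of basic
      sets, so this is a measurable condition on x.\<close>
    define \<F> where "\<F> = {G. finite G \<and> G \<subseteq> \<B> \<and> C \<inter> F \<subseteq> \<Union>G}"
    have "countable \<F>" unfolding \<F>_def
      by (rule countable_subset[OF _ countable_Collect_finite_subset[OF \<B>(1)]]) auto
    moreover have "{x \<in> space X. \<forall>W\<in>G. x \<notin> A W} \<in> sets X" if "G \<in> \<F>" for G
    proof -
      have "{x \<in> space X. \<forall>W\<in>G. x \<notin> A W} = space X - (\<Union>W\<in>G. A W)" by auto
      moreover have "(\<Union>W\<in>G. A W) \<in> sets X"
        using that A(1) unfolding \<F>_def by (intro sets.finite_UN) auto
      ultimately show ?thesis by auto
    qed
    ultimately have meas: "(\<Union>G\<in>\<F>. {x \<in> space X. \<forall>W\<in>G. x \<notin> A W}) \<in> sets X"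
      by (intro sets.countable_UN'') auto
    have "hit F = space X - (\<Union>G\<in>\<F>. {x \<in> space X. \<forall>W\<in>G. x \<notin> A W})"
    proof (intro equalityI subsetI)
      fix x assume x: "x \<in> hit F"
      then obtain g where "g \<in> C" "g \<in> F" "\<And>W. W \<in> \<B> \<Longrightarrow> x \<notin> A W \<Longrightarrow> g \<notin> W"
        unfolding hit_def L_def by auto
      then show "x \<in> space X - (\<Union>G\<in>\<F>. {x \<in> space X. \<forall>W\<in>G. x \<notin> A W})"
        using x unfolding \<F>_def hit_def by blast
    next
      fix x assume x: "x \<in> space X - (\<Union>G\<in>\<F>. {x \<in> space X. \<forall>W\<in>G. x \<notin> A W})"
      show "x \<in> hit F"
      proof (rule ccontr)
        assume "x \<notin> hit F"
        then have "C \<inter> F \<subseteq> \<Union>{W \<in> \<B>. x \<notin> A W}" using x unfolding hit_def L_def by auto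
        then obtain G where "G \<subseteq> {W \<in> \<B>. x \<notin> A W}" "finite G" "C \<inter> F \<subseteq> \<Union>G"
          using compactE[OF cF, of "{W \<in> \<B>. x \<notin> A W}"] \<B>_open by auto
        then have "G \<in> \<F>" "\<forall>W\<in>G. x \<notin> A W" unfolding \<F>_def by auto
        then show False using x by auto
      qed
    qed
    with meas show ?thesis by auto
  qed
  \<comment> \<open>Here the decisions are consistent and leave a point, so \<open>L x\<close> is a
    singleton. \<open>S\<close> may still exceed the projection of \<open>D\<close>, which is
    recovered in the end by testing whether \<open>(l x, x)\<close> lies in
    \<open>D\<close>.\<close>
  define S where "S = hit UNIV - (\<Union>p\<in>{p \<in> \<B> \<times> \<B>. fst p \<inter> snd p = {}}. A (fst p) \<inter> A (snd p))"
  have "countable {p \<in> \<B> \<times> \<B>. fst p \<inter> snd p = {}}"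
    by (rule countable_subset[of _ "\<B> \<times> \<B>"]) (use \<B>(1) in auto)
  then have S: "S \<in> sets X"
    unfolding S_def using A(1) by (intro sets.Diff hit sets.countable_UN') auto
  have S_sep: "x \<notin> A W \<or> x \<notin> A W'" if "x \<in> S" "W \<in> \<B>" "W' \<in> \<B>" "W \<inter> W' = {}" for x W W'
    using that unfolding S_def by fastforce
  have one: "g = h" if "x \<in> S" "g \<in> L x" "h \<in> L x" for x g h
  proof (rule ccontr)
    assume "g \<noteq> h"
    then obtain U V where UV: "open U" "open V" "g \<in> U" "h \<in> V" "U \<inter> V = {}" by (metis hausdorff)
    obtain W where W: "W \<in> \<B>" "g \<in> W" "W \<subseteq> U" using topological_basisE[OF \<B>(2) UV(1,3)] by blast
    obtain W' where W': "W' \<in> \<B>" "h \<in> W'" "W' \<subseteq> V" using topological_basisE[OF \<B>(2) UV(2,4)] by blast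
    have "x \<in> A W" "x \<in> A W'" using W W' that(2,3) unfolding L_def by auto
    moreover have "W \<inter> W' = {}" using W W' UV by blast
    ultimately show False using S_sep[OF that(1) W(1) W'(1)] by blast
  qed
  \<comment> \<open>A constant default off \<open>S\<close> keeps \<open>l\<close> measurable; it
    accounts for the case distinction on \<open>undefined \<in> F\<close> below.\<close>
  define l where "l x = (if x \<in> S then (SOME g. g \<in> L x) else undefined)" for x
  have lL: "l x \<in> L x" if "x \<in> S" for x
    unfolding l_def using that some_in_eq[of "L x"] by (auto simp: S_def hit_def)
  have l: "l \<in> X \<rightarrow>\<^sub>M borel"
    unfolding borel_eq_closed
  proof (rule measurable_measure_of)
    fix F :: "'g set" assume "F \<in> Collect closed"
    then have "closed F" by simp
    have "l -` F \<inter> space X = (S \<inter> hit F) \<union> (if undefined \<in> F then space X - S else {})"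
    proof (intro set_eqI)
      fix x
      have "l x \<in> F \<longleftrightarrow> L x \<inter> F \<noteq> {}" if "x \<in> S" using lL[OF that] one[OF that] by blast
      moreover have "l x = undefined" if "x \<notin> S" using that by (simp add: l_def)
      ultimately show "x \<in> l -` F \<inter> space X \<longleftrightarrow>
          x \<in> (S \<inter> hit F) \<union> (if undefined \<in> F then space X - S else {})"
        using sets.sets_into_space[OF S] by (cases "x \<in> S") (auto simp: hit_def)
    qed
    then show "l -` F \<inter> space X \<in> sets X" using S hit[OF \<open>closed F\<close>] by auto
  qed auto
  have in_S: "x \<in> S \<and> l x = g" if "(g, x) \<in> D" for g x
  proof -
    have "g \<in> L x" unfolding L_def using that iff sub by auto
    moreover from this have "x \<in> S" unfolding S_def hit_def using iff[OF that] spD[OF that] by auto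
    ultimately show ?thesis using one lL by blast
  qed
  have eq: "snd ` D = S \<inter> ((\<lambda>x. (l x, x)) -` D \<inter> space X)"
    using in_S spD by force
  have "(\<lambda>x. (l x, x)) \<in> X \<rightarrow>\<^sub>M borel \<Otimes>\<^sub>M X" using l by measurable
  from measurable_sets[OF this D] S have "snd ` D \<in> sets X" unfolding eq by auto
  moreover have "\<forall>x\<in>snd ` D. (l x, x) \<in> D" using in_S by auto
  ultimately show ?thesis using l by blast
qed

section \<open>Summation over the return set\<close>

lemma measurable_group_uminus [measurable (raw)]:
  fixes f :: "'a \<Rightarrow> 'g::{topological_group_add, second_countable_topology, t2_space}"
  assumes "f \<in> borel_measurable M"
  shows "(\<lambda>x. - f x) \<in> borel_measurable M"
  by (rule borel_measurable_continuous_on[OF _ assms]) (intro continuous_intros)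

lemma measurable_group_diff [measurable (raw)]:
  fixes f g :: "'a \<Rightarrow> 'g::{topological_group_add, second_countable_topology, t2_space}"
  assumes "f \<in> borel_measurable M" "g \<in> borel_measurable M"
  shows "(\<lambda>x. f x - g x) \<in> borel_measurable M"
  using borel_measurable_add[OF assms(1) measurable_group_uminus[OF assms(2)]] by simp

text \<open>The occupied cells enumerate A. For return sets, which vary with the point, this
  replaces a varying index set by the fixed one of natural numbers, so that measurability can be
  checked term by term.\<close>

lemma infsum_eq_suminf_partition:
  fixes f :: "'a \<Rightarrow> ennreal" and s :: "nat \<Rightarrow> 'a"
  assumes V: "disjoint_family V" "A \<subseteq> (\<Union>i. V i)"
    and s: "\<And>i. A \<inter> V i \<noteq> {} \<Longrightarrow> A \<inter> V i = {s i}"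
  shows "infsum f A = (\<Sum>i. if A \<inter> V i \<noteq> {} then f (s i) else 0)"
proof -
  let ?I = "{i. A \<inter> V i \<noteq> {}}"
  have "bij_betw s ?I A"
  proof (rule bij_betw_imageI)
    have mem: "s i \<in> V i" "s i \<in> A" if "i \<in> ?I" for i using s[of i] that by auto
    show "inj_on s ?I"
      using mem V(1) unfolding inj_on_def disjoint_family_on_def by (metis UNIV_I disjoint_iff)
    show "s ` ?I = A"
    proof (intro equalityI subsetI)
      fix a assume a: "a \<in> A"
      then obtain i where i: "a \<in> V i" using V(2) by auto
      then have "A \<inter> V i \<noteq> {}" using a by blast
      with s[of i] a i have "a = s i" "i \<in> ?I" by auto
      then show "a \<in> s ` ?I" by blast
    qed (use mem in auto)
  qed
  then have "infsum f A = infsum (\<lambda>i. f (s i)) ?I"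
    by (rule infsum_reindex_bij_betw[symmetric])
  also have "\<dots> = infsum (\<lambda>i. if A \<inter> V i \<noteq> {} then f (s i) else 0) UNIV"
    by (rule infsum_cong_neutral) auto
  also have "\<dots> = (\<Sum>i. if A \<inter> V i \<noteq> {} then f (s i) else 0)"
    by (rule sums_unique[OF has_sum_imp_sums[OF has_sum_infsum[OF nonneg_summable_on_complete]]]) simp
  finally show ?thesis .
qed

lemma suminf_swap_ennreal:
  fixes f :: "nat \<Rightarrow> nat \<Rightarrow> ennreal"
  shows "(\<Sum>i. \<Sum>j. f i j) = (\<Sum>j. \<Sum>i. f i j)"
  using nn_integral_suminf[of "\<lambda>j i. f i j" "count_space UNIV"] by (simp add: nn_integral_count_space_nat)

locale separated_action =
  fixes act :: "'g::{topological_group_add, second_countable_topology, t2_space} \<Rightarrow> 'x \<Rightarrow> 'x"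
    and X :: "'x measure" and Y :: "'x set" and K :: "nat \<Rightarrow> 'g set"
  assumes standard: "standard_borel_space X"
    and action: "borel_action act X"
    and cross: "cross_section act X Y"
    and separated: "separated act Y"
    and exhaustion: "fundamental_exhaustion K"
begin

lemma measurable_act [measurable (raw)]:
  assumes "f \<in> borel_measurable N" "k \<in> N \<rightarrow>\<^sub>M X"
  shows "(\<lambda>z. act (f z) (k z)) \<in> N \<rightarrow>\<^sub>M X"
proof -
  have "(\<lambda>(g, x). act g x) \<in> borel \<Otimes>\<^sub>M X \<rightarrow>\<^sub>M X" using action unfolding borel_action_def by blast
  from measurable_compose[OF measurable_Pair[OF assms] this] show ?thesis by simp
qed

lemma act_space [simp]: "x \<in> space X \<Longrightarrow> act g x \<in> space X"
  by (rule measurable_space[OF measurable_act[of "\<lambda>_. g" X "\<lambda>x. x"]]) simp_all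

lemma act_zero [simp]: "x \<in> space X \<Longrightarrow> act 0 x = x"
  and act_act: "x \<in> space X \<Longrightarrow> act g (act h x) = act (g + h) x"
  using action unfolding borel_action_def by auto

lemma act_minus [simp]:
  "x \<in> space X \<Longrightarrow> act (- g) (act g x) = x" "x \<in> space X \<Longrightarrow> act g (act (- g) x) = x"
  by (simp_all add: act_act)

lemma act_image: "A \<subseteq> space X \<Longrightarrow> act g ` A = act (- g) -` A \<inter> space X"
  by (force intro: rev_image_eqI)

lemma Y_sets [measurable]: "Y \<in> sets X"
  using cross unfolding cross_section_def by blast

lemma Y_subset: "y \<in> Y \<Longrightarrow> y \<in> space X"
  using sets.sets_into_space[OF Y_sets] by blast

lemma space_Y: "space (restrict_space X Y) = Y"
  using Y_subset by (auto simp: space_restrict_space)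

lemma K_compact: "compact (K n)" and K_UN: "(\<Union>n. K n) = UNIV" and K_mono: "incseq K"
  and K_absorbs: "compact C \<Longrightarrow> \<exists>n. C \<subseteq> K n"
  using exhaustion unfolding fundamental_exhaustion_def by auto

lemma return_set_nonempty: "x \<in> space X \<Longrightarrow> \<exists>g. g \<in> return_set act Y x"
proof -
  assume x: "x \<in> space X"
  then have "x \<in> translates act UNIV Y" using cross unfolding cross_section_def by simp
  then obtain g y where "y \<in> Y" "x = act g y" unfolding translates_def by auto
  then have "- g \<in> return_set act Y x" using Y_subset by (simp add: return_set_def)
  then show ?thesis by blast
qed

section \<open>Pieces of the group that hold at most one return\<close>

definition small :: "'g set \<Rightarrow> bool" where
  "small W \<longleftrightarrow> (\<forall>x\<in>space X. \<forall>g\<in>return_set act Y x \<inter> W. \<forall>h\<in>return_set act Y x \<inter> W. g = h)"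

lemma smallD:
  "small W \<Longrightarrow> x \<in> space X \<Longrightarrow> act g x \<in> Y \<Longrightarrow> act h x \<in> Y \<Longrightarrow> g \<in> W \<Longrightarrow> h \<in> W \<Longrightarrow> g = h"
  unfolding small_def return_set_def by blast

lemma small_mono: "small W \<Longrightarrow> W' \<subseteq> W \<Longrightarrow> small W'"
  unfolding small_def by blast

text \<open>Two returns g and h of x differ by \<open>g - h\<close>, which carries the point
  \<open>act h x\<close> of Y to the point \<open>act g x\<close> of Y. Separatedness forces g = h
  once all differences of W lie in U, and continuity of subtraction at (g, g) provides such a W
  around g.\<close>

lemma ex_small_cover: "\<exists>\<W>. countable \<W> \<and> (\<forall>W\<in>\<W>. open W \<and> small W) \<and> \<Union>\<W> = UNIV"
proof -
  obtain U where U: "open U" "0 \<in> U" "{g. act g ` Y \<inter> Y \<noteq> {}} \<inter> U = {0}"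
    using separated unfolding separated_def by blast
  have small: "small W" if W: "\<forall>a\<in>W. \<forall>b\<in>W. a - b \<in> U" for W
    unfolding small_def
  proof (intro ballI)
    fix x g h assume x: "x \<in> space X" and g: "g \<in> return_set act Y x \<inter> W"
      and h: "h \<in> return_set act Y x \<inter> W"
    have "act (g - h) (act h x) = act g x" using x by (simp add: act_act)
    then have "act (g - h) ` Y \<inter> Y \<noteq> {}" using g h unfolding return_set_def by force
    moreover have "g - h \<in> U" using W g h by blast
    ultimately have "g - h = 0" using U(3) by blast
    then show "g = h" by simp
  qed
  obtain \<B> :: "'g set set" where \<B>: "countable \<B>" "topological_basis \<B>"
    using ex_countable_basis by blast
  define \<W> where "\<W> = {W \<in> \<B>. \<forall>a\<in>W. \<forall>b\<in>W. a - b \<in> U}"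
  have "\<exists>W\<in>\<W>. g \<in> W" for g
  proof -
    let ?O = "(\<lambda>p :: 'g \<times> 'g. fst p - snd p) -` U"
    have "continuous_on UNIV (\<lambda>p :: 'g \<times> 'g. fst p - snd p)" by (intro continuous_intros)
    then have "open ?O" using U(1) open_vimage by blast
    moreover have "(g, g) \<in> ?O" using U(2) by simp
    ultimately obtain A B where AB: "open A" "open B" "(g, g) \<in> A \<times> B" "A \<times> B \<subseteq> ?O"
      by (rule open_prod_elim)
    then obtain W where W: "W \<in> \<B>" "g \<in> W" "W \<subseteq> A \<inter> B"
      using topological_basisE[OF \<B>(2), of "A \<inter> B" g] by auto
    have "a - b \<in> U" if "a \<in> W" "b \<in> W" for a b
    proof -
      have "(a, b) \<in> ?O" using that W(3) AB(4) by blast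
      then show ?thesis by simp
    qed
    with W show ?thesis unfolding \<W>_def by blast
  qed
  moreover have "countable \<W>" using \<B>(1) unfolding \<W>_def by simp
  moreover have "\<forall>W\<in>\<W>. open W \<and> small W"
    using small topological_basis_open[OF \<B>(2)] unfolding \<W>_def by blast
  ultimately show ?thesis by (intro exI[of _ \<W>]) auto
qed

lemma ex_finite_small_cover:
  assumes "compact C"
  shows "\<exists>\<W>. finite \<W> \<and> (\<forall>W\<in>\<W>. open W \<and> small W) \<and> C \<subseteq> \<Union>\<W>"
proof -
  obtain \<W> where "countable \<W> \<and> (\<forall>W\<in>\<W>. open W \<and> small W) \<and> \<Union>\<W> = UNIV"
    using ex_small_cover ..
  then have \<W>: "\<And>W. W \<in> \<W> \<Longrightarrow> open W \<and> small W" "\<Union>\<W> = UNIV" by simp_all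
  obtain \<W>' where "\<W>' \<subseteq> \<W>" "finite \<W>'" "C \<subseteq> \<Union>\<W>'"
    using compactE[OF assms, of \<W>] \<W> by auto
  with \<W> show ?thesis by (intro exI[of _ \<W>']) auto
qed

text \<open>Disjointness makes every return count once; intersecting with the sets
  \<open>K k\<close> makes the pieces relatively compact, as
  \<open>measurable_unique_section\<close> requires.\<close>

lemma ex_partition:
  "\<exists>V :: nat \<Rightarrow> 'g set. (\<forall>i. V i \<in> sets borel) \<and> disjoint_family V \<and> (\<Union>i. V i) = UNIV \<and>
     (\<forall>i. small (V i) \<and> (\<exists>C. compact C \<and> V i \<subseteq> C))"
proof -
  obtain \<W> where "countable \<W> \<and> (\<forall>W\<in>\<W>. open W \<and> small W) \<and> \<Union>\<W> = UNIV"
    using ex_small_cover ..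
  then have \<W>: "countable \<W>" "\<And>W. W \<in> \<W> \<Longrightarrow> open W \<and> small W" "\<Union>\<W> = UNIV" by simp_all
  then have "\<W> \<noteq> {}" by auto
  define W where "W = from_nat_into \<W>"
  have W: "open (W n)" "small (W n)" for n
    using \<W>(2) from_nat_into[OF \<open>\<W> \<noteq> {}\<close>] unfolding W_def by auto
  have W_UN: "\<exists>n. g \<in> W n" for g
  proof -
    have "g \<in> \<Union>\<W>" using \<W>(3) by simp
    then obtain V where "V \<in> \<W>" "g \<in> V" by (rule UnionE)
    then show ?thesis using from_nat_into_surj[OF \<W>(1)] unfolding W_def by metis
  qed
  define A where "A p = W (fst (prod_decode p)) \<inter> K (snd (prod_decode p))" for p
  have A_borel: "A p \<in> sets borel" for p
    unfolding A_def using W(1) K_compact by (intro sets.Int borel_open borel_compact)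
  have A_UN: "(\<Union>p. A p) = UNIV"
  proof (intro equalityI subsetI UNIV_I)
    fix g
    obtain n k where "g \<in> W n" "g \<in> K k" using W_UN K_UN by (metis UNIV_I UN_E)
    then have "g \<in> A (prod_encode (n, k))" unfolding A_def by simp
    then show "g \<in> (\<Union>p. A p)" by blast
  qed
  show ?thesis
  proof (intro exI[of _ "disjointed A"] conjI allI)
    fix i
    show "disjointed A i \<in> sets borel"
      using sets.range_disjointed_sets[of A borel] A_borel by auto
    have "disjointed A i \<subseteq> A i" by (rule disjointed_subset)
    then have "disjointed A i \<subseteq> W (fst (prod_decode i))" "disjointed A i \<subseteq> K (snd (prod_decode i))"
      unfolding A_def by auto
    then show "small (disjointed A i)" "\<exists>C. compact C \<and> disjointed A i \<subseteq> C"
      using small_mono[OF W(2)] K_compact by (simp, intro exI conjI)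
  qed (auto simp: disjoint_family_disjointed UN_disjointed_eq A_UN)
qed

definition part :: "nat \<Rightarrow> 'g set" where
  "part = (SOME V. (\<forall>i. V i \<in> sets borel) \<and> disjoint_family V \<and> (\<Union>i. V i) = UNIV \<and>
     (\<forall>i. small (V i) \<and> (\<exists>C. compact C \<and> V i \<subseteq> C)))"

lemma part_props:
  "(\<forall>i. part i \<in> sets borel) \<and> disjoint_family part \<and> (\<Union>i. part i) = UNIV \<and>
     (\<forall>i. small (part i) \<and> (\<exists>C. compact C \<and> part i \<subseteq> C))"
  unfolding part_def by (rule someI_ex[OF ex_partition])

lemma part_borel [measurable]: "part i \<in> sets borel"
  and part_disjoint: "disjoint_family part"
  and part_UN: "(\<Union>i. part i) = UNIV"
  and part_small: "small (part i)"
  and part_compact: "\<exists>C. compact C \<and> part i \<subseteq> C"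
  using part_props by simp_all

lemma part_unique: "g \<in> part i \<Longrightarrow> g \<in> part j \<Longrightarrow> i = j"
  using part_disjoint unfolding disjoint_family_on_def by blast

section \<open>Measurable enumeration of the returns\<close>

definition cell :: "nat \<Rightarrow> 'x set" where
  "cell i = {x \<in> space X. return_set act Y x \<inter> part i \<noteq> {}}"

text \<open>The pairs (g, x) with g a return of x in \<open>part i\<close> form a measurable set
  over a compact part of G, with at most one g for each x.\<close>

lemma ex_section:
  "cell i \<in> sets X \<and> (\<exists>l \<in> X \<rightarrow>\<^sub>M borel. \<forall>x\<in>cell i. l x \<in> part i \<and> act (l x) x \<in> Y)"
proof -
  define D where "D = {z \<in> space (borel \<Otimes>\<^sub>M X). fst z \<in> part i \<and> act (fst z) (snd z) \<in> Y}"
  obtain C where C: "compact C" "part i \<subseteq> C" using part_compact by blast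
  have D_iff: "(g, x) \<in> D \<longleftrightarrow> x \<in> space X \<and> g \<in> part i \<and> act g x \<in> Y" for g x
    unfolding D_def by (auto simp: space_pair_measure)
  have "D \<in> sets (borel \<Otimes>\<^sub>M X)" unfolding D_def by measurable
  moreover have "g = h" if "(g, x) \<in> D" "(h, x) \<in> D" for g h x
    using that smallD[OF part_small] unfolding D_iff by blast
  moreover have "D \<subseteq> C \<times> UNIV" using C(2) D_iff by auto
  ultimately have *: "snd ` D \<in> sets X \<and> (\<exists>l \<in> X \<rightarrow>\<^sub>M borel. \<forall>x\<in>snd ` D. (l x, x) \<in> D)"
    by (intro measurable_unique_section[OF standard C(1)])
  have "snd ` D = cell i"
  proof (intro set_eqI iffI)
    fix x assume "x \<in> snd ` D"
    then obtain g where "(g, x) \<in> D" by auto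
    then show "x \<in> cell i" unfolding D_iff cell_def return_set_def by auto
  next
    fix x assume "x \<in> cell i"
    then obtain g where "(g, x) \<in> D" unfolding D_iff cell_def return_set_def by auto
    then show "x \<in> snd ` D" by force
  qed
  with * show ?thesis unfolding D_iff by auto
qed

definition sec :: "nat \<Rightarrow> 'x \<Rightarrow> 'g" where
  "sec i = (SOME l. l \<in> X \<rightarrow>\<^sub>M borel \<and> (\<forall>x\<in>cell i. l x \<in> part i \<and> act (l x) x \<in> Y))"

lemma cell_sets [measurable]: "cell i \<in> sets X"
  and sec_measurable [measurable]: "sec i \<in> X \<rightarrow>\<^sub>M borel"
  and sec_part: "x \<in> cell i \<Longrightarrow> sec i x \<in> part i"
  and sec_act: "x \<in> cell i \<Longrightarrow> act (sec i x) x \<in> Y"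
proof -
  have "\<exists>l. l \<in> X \<rightarrow>\<^sub>M borel \<and> (\<forall>x\<in>cell i. l x \<in> part i \<and> act (l x) x \<in> Y)"
    using ex_section[of i] by blast
  from someI_ex[OF this, folded sec_def] show "sec i \<in> X \<rightarrow>\<^sub>M borel" "x \<in> cell i \<Longrightarrow> sec i x \<in> part i"
    "x \<in> cell i \<Longrightarrow> act (sec i x) x \<in> Y"
    by simp_all
  show "cell i \<in> sets X" using ex_section ..
qed

lemma secI:
  assumes "x \<in> space X" "act g x \<in> Y" "g \<in> part i"
  shows "x \<in> cell i" "sec i x = g"
proof -
  show "x \<in> cell i" using assms unfolding cell_def return_set_def by blast
  with sec_part sec_act show "sec i x = g" using smallD[OF part_small assms(1)] assms by blast
qed

lemma ex_cell: "x \<in> space X \<Longrightarrow> \<exists>i. x \<in> cell i"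
  using return_set_nonempty[of x] part_UN unfolding cell_def by blast

lemma suminf_indicator_part: "(\<Sum>i. indicator (part i) g) = (1 :: ennreal)"
proof -
  obtain i where i: "g \<in> part i" using part_UN by blast
  then have "(\<lambda>k. indicator (part k) g) = (\<lambda>k. if k = i then 1 else 0 :: ennreal)"
    using part_unique by (fastforce simp: indicator_def)
  then show ?thesis by (simp add: sums_unique[OF sums_single, symmetric])
qed

text \<open>With h = - g this runs over all (h, y) with y \<in> Y and h.y = x: it is the sum of F
  over the fibre of the action map G x Y \<rightarrow> X. For an indicator it counts the fibre
  points in the set.\<close>

definition trans_sum :: "('g \<times> 'x \<Rightarrow> ennreal) \<Rightarrow> 'x \<Rightarrow> ennreal" where
  "trans_sum F x = (\<Sum>\<^sub>\<infinity>g\<in>return_set act Y x. F (- g, act g x))"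

lemma trans_sum_cong:
  "(\<And>g y. y \<in> Y \<Longrightarrow> act g y = x \<Longrightarrow> F (g, y) = G (g, y)) \<Longrightarrow> x \<in> space X \<Longrightarrow> trans_sum F x = trans_sum G x"
  unfolding trans_sum_def by (rule infsum_cong) (simp add: return_set_def)

lemma trans_sum_eq_suminf:
  assumes x: "x \<in> space X"
  shows "trans_sum F x = (\<Sum>i. indicator (cell i) x * F (- sec i x, act (sec i x) x))"
proof -
  have s: "return_set act Y x \<inter> part i = {sec i x}" if "return_set act Y x \<inter> part i \<noteq> {}" for i
    using that x secI(2)[OF x] unfolding return_set_def by blast
  have "trans_sum F x = (\<Sum>i. if return_set act Y x \<inter> part i \<noteq> {}
      then F (- sec i x, act (sec i x) x) else 0)"
    unfolding trans_sum_def
    using s part_UN by (intro infsum_eq_suminf_partition part_disjoint) auto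
  also have "\<dots> = (\<Sum>i. indicator (cell i) x * F (- sec i x, act (sec i x) x))"
    using x by (intro suminf_cong) (simp add: cell_def)
  finally show ?thesis .
qed

lemma trans_sum_measurable [measurable (raw)]:
  assumes [measurable]: "F \<in> borel_measurable (borel \<Otimes>\<^sub>M X)"
  shows "trans_sum F \<in> borel_measurable X"
proof -
  have "(\<lambda>x. \<Sum>i. indicator (cell i) x * F (- sec i x, act (sec i x) x)) \<in> borel_measurable X"
    by measurable
  then show ?thesis by (subst measurable_cong[OF trans_sum_eq_suminf])
qed

text \<open>Moving x by g translates its fibre from the left by g; on return times the substitution
  is \<open>h - g\<close>. This is how invariance on X becomes left invariance on G x Y.\<close>

lemma trans_sum_act:
  assumes x: "x \<in> space X"
  shows "trans_sum F (act g x) = trans_sum (\<lambda>(h, y). F (g + h, y)) x"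
proof -
  have "bij_betw (\<lambda>h. h - g) (return_set act Y x) (return_set act Y (act g x))"
  proof (rule bij_betw_byWitness[of _ "\<lambda>h. h + g"])
    show "(\<lambda>h. h - g) ` return_set act Y x \<subseteq> return_set act Y (act g x)"
      using x by (auto simp: return_set_def act_act)
    show "(\<lambda>h. h + g) ` return_set act Y (act g x) \<subseteq> return_set act Y x"
      using x by (auto simp: return_set_def act_act)
  qed auto
  from infsum_reindex_bij_betw[OF this, of "\<lambda>k. F (- k, act k (act g x))"]
  show ?thesis using x unfolding trans_sum_def by (simp add: act_act)
qed

text \<open>Along the fibre of x the factor is constantly \<open>k x\<close>.\<close>

lemma trans_sum_mult_right:
  assumes x: "x \<in> space X"
  shows "trans_sum (\<lambda>z. F z * k (act (fst z) (snd z))) x = trans_sum F x * k x"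
  using x unfolding trans_sum_eq_suminf[OF x]
  by (simp add: mult.assoc[symmetric] ennreal_suminf_multc)

lemma trans_sum_ge:
  assumes "g \<in> return_set act Y x"
  shows "F (- g, act g x) \<le> trans_sum F x"
proof -
  have "(\<Sum>h\<in>{g}. F (- h, act h x)) \<le> trans_sum F x"
    unfolding trans_sum_def using assms
    by (subst nonneg_infsum_complete) (auto intro!: SUP_upper simp del: sum.insert)
  then show ?thesis by simp
qed

lemma trans_sum_single:
  assumes "g \<in> return_set act Y x"
    and "\<And>h. h \<in> return_set act Y x \<Longrightarrow> h \<noteq> g \<Longrightarrow> F (- h, act h x) = 0"
  shows "trans_sum F x = F (- g, act g x)"
proof -
  have "trans_sum F x = (\<Sum>\<^sub>\<infinity>h\<in>{g}. F (- h, act h x))"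
    unfolding trans_sum_def by (rule infsum_cong_neutral) (use assms in auto)
  then show ?thesis by simp
qed

lemma trans_sum_0: "(\<And>g. g \<in> return_set act Y x \<Longrightarrow> F (- g, act g x) = 0) \<Longrightarrow> trans_sum F x = 0"
  unfolding trans_sum_def by (rule infsum_0) auto

section \<open>One chosen representation for every point\<close>

definition first :: "'x \<Rightarrow> nat" where
  "first x = (LEAST i. x \<in> cell i)"

lemma first_measurable [measurable]: "first \<in> X \<rightarrow>\<^sub>M count_space UNIV"
  unfolding first_def by measurable

lemma first_cell: "x \<in> space X \<Longrightarrow> x \<in> cell (first x)"
  unfolding first_def using ex_cell by (rule LeastI_ex)

text \<open>A set containing exactly one representation of each point \<open>x\<close> as \<open>act g y\<close> with \<open>y \<in> Y\<close>.\<close>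

definition fundamental :: "('g \<times> 'x) set" where
  "fundamental = {z \<in> space (borel \<Otimes>\<^sub>M X). - fst z \<in> part (first (act (fst z) (snd z)))}"

lemma fundamental_sets [measurable]: "fundamental \<in> sets (borel \<Otimes>\<^sub>M X)"
proof -
  have "fundamental = (\<Union>i. {z \<in> space (borel \<Otimes>\<^sub>M X). first (act (fst z) (snd z)) = i \<and> - fst z \<in> part i})"
    unfolding fundamental_def by auto
  also have "\<dots> \<in> sets (borel \<Otimes>\<^sub>M X)" by measurable
  finally show ?thesis .
qed

text \<open>The least part of G that contains a return of x contains exactly one, and
  \<open>fundamental\<close> retains only the fibre point belonging to it.\<close>

lemma trans_sum_fundamental: "x \<in> space X \<Longrightarrow> trans_sum (indicator fundamental) x = 1"
proof -
  assume x: "x \<in> space X"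
  let ?i = "first x"
  have c: "x \<in> cell ?i" by (rule first_cell[OF x])
  have mem: "(- h, act h x) \<in> fundamental \<longleftrightarrow> h \<in> part ?i" for h
    unfolding fundamental_def using x by (simp add: space_pair_measure)
  have "trans_sum (indicator fundamental) x = indicator fundamental (- sec ?i x, act (sec ?i x) x)"
  proof (rule trans_sum_single)
    show "sec ?i x \<in> return_set act Y x" using sec_act[OF c] by (simp add: return_set_def)
    fix h assume "h \<in> return_set act Y x" "h \<noteq> sec ?i x"
    then show "indicator fundamental (- h, act h x) = 0"
      using secI(2)[OF x, of h ?i] mem[of h] by (auto simp: return_set_def indicator_def)
  qed
  then show ?thesis using mem sec_part[OF c] by simp
qed

text \<open>Local finiteness with a uniform bound: \<open>- C\<close> is covered by finitely many
  small sets, each holding at most one return of x. The inverse appears because a return g gives the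
  fibre coordinate - g. The bound depends on C alone and yields finiteness on G x Y from finiteness
  on X.\<close>

lemma trans_sum_compact_le:
  assumes "compact C"
  shows "\<exists>N :: nat. \<forall>x\<in>space X. \<forall>A.
    trans_sum (indicator (C \<times> A)) x \<le> of_nat N * indicator (translates act C (A \<inter> Y)) x"
proof -
  have "compact (uminus ` C)"
    by (intro compact_continuous_image continuous_intros assms)
  from ex_finite_small_cover[OF this] obtain \<W> where
    "finite \<W> \<and> (\<forall>W\<in>\<W>. open W \<and> small W) \<and> uminus ` C \<subseteq> \<Union>\<W>" ..
  then have \<W>: "finite \<W>" "\<And>W. W \<in> \<W> \<Longrightarrow> small W" "uminus ` C \<subseteq> \<Union>\<W>" by simp_all
  have "trans_sum (indicator (C \<times> A)) x \<le> of_nat (card \<W>) * indicator (translates act C (A \<inter> Y)) x"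
    if x: "x \<in> space X" for x A
  proof (cases "x \<in> translates act C (A \<inter> Y)")
    case True
    let ?R = "return_set act Y x \<inter> uminus ` C"
    have R: "finite ?R \<and> card ?R \<le> card \<W>"
    proof -
      have "\<exists>W\<in>\<W>. h \<in> W" if "h \<in> ?R" for h using that \<W>(3) by blast
      then obtain w where w: "\<And>h. h \<in> ?R \<Longrightarrow> w h \<in> \<W> \<and> h \<in> w h" by metis
      have "inj_on w ?R"
      proof (rule inj_onI)
        fix g h assume gh: "g \<in> ?R" "h \<in> ?R" "w g = w h"
        then show "g = h" using w[of g] w[of h] \<W>(2) smallD[OF _ x, of "w g" g h]
          by (auto simp: return_set_def)
      qed
      moreover have "w ` ?R \<subseteq> \<W>" using w by blast
      ultimately show ?thesis
        using card_inj_on_le[of w ?R \<W>] inj_on_finite[of w ?R \<W>] \<W>(1) by simp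
    qed
    have "trans_sum (indicator (C \<times> A)) x = (\<Sum>\<^sub>\<infinity>g\<in>?R. indicator (C \<times> A) (- g, act g x))"
      unfolding trans_sum_def
      by (rule infsum_cong_neutral) (force simp: indicator_def image_iff)+
    also have "\<dots> = (\<Sum>g\<in>?R. indicator (C \<times> A) (- g, act g x))" using R by simp
    also have "\<dots> \<le> (\<Sum>g\<in>?R. 1)" by (rule sum_mono) (simp add: indicator_def)
    also have "\<dots> \<le> of_nat (card \<W>)" using R by simp
    finally show ?thesis using True by simp
  next
    case False
    have "trans_sum (indicator (C \<times> A)) x = 0"
    proof (rule trans_sum_0)
      fix g assume "g \<in> return_set act Y x"
      then have "x \<in> translates act C (A \<inter> Y)" if "- g \<in> C" "act g x \<in> A"
        using that x unfolding translates_def return_set_def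
        by (auto intro!: bexI[of _ "- g"] rev_image_eqI[of "act g x"])
      with False show "indicator (C \<times> A) (- g, act g x) = (0 :: ennreal)"
        by (auto simp: indicator_def)
    qed
    then show ?thesis by simp
  qed
  then show ?thesis by blast
qed

text \<open>The matching lower bound, used for finiteness in the opposite direction.\<close>

lemma trans_sum_translates_pos:
  assumes "x \<in> translates act C (A \<inter> Y)"
  shows "1 \<le> trans_sum (indicator (C \<times> A)) x"
proof -
  obtain g y where gy: "g \<in> C" "y \<in> A" "y \<in> Y" "x = act g y"
    using assms unfolding translates_def by auto
  then have y: "act (- g) x = y" using Y_subset by simp
  then have "- g \<in> return_set act Y x" using gy by (simp add: return_set_def)
  from trans_sum_ge[OF this, of "indicator (C \<times> A)"] show ?thesis using gy y by simp
qed

text \<open>An image under the action is not measurable for free; here it is the set where the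
  measurable fibre count of \<open>C \<times> A\<close> is at least 1.\<close>

lemma translates_sets:
  assumes C: "C \<in> sets borel" and A: "A \<in> sets X" "A \<subseteq> Y"
  shows "translates act C A \<in> sets X"
proof -
  have *: "A \<inter> Y = A" using A(2) by auto
  have "x \<in> translates act C A \<longleftrightarrow> 1 \<le> trans_sum (indicator (C \<times> A)) x" if x: "x \<in> space X" for x
  proof
    assume "1 \<le> trans_sum (indicator (C \<times> A)) x"
    then have "trans_sum (indicator (C \<times> A)) x \<noteq> 0" by auto
    then obtain g where g: "g \<in> return_set act Y x" "indicator (C \<times> A) (- g, act g x) \<noteq> (0 :: ennreal)"
      using trans_sum_0[of x "indicator (C \<times> A)"] by blast
    then have "- g \<in> C" "act g x \<in> A" by (auto simp: indicator_def split: if_splits)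
    then show "x \<in> translates act C A" using x unfolding translates_def
      by (auto intro!: bexI[of _ "- g"] rev_image_eqI[of "act g x"])
  qed (use trans_sum_translates_pos[of x C A] * in simp)
  moreover have "translates act C A \<subseteq> space X"
    using A(2) Y_subset unfolding translates_def by auto
  ultimately have "translates act C A = {x \<in> space X. 1 \<le> trans_sum (indicator (C \<times> A)) x}"
    by blast
  also have "\<dots> \<in> sets X"
  proof -
    have "C \<times> A \<in> sets (borel \<Otimes>\<^sub>M X)" using C A by auto
    then have [measurable]: "trans_sum (indicator (C \<times> A)) \<in> borel_measurable X"
      by (intro trans_sum_measurable borel_measurable_indicator)
    show ?thesis by measurable
  qed
  finally show ?thesis .
qed

text \<open>X is only a measurable space, so equality is tested on the codes of the standard Borel
  embedding.\<close>

lemma measurable_eq_set: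
  assumes f: "f \<in> N \<rightarrow>\<^sub>M X" and k: "k \<in> N \<rightarrow>\<^sub>M X"
  shows "{z \<in> space N. f z = k z} \<in> sets N"
proof -
  obtain e :: "'x \<Rightarrow> nat \<Rightarrow> real" and r P where e: "e \<in> X \<rightarrow>\<^sub>M borel" and "P \<in> sets borel"
    "P \<subseteq> {z. \<forall>n. z n \<in> {0..1}}" and "r \<in> restrict_space borel P \<rightarrow>\<^sub>M X"
    and "\<And>x. x \<in> space X \<Longrightarrow> e x \<in> P" and re: "\<And>x. x \<in> space X \<Longrightarrow> r (e x) = x"
    and "\<And>z. z \<in> P \<Longrightarrow> e (r z) = z"
    by (rule standard_borel_embedding[OF standard]) (rule that; assumption)
  have "{z \<in> space N. f z = k z} = {z \<in> space N. e (f z) = e (k z)}"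
    using re measurable_space[OF f] measurable_space[OF k] by metis
  also have "\<dots> \<in> sets N"
    using measurable_compose[OF f e] measurable_compose[OF k e] by (rule measurable_equality_set)
  finally show ?thesis .
qed

end

section \<open>Uniqueness of Haar measure and restriction to the cross section\<close>

text \<open>Invariance is defined through images; an image under the inverse \<tau>' is a preimage
  under \<tau>, so M is its own pushforward.\<close>

lemma nn_integral_invariant_map:
  assumes \<tau>: "\<tau> \<in> M \<rightarrow>\<^sub>M M"
    and inverse: "\<And>x. x \<in> space M \<Longrightarrow> \<tau>' x \<in> space M" "\<And>x. x \<in> space M \<Longrightarrow> \<tau>' (\<tau> x) = x"
      "\<And>x. x \<in> space M \<Longrightarrow> \<tau> (\<tau>' x) = x"
    and inv: "\<And>A. A \<in> sets M \<Longrightarrow> emeasure M (\<tau>' ` A) = emeasure M A"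
    and f: "f \<in> borel_measurable M"
  shows "(\<integral>\<^sup>+x. f (\<tau> x) \<partial>M) = (\<integral>\<^sup>+x. f x \<partial>M)"
proof -
  have "distr M M \<tau> = M"
  proof (rule measure_eqI)
    fix A assume "A \<in> sets (distr M M \<tau>)"
    then have A: "A \<in> sets M" by simp
    have "\<tau> -` A \<inter> space M = \<tau>' ` A"
      using inverse measurable_space[OF \<tau>] sets.sets_into_space[OF A]
      by (auto intro: rev_image_eqI)
    then show "emeasure (distr M M \<tau>) A = emeasure M A"
      using A inv by (simp add: emeasure_distr[OF \<tau>])
  qed simp
  then show ?thesis using nn_integral_distr[OF \<tau>, of f] f by simp
qed

text \<open>Uniqueness of Haar measure up to scaling, by Fubini: substituting \<open>y \<mapsto> y + x\<close>,
  \<open>x \<mapsto> - y + x\<close> and \<open>y \<mapsto> x + y\<close> in turn moves the variable of \<open>k\<close> from one measure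
  to the other.\<close>

lemma invariant_measures_swap:
  fixes m \<kappa> :: "'g::{topological_group_add, second_countable_topology, t2_space} measure"
  assumes fin: "sigma_finite_measure m" "sigma_finite_measure \<kappa>"
    and [measurable_cong]: "sets m = sets borel" "sets \<kappa> = sets borel"
    and left: "\<And>f g. f \<in> borel_measurable borel \<Longrightarrow> (\<integral>\<^sup>+x. f (g + x) \<partial>m) = (\<integral>\<^sup>+x. f x \<partial>m)"
    and right: "\<And>f g. f \<in> borel_measurable borel \<Longrightarrow> (\<integral>\<^sup>+x. f (x + g) \<partial>m) = (\<integral>\<^sup>+x. f x \<partial>m)"
    and left': "\<And>f g. f \<in> borel_measurable borel \<Longrightarrow> (\<integral>\<^sup>+x. f (g + x) \<partial>\<kappa>) = (\<integral>\<^sup>+x. f x \<partial>\<kappa>)"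
    and f [measurable]: "f \<in> borel_measurable borel" and k [measurable]: "k \<in> borel_measurable borel"
  shows "(\<integral>\<^sup>+x. f x \<partial>\<kappa>) * (\<integral>\<^sup>+y. k y \<partial>m) = (\<integral>\<^sup>+x. k x \<partial>\<kappa>) * (\<integral>\<^sup>+y. f (- y) \<partial>m)"
proof -
  interpret m: sigma_finite_measure m by (rule fin)
  interpret l: sigma_finite_measure \<kappa> by (rule fin)
  interpret pair_sigma_finite \<kappa> m ..
  have "(\<integral>\<^sup>+x. f x \<partial>\<kappa>) * (\<integral>\<^sup>+y. k y \<partial>m) = (\<integral>\<^sup>+x. f x * (\<integral>\<^sup>+y. k y \<partial>m) \<partial>\<kappa>)"
    by (rule nn_integral_multc[symmetric]) measurable
  also have "\<dots> = (\<integral>\<^sup>+x. (\<integral>\<^sup>+y. f x * k (y + x) \<partial>m) \<partial>\<kappa>)"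
  proof (rule nn_integral_cong)
    fix x
    have "f x * (\<integral>\<^sup>+y. k y \<partial>m) = f x * (\<integral>\<^sup>+y. k (y + x) \<partial>m)" by (simp add: right[OF k])
    also have "\<dots> = (\<integral>\<^sup>+y. f x * k (y + x) \<partial>m)"
      by (rule nn_integral_cmult[symmetric]) measurable
    finally show "f x * (\<integral>\<^sup>+y. k y \<partial>m) = (\<integral>\<^sup>+y. f x * k (y + x) \<partial>m)" .
  qed
  also have "\<dots> = (\<integral>\<^sup>+y. (\<integral>\<^sup>+x. f x * k (y + x) \<partial>\<kappa>) \<partial>m)"
    by (rule Fubini'[symmetric]) measurable
  also have "\<dots> = (\<integral>\<^sup>+y. (\<integral>\<^sup>+x. f (- y + x) * k x \<partial>\<kappa>) \<partial>m)"
  proof (rule nn_integral_cong)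
    fix y
    have "(\<lambda>x. f (- y + x) * k x) \<in> borel_measurable borel" by measurable
    from left'[OF this, of y]
    show "(\<integral>\<^sup>+x. f x * k (y + x) \<partial>\<kappa>) = (\<integral>\<^sup>+x. f (- y + x) * k x \<partial>\<kappa>)"
      by (simp add: add.assoc[symmetric])
  qed
  also have "\<dots> = (\<integral>\<^sup>+x. (\<integral>\<^sup>+y. f (- y + x) * k x \<partial>m) \<partial>\<kappa>)"
    by (rule Fubini') measurable
  also have "\<dots> = (\<integral>\<^sup>+x. k x * (\<integral>\<^sup>+y. f (- y) \<partial>m) \<partial>\<kappa>)"
  proof (rule nn_integral_cong)
    fix x
    have "(\<integral>\<^sup>+y. f (- y + x) * k x \<partial>m) = (\<integral>\<^sup>+y. f (- y + x) \<partial>m) * k x"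
      by (rule nn_integral_multc) measurable
    also have "(\<lambda>y. f (- y + x)) \<in> borel_measurable borel" by measurable
    from left[OF this, of x] have "(\<integral>\<^sup>+y. f (- y + x) \<partial>m) = (\<integral>\<^sup>+y. f (- y) \<partial>m)"
      by (simp add: minus_add add.assoc)
    finally show "(\<integral>\<^sup>+y. f (- y + x) * k x \<partial>m) = k x * (\<integral>\<^sup>+y. f (- y) \<partial>m)"
      by (simp add: mult.commute)
  qed
  also have "\<dots> = (\<integral>\<^sup>+x. k x \<partial>\<kappa>) * (\<integral>\<^sup>+y. f (- y) \<partial>m)"
    by (rule nn_integral_multc) measurable
  finally show ?thesis .
qed

text \<open>Swapping m with itself shows that m is invariant under inversion, after cancelling the
  finite positive value \<open>emeasure m C\<close>. This removes the inversion from the swap of m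
  with \<kappa>. The product form avoids dividing by values that may be infinite.\<close>

lemma haar_measure_unique:
  fixes m \<kappa> :: "'g::{topological_group_add, second_countable_topology, t2_space} measure"
  assumes fin: "sigma_finite_measure m" "sigma_finite_measure \<kappa>"
    and sets: "sets m = sets borel" "sets \<kappa> = sets borel"
    and left: "\<And>f g. f \<in> borel_measurable borel \<Longrightarrow> (\<integral>\<^sup>+x. f (g + x) \<partial>m) = (\<integral>\<^sup>+x. f x \<partial>m)"
    and right: "\<And>f g. f \<in> borel_measurable borel \<Longrightarrow> (\<integral>\<^sup>+x. f (x + g) \<partial>m) = (\<integral>\<^sup>+x. f x \<partial>m)"
    and left': "\<And>f g. f \<in> borel_measurable borel \<Longrightarrow> (\<integral>\<^sup>+x. f (g + x) \<partial>\<kappa>) = (\<integral>\<^sup>+x. f x \<partial>\<kappa>)"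
    and A: "A \<in> sets borel" and C: "C \<in> sets borel" "emeasure m C \<noteq> 0" "emeasure m C \<noteq> \<infinity>"
  shows "emeasure \<kappa> A * emeasure m C = emeasure \<kappa> C * emeasure m A"
proof -
  have ind: "indicator A \<in> borel_measurable borel" "indicator C \<in> borel_measurable borel"
    using A C by auto
  have int: "(\<integral>\<^sup>+x. indicator B x \<partial>N) = emeasure N B" if "B \<in> sets borel" "sets N = sets borel"
    for B :: "'g set" and N
    using that by (intro nn_integral_indicator) simp
  note m_swap = invariant_measures_swap[OF fin(1) fin(1) sets(1) sets(1) left right left ind]
  have "emeasure m A * emeasure m C = emeasure m C * (\<integral>\<^sup>+y. indicator A (- y) \<partial>m)"
    using m_swap unfolding int[OF A sets(1)] int[OF C(1) sets(1)] .
  then have inverse: "(\<integral>\<^sup>+y. indicator A (- y) \<partial>m) = emeasure m A"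
    using C(2,3) by (simp add: mult.commute[of "emeasure m A"] ennreal_mult_cancel_left)
  show ?thesis
    using invariant_measures_swap[OF fin sets left right left' ind]
    unfolding int[OF A sets(2)] int[OF C(1) sets(2)] int[OF C(1) sets(1)] inverse .
qed

locale unimodular_action = separated_action act X Y K
  for act :: "'g::{topological_group_add, second_countable_topology, t2_space} \<Rightarrow> 'x \<Rightarrow> 'x"
    and X :: "'x measure" and Y :: "'x set" and K :: "nat \<Rightarrow> 'g set" +
  fixes m :: "'g measure" and E :: "nat \<Rightarrow> 'x set"
  assumes unimodular: "unimodular TYPE('g)"
    and haar: "haar_measure m"
    and exhaustion_Y: "borel_exhaustion (restrict_space X Y) E"
begin

section \<open>Haar measure and the two exhaustions\<close>

lemma sets_m [measurable_cong]: "sets m = sets borel"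
  using haar by (simp add: haar_measure_def)

lemma space_m: "space m = UNIV"
  using sets_eq_imp_space_eq[OF sets_m] by simp

lemma m_compact: "compact C \<Longrightarrow> emeasure m C \<noteq> \<infinity>"
  using haar unfolding haar_measure_def by (auto simp: less_top)

lemma m_UNIV: "emeasure m UNIV \<noteq> 0"
  using haar by (simp add: haar_measure_def)

lemma m_left:
  assumes "f \<in> borel_measurable borel"
  shows "(\<integral>\<^sup>+h. f (g + h) \<partial>m) = (\<integral>\<^sup>+h. f h \<partial>m)"
proof (rule nn_integral_invariant_map[where \<tau>' = "\<lambda>h. - g + h"])
  show "(\<lambda>h. g + h) \<in> m \<rightarrow>\<^sub>M m" by measurable
  show "f \<in> borel_measurable m" using assms by (simp cong: measurable_cong_sets add: sets_m)
  fix A assume "A \<in> sets m"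
  then show "emeasure m ((\<lambda>h. - g + h) ` A) = emeasure m A"
    using haar by (simp add: haar_measure_def)
qed (simp_all add: space_m add.assoc[symmetric])

lemma m_right:
  assumes "f \<in> borel_measurable borel"
  shows "(\<integral>\<^sup>+h. f (h + g) \<partial>m) = (\<integral>\<^sup>+h. f h \<partial>m)"
proof (rule nn_integral_invariant_map[where \<tau>' = "\<lambda>h. h + - g"])
  show "(\<lambda>h. h + g) \<in> m \<rightarrow>\<^sub>M m" by measurable
  show "f \<in> borel_measurable m" using assms by (simp cong: measurable_cong_sets add: sets_m)
  fix A assume "A \<in> sets m"
  then show "emeasure m ((\<lambda>h. h + - g) ` A) = emeasure m A"
    using unimodular haar sets_m unfolding unimodular_def by blast
qed (simp_all add: space_m add.assoc)

lemma K_borel: "K n \<in> sets borel"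
  using K_compact by (rule borel_compact)

lemma sigma_finite_m: "sigma_finite_measure m"
proof
  show "\<exists>A. countable A \<and> A \<subseteq> sets m \<and> \<Union>A = space m \<and> (\<forall>a\<in>A. emeasure m a \<noteq> \<infinity>)"
    using K_borel K_UN m_compact K_compact
    by (intro exI[of _ "range K"]) (auto simp: sets_m space_m)
qed

lemma ex_K_pos: "\<exists>n. emeasure m (K n) \<noteq> 0"
proof (rule ccontr)
  assume "\<nexists>n. emeasure m (K n) \<noteq> 0"
  then have "emeasure m (\<Union>n. K n) = 0"
    using K_borel by (intro emeasure_UN_eq_0) (auto simp: sets_m)
  then show False using m_UNIV K_UN by simp
qed

text \<open>A reference set of positive finite Haar measure; it fixes the scale of the restricted
  measure.\<close>

definition K0 :: "'g set" where
  "K0 = K (SOME n. emeasure m (K n) \<noteq> 0)"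

lemma K0: "compact K0" "K0 \<in> sets borel" "emeasure m K0 \<noteq> 0" "emeasure m K0 \<noteq> \<infinity>"
  using K_compact K_borel someI_ex[OF ex_K_pos] m_compact unfolding K0_def by auto

lemma K0_inverse: "inverse (emeasure m K0) * (emeasure m K0 * a) = a"
proof -
  have "inverse (emeasure m K0) * emeasure m K0 = 1"
    using K0(3,4) ennreal_divide_self[of "emeasure m K0"]
    by (simp add: divide_ennreal_def mult.commute less_top)
  then show ?thesis by (simp add: mult.assoc[symmetric])
qed

lemma E_sets: "E n \<in> sets X" and E_subset: "E n \<subseteq> Y" and E_mono: "incseq E" and E_UN: "(\<Union>n. E n) = Y"
proof -
  have "E n \<in> sets (restrict_space X Y)" "incseq E" "(\<Union>n. E n) = space (restrict_space X Y)" for n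
    using exhaustion_Y unfolding borel_exhaustion_def by auto
  then show "E n \<in> sets X" "E n \<subseteq> Y" "incseq E" "(\<Union>n. E n) = Y"
    by (simp_all add: sets_restrict_space_iff space_Y)
qed

section \<open>Functions on G x Y and on G x X\<close>

lemma sets_Y_iff: "A \<in> sets (restrict_space X Y) \<longleftrightarrow> A \<subseteq> Y \<and> A \<in> sets X"
  by (simp add: sets_restrict_space_iff)

lemma space_GY: "space (borel \<Otimes>\<^sub>M restrict_space X Y) = UNIV \<times> Y"
  by (simp add: space_pair_measure space_Y)

lemma inclusion_measurable: "(\<lambda>z. z) \<in> borel \<Otimes>\<^sub>M restrict_space X Y \<rightarrow>\<^sub>M borel \<Otimes>\<^sub>M X"
proof -
  have "(\<lambda>z. (fst z, snd z)) \<in> borel \<Otimes>\<^sub>M restrict_space X Y \<rightarrow>\<^sub>M borel \<Otimes>\<^sub>M X"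
    by (intro measurable_Pair measurable_fst measurable_compose[OF measurable_snd]
        measurable_restrict_space1 measurable_ident_sets) simp
  then show ?thesis by simp
qed

lemma restrict_GY_measurable:
  "F \<in> borel \<Otimes>\<^sub>M X \<rightarrow>\<^sub>M N \<Longrightarrow> F \<in> borel \<Otimes>\<^sub>M restrict_space X Y \<rightarrow>\<^sub>M N"
  using measurable_compose[OF inclusion_measurable] .

text \<open>Fibre sums see only points of G x Y, so extension by zero changes none of them and lets
  facts about functions on G x X apply to F.\<close>

lemma extend_GY_measurable:
  fixes F :: "'g \<times> 'x \<Rightarrow> ennreal"
  assumes F: "F \<in> borel_measurable (borel \<Otimes>\<^sub>M restrict_space X Y)"
  shows "(\<lambda>z. F z * indicator (UNIV \<times> Y) z) \<in> borel_measurable (borel \<Otimes>\<^sub>M X)"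
proof -
  have \<Omega>: "UNIV \<times> Y \<in> sets (borel \<Otimes>\<^sub>M X)" "UNIV \<times> Y \<inter> space (borel \<Otimes>\<^sub>M X) \<in> sets (borel \<Otimes>\<^sub>M X)"
    by auto
  have sp: "space (restrict_space (borel \<Otimes>\<^sub>M X) (UNIV \<times> Y)) = UNIV \<times> Y"
    using sets.sets_into_space[OF \<Omega>(1)] by (auto simp: space_restrict_space)
  have "F \<in> borel_measurable (restrict_space (borel \<Otimes>\<^sub>M X) (UNIV \<times> Y))"
  proof (rule measurableI)
    fix A :: "ennreal set" assume "A \<in> sets borel"
    from measurable_sets[OF F this]
    have "F -` A \<inter> (UNIV \<times> Y) \<in> sets (borel \<Otimes>\<^sub>M restrict_space X Y)" by (simp only: space_GY)
    then have "F -` A \<inter> (UNIV \<times> Y) \<in> sets (borel \<Otimes>\<^sub>M X)"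
      by (rule sets_pair_restrict_space[OF Y_sets])
    then show "F -` A \<inter> space (restrict_space (borel \<Otimes>\<^sub>M X) (UNIV \<times> Y))
        \<in> sets (restrict_space (borel \<Otimes>\<^sub>M X) (UNIV \<times> Y))"
      by (simp add: sp sets_restrict_space_iff[OF \<Omega>(2)])
  qed simp
  then show ?thesis by (simp add: borel_measurable_restrict_space_iff_ennreal[OF \<Omega>(2)])
qed

lemma trans_sum_extend:
  "x \<in> space X \<Longrightarrow> trans_sum (\<lambda>z. F z * indicator (UNIV \<times> Y) z) x = trans_sum F x"
  by (rule trans_sum_cong) auto

lemma trans_sum_measurable_GY [measurable]:
  assumes "F \<in> borel_measurable (borel \<Otimes>\<^sub>M restrict_space X Y)"
  shows "trans_sum F \<in> borel_measurable X"
  using trans_sum_measurable[OF extend_GY_measurable[OF assms]] trans_sum_extend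
  by (simp cong: measurable_cong)

section \<open>Integrated fibre sums as a measure on G x Y\<close>

definition transverse_product :: "'x measure \<Rightarrow> ('g \<times> 'x) measure" where
  "transverse_product \<mu> = measure_of (UNIV \<times> Y) (sets (borel \<Otimes>\<^sub>M restrict_space X Y))
     (\<lambda>C. \<integral>\<^sup>+x. trans_sum (indicator C) x \<partial>\<mu>)"

lemma sets_GY_closed: "sets (borel \<Otimes>\<^sub>M restrict_space X Y) \<subseteq> Pow (UNIV \<times> Y)"
  using sets.space_closed[of "borel \<Otimes>\<^sub>M restrict_space X Y"] unfolding space_GY .

lemma sets_transverse_product [measurable_cong]:
  "sets (transverse_product \<mu>) = sets (borel \<Otimes>\<^sub>M restrict_space X Y)"
  unfolding transverse_product_def
  using sets.sigma_sets_eq[of "borel \<Otimes>\<^sub>M restrict_space X Y"]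
  by (simp add: sets_GY_closed space_GY)

lemma space_transverse_product: "space (transverse_product \<mu>) = UNIV \<times> Y"
  using sets_eq_imp_space_eq[OF sets_transverse_product] by (simp add: space_GY)

lemma trans_sum_suminf:
  assumes x: "x \<in> space X"
  shows "trans_sum (\<lambda>z. \<Sum>n. F n z) x = (\<Sum>n. trans_sum (F n) x)"
proof -
  have "trans_sum (\<lambda>z. \<Sum>n. F n z) x
      = (\<Sum>i. \<Sum>n. indicator (cell i) x * F n (- sec i x, act (sec i x) x))"
    unfolding trans_sum_eq_suminf[OF x] by simp
  also have "\<dots> = (\<integral>\<^sup>+i. (\<Sum>n. indicator (cell i) x * F n (- sec i x, act (sec i x) x)) \<partial>count_space UNIV)"
    by (rule nn_integral_count_space_nat[symmetric])
  also have "\<dots> = (\<Sum>n. \<integral>\<^sup>+i. indicator (cell i) x * F n (- sec i x, act (sec i x) x) \<partial>count_space UNIV)"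
    by (rule nn_integral_suminf) simp
  finally show ?thesis unfolding trans_sum_eq_suminf[OF x] nn_integral_count_space_nat .
qed

lemma trans_sum_SUP:
  assumes x: "x \<in> space X" and U: "incseq U"
  shows "trans_sum (\<lambda>z. SUP n. U n z) x = (SUP n. trans_sum (U n) x)"
proof -
  have "trans_sum (\<lambda>z. SUP n. U n z) x
      = (\<integral>\<^sup>+i. (SUP n. indicator (cell i) x * U n (- sec i x, act (sec i x) x)) \<partial>count_space UNIV)"
    unfolding trans_sum_eq_suminf[OF x] nn_integral_count_space_nat[symmetric]
    by (simp add: SUP_mult_left_ennreal)
  also have "\<dots> = (SUP n. \<integral>\<^sup>+i. indicator (cell i) x * U n (- sec i x, act (sec i x) x) \<partial>count_space UNIV)"
    using U by (intro nn_integral_monotone_convergence_SUP)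
      (auto simp: incseq_def le_fun_def intro!: mult_left_mono)
  finally show ?thesis unfolding trans_sum_eq_suminf[OF x] nn_integral_count_space_nat .
qed

lemma trans_sum_add:
  assumes x: "x \<in> space X"
  shows "trans_sum (\<lambda>z. F z + G z) x = trans_sum F x + trans_sum G x"
  unfolding trans_sum_eq_suminf[OF x] by (simp add: distrib_left suminf_add[symmetric])

lemma trans_sum_mult_left:
  assumes x: "x \<in> space X"
  shows "trans_sum (\<lambda>z. c * F z) x = c * trans_sum F x"
  unfolding trans_sum_eq_suminf[OF x] ennreal_suminf_cmult[symmetric]
  by (simp add: mult.left_commute)

lemma emeasure_transverse_product:
  assumes \<mu>: "sets \<mu> = sets X" and C: "C \<in> sets (borel \<Otimes>\<^sub>M restrict_space X Y)"
  shows "emeasure (transverse_product \<mu>) C = (\<integral>\<^sup>+x. trans_sum (indicator C) x \<partial>\<mu>)"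
  unfolding transverse_product_def
proof (rule emeasure_measure_of_sigma)
  let ?N = "borel \<Otimes>\<^sub>M restrict_space X Y" and ?f = "\<lambda>C. \<integral>\<^sup>+x. trans_sum (indicator C) x \<partial>\<mu>"
  have sp: "space \<mu> = space X" using \<mu> by (rule sets_eq_imp_space_eq)
  show "sigma_algebra (UNIV \<times> Y) (sets ?N)"
    using sets.sigma_algebra_axioms[of ?N] unfolding space_GY .
  have "trans_sum (indicator {}) = (\<lambda>_. 0)"
    by (rule ext, rule trans_sum_0) simp
  then show "positive (sets ?N) ?f"
    unfolding positive_def by simp
  show "countably_additive (sets ?N) ?f"
    unfolding countably_additive_def
  proof (intro allI impI)
    fix A :: "nat \<Rightarrow> ('g \<times> 'x) set" assume A: "range A \<subseteq> sets ?N" "disjoint_family A"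
    have [measurable]: "trans_sum (indicator (A n)) \<in> borel_measurable \<mu>" for n
    proof -
      have "indicator (A n) \<in> borel_measurable ?N" using A(1) by (intro borel_measurable_indicator) auto
      from trans_sum_measurable_GY[OF this] show ?thesis by (simp cong: measurable_cong_sets add: \<mu>)
    qed
    have "(\<Sum>n. ?f (A n)) = (\<integral>\<^sup>+x. (\<Sum>n. trans_sum (indicator (A n)) x) \<partial>\<mu>)"
      by (rule nn_integral_suminf[symmetric]) measurable
    also have "\<dots> = ?f (\<Union>n. A n)"
    proof (rule nn_integral_cong)
      fix x assume "x \<in> space \<mu>"
      then have x: "x \<in> space X" using sp by simp
      have "(\<lambda>z. \<Sum>n. indicator (A n) z) = (indicator (\<Union>n. A n) :: _ \<Rightarrow> ennreal)"
        using suminf_indicator[OF A(2)] by auto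
      with trans_sum_suminf[OF x, of "\<lambda>n. indicator (A n)"]
      show "(\<Sum>n. trans_sum (indicator (A n)) x) = trans_sum (indicator (\<Union>n. A n)) x" by simp
    qed
    finally show "(\<Sum>n. ?f (A n)) = ?f (\<Union>n. A n)" .
  qed
qed (rule C)

lemma nn_integral_transverse_product:
  assumes \<mu>: "sets \<mu> = sets X" and F: "F \<in> borel_measurable (borel \<Otimes>\<^sub>M restrict_space X Y)"
  shows "(\<integral>\<^sup>+z. F z \<partial>transverse_product \<mu>) = (\<integral>\<^sup>+x. trans_sum F x \<partial>\<mu>)"
  using F
proof (induction rule: borel_measurable_induct)
  have sp: "space \<mu> = space X" using \<mu> by (rule sets_eq_imp_space_eq)
  have spl: "space (transverse_product \<mu>) = space (borel \<Otimes>\<^sub>M restrict_space X Y)"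
    by (simp add: space_transverse_product space_GY)
  have meas: "trans_sum u \<in> borel_measurable \<mu>"
    if "u \<in> borel_measurable (borel \<Otimes>\<^sub>M restrict_space X Y)" for u
    using trans_sum_measurable_GY[OF that] by (simp cong: measurable_cong_sets add: \<mu>)
  have meas': "u \<in> borel_measurable (transverse_product \<mu>)"
    if "u \<in> borel_measurable (borel \<Otimes>\<^sub>M restrict_space X Y)" for u :: "_ \<Rightarrow> ennreal"
    using that by (simp cong: measurable_cong_sets add: sets_transverse_product)
  {
    case (cong f g)
    have "(\<integral>\<^sup>+z. f z \<partial>transverse_product \<mu>) = (\<integral>\<^sup>+z. g z \<partial>transverse_product \<mu>)"
      using cong(3) spl by (intro nn_integral_cong) simp
    moreover have "trans_sum f x = trans_sum g x" if "x \<in> space X" for x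
      using cong(3) that by (intro trans_sum_cong) (auto simp: space_GY)
    then have "(\<integral>\<^sup>+x. trans_sum f x \<partial>\<mu>) = (\<integral>\<^sup>+x. trans_sum g x \<partial>\<mu>)"
      using sp by (intro nn_integral_cong) simp
    ultimately show ?case using cong(4) by simp
  next
    case (set A)
    then show ?case using emeasure_transverse_product[OF \<mu> set]
      by (simp add: sets_transverse_product)
  next
    case (mult u c)
    have "(\<integral>\<^sup>+x. trans_sum (\<lambda>z. c * u z) x \<partial>\<mu>) = (\<integral>\<^sup>+x. c * trans_sum u x \<partial>\<mu>)"
      using sp by (intro nn_integral_cong) (simp add: trans_sum_mult_left)
    then show ?case using mult by (simp add: nn_integral_cmult meas meas')
  next
    case (add u v)
    have "(\<integral>\<^sup>+x. trans_sum (\<lambda>z. v z + u z) x \<partial>\<mu>) = (\<integral>\<^sup>+x. trans_sum v x + trans_sum u x \<partial>\<mu>)"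
      using sp by (intro nn_integral_cong) (simp add: trans_sum_add)
    then show ?case using add by (simp add: nn_integral_add meas meas')
  next
    case (seq U)
    have "(\<integral>\<^sup>+x. trans_sum (SUP i. U i) x \<partial>\<mu>) = (\<integral>\<^sup>+x. (SUP i. trans_sum (U i) x) \<partial>\<mu>)"
    proof (rule nn_integral_cong)
      fix x assume "x \<in> space \<mu>"
      then have "trans_sum (\<lambda>z. SUP i. U i z) x = (SUP i. trans_sum (U i) x)"
        using sp seq(3) by (intro trans_sum_SUP) simp_all
      then show "trans_sum (SUP i. U i) x = (SUP i. trans_sum (U i) x)"
        by (simp add: Sup_fun_def image_comp)
    qed
    also have "\<dots> = (SUP i. \<integral>\<^sup>+x. trans_sum (U i) x \<partial>\<mu>)"
    proof (rule nn_integral_monotone_convergence_SUP)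
      have "trans_sum (U i) x \<le> trans_sum (U j) x" if "i \<le> j" for i j x
        unfolding trans_sum_def using seq(3) that
        by (intro infsum_mono nonneg_summable_on_complete) (auto simp: incseq_def le_fun_def)
      then show "incseq (\<lambda>i. trans_sum (U i))" by (simp add: incseq_def le_fun_def)
    qed (rule meas[OF seq(1)])
    also have "\<dots> = (SUP i. \<integral>\<^sup>+z. U i z \<partial>transverse_product \<mu>)" using seq(5) by simp
    also have "\<dots> = (\<integral>\<^sup>+z. (SUP i. U i z) \<partial>transverse_product \<mu>)"
      by (rule nn_integral_monotone_convergence_SUP[symmetric, OF seq(3)]) (rule meas'[OF seq(1)])
    finally show ?case by (simp add: Sup_fun_def image_comp)
  }
qed

section \<open>The product structure coming from an invariant measure\<close>

abbreviation "M_X \<equiv> invariant_measures act X K E"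
abbreviation "M_Y \<equiv> transverse_measures act X Y E"

lemma M_X_sets: "\<mu> \<in> M_X \<Longrightarrow> sets \<mu> = sets X"
  and M_X_finite: "\<mu> \<in> M_X \<Longrightarrow> emeasure \<mu> (translates act (K n) (E n)) \<noteq> \<infinity>"
  and M_X_invariant: "\<mu> \<in> M_X \<Longrightarrow> A \<in> sets X \<Longrightarrow> emeasure \<mu> (act g ` A) = emeasure \<mu> A"
  unfolding invariant_measures_def measures_finite_on_def invariant_measure_def
  by (auto simp: less_top)

lemma M_X_space: "\<mu> \<in> M_X \<Longrightarrow> space \<mu> = space X"
  using M_X_sets sets_eq_imp_space_eq by blast

lemma nn_integral_act:
  assumes \<mu>: "\<mu> \<in> M_X" and k: "k \<in> borel_measurable X"
  shows "(\<integral>\<^sup>+x. k (act g x) \<partial>\<mu>) = (\<integral>\<^sup>+x. k x \<partial>\<mu>)"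
proof (rule nn_integral_invariant_map[where \<tau>' = "act (- g)"])
  have "(\<lambda>x. act g x) \<in> X \<rightarrow>\<^sub>M X" by (rule measurable_act) simp_all
  then show "act g \<in> \<mu> \<rightarrow>\<^sub>M \<mu>" by (simp cong: measurable_cong_sets add: M_X_sets[OF \<mu>])
  show "k \<in> borel_measurable \<mu>" using k by (simp cong: measurable_cong_sets add: M_X_sets[OF \<mu>])
qed (simp_all add: M_X_space[OF \<mu>] M_X_sets[OF \<mu>] M_X_invariant[OF \<mu>])

text \<open>By \<open>trans_sum_act\<close> a left translation of F is a translation of x, which
  \<mu> does not notice.\<close>

lemma transverse_product_left:
  assumes \<mu>: "\<mu> \<in> M_X" and F: "F \<in> borel_measurable (borel \<Otimes>\<^sub>M restrict_space X Y)"
  shows "(\<integral>\<^sup>+z. F (g + fst z, snd z) \<partial>transverse_product \<mu>) = (\<integral>\<^sup>+z. F z \<partial>transverse_product \<mu>)"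
proof -
  have F': "(\<lambda>z. F (g + fst z, snd z)) \<in> borel_measurable (borel \<Otimes>\<^sub>M restrict_space X Y)"
    by (rule measurable_compose[OF _ F]) measurable
  have "(\<integral>\<^sup>+z. F (g + fst z, snd z) \<partial>transverse_product \<mu>)
      = (\<integral>\<^sup>+x. trans_sum (\<lambda>z. F (g + fst z, snd z)) x \<partial>\<mu>)"
    by (rule nn_integral_transverse_product[OF M_X_sets[OF \<mu>] F'])
  also have "\<dots> = (\<integral>\<^sup>+x. trans_sum F (act g x) \<partial>\<mu>)"
    using M_X_space[OF \<mu>] by (intro nn_integral_cong) (simp add: trans_sum_act split_beta')
  also have "\<dots> = (\<integral>\<^sup>+x. trans_sum F x \<partial>\<mu>)"
    by (rule nn_integral_act[OF \<mu> trans_sum_measurable_GY[OF F]])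
  also have "\<dots> = (\<integral>\<^sup>+z. F z \<partial>transverse_product \<mu>)"
    by (rule nn_integral_transverse_product[OF M_X_sets[OF \<mu>] F, symmetric])
  finally show ?thesis .
qed

text \<open>The fibre count of \<open>C \<times> A\<close> is at most a constant times the indicator
  of C.A, and C.A lies in a single K N.E N because the exhaustion of G absorbs compact sets and both
  exhaustions increase.\<close>

lemma transverse_product_finite:
  assumes \<mu>: "\<mu> \<in> M_X" and C: "compact C" and A: "A \<in> sets X" "A \<subseteq> E n"
  shows "emeasure (transverse_product \<mu>) (C \<times> A) \<noteq> \<infinity>"
proof -
  obtain k where "C \<subseteq> K k" using K_absorbs[OF C] by blast
  define N where "N = max k n"
  have "C \<subseteq> K N" using \<open>C \<subseteq> K k\<close> incseqD[OF K_mono, of k N] unfolding N_def by auto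
  moreover have "A \<subseteq> E N" using A(2) incseqD[OF E_mono, of n N] unfolding N_def by auto
  ultimately have sub: "translates act C A \<subseteq> translates act (K N) (E N)"
    unfolding translates_def by blast
  have AY: "A \<inter> Y = A" using A(2) E_subset by blast
  obtain c :: nat where c: "\<And>x. x \<in> space X \<Longrightarrow>
      trans_sum (indicator (C \<times> A)) x \<le> of_nat c * indicator (translates act C A) x"
    using trans_sum_compact_le[OF C] AY by metis
  have tr: "translates act C A \<in> sets \<mu>" "translates act (K N) (E N) \<in> sets \<mu>"
    using A E_sets E_subset C K_compact M_X_sets[OF \<mu>] AY
    by (auto intro!: translates_sets borel_compact)
  have "C \<times> A \<in> sets (borel \<Otimes>\<^sub>M restrict_space X Y)"
    using A AY by (intro pair_measureI borel_compact[OF C]) (auto simp: sets_Y_iff)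
  then have "emeasure (transverse_product \<mu>) (C \<times> A) = (\<integral>\<^sup>+x. trans_sum (indicator (C \<times> A)) x \<partial>\<mu>)"
    by (rule emeasure_transverse_product[OF M_X_sets[OF \<mu>]])
  also have "\<dots> \<le> (\<integral>\<^sup>+x. of_nat c * indicator (translates act C A) x \<partial>\<mu>)"
    using c M_X_space[OF \<mu>] by (intro nn_integral_mono) simp
  also have "\<dots> = of_nat c * emeasure \<mu> (translates act C A)"
    using tr by (simp add: nn_integral_cmult)
  also have "\<dots> \<le> of_nat c * emeasure \<mu> (translates act (K N) (E N))"
    using sub tr by (intro mult_left_mono emeasure_mono) auto
  also have "\<dots> < \<infinity>"
    using M_X_finite[OF \<mu>, of N] by (simp add: ennreal_mult_less_top less_top of_nat_less_top)
  finally show ?thesis by simp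
qed

text \<open>The slab over \<open>K0\<close>, projected to Y and divided by the Haar measure of
  \<open>K0\<close>: for a product of m with a measure on Y this returns the second factor.\<close>

definition res :: "'x measure \<Rightarrow> 'x measure" where
  "res \<mu> = scale_measure (inverse (emeasure m K0))
     (distr (density (transverse_product \<mu>) (indicator (K0 \<times> Y))) (restrict_space X Y) snd)"

lemma sets_res [measurable_cong]: "sets (res \<mu>) = sets (restrict_space X Y)"
  by (simp add: res_def)

lemma space_res: "space (res \<mu>) = Y"
  using sets_eq_imp_space_eq[OF sets_res] space_Y by simp

lemma emeasure_density_times:
  assumes B: "B \<in> sets borel" and A: "A \<in> sets X" "A \<subseteq> Y" and C: "C \<in> sets borel" and D: "D \<in> sets X" "D \<subseteq> Y"
  shows "emeasure (density (transverse_product \<mu>) (indicator (B \<times> A))) (C \<times> D)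
    = emeasure (transverse_product \<mu>) ((B \<inter> C) \<times> (A \<inter> D))"
proof -
  have s: "B \<times> A \<in> sets (transverse_product \<mu>)" "C \<times> D \<in> sets (transverse_product \<mu>)"
    using assms by (auto simp: sets_transverse_product sets_Y_iff)
  then have "emeasure (density (transverse_product \<mu>) (indicator (B \<times> A))) (C \<times> D)
      = (\<integral>\<^sup>+z. indicator (B \<times> A) z * indicator (C \<times> D) z \<partial>transverse_product \<mu>)"
    by (intro emeasure_density) auto
  also have "\<dots> = (\<integral>\<^sup>+z. indicator ((B \<times> A) \<inter> (C \<times> D)) z \<partial>transverse_product \<mu>)"
    by (simp add: indicator_inter_arith)
  also have "\<dots> = emeasure (transverse_product \<mu>) ((B \<times> A) \<inter> (C \<times> D))"
    using s by (intro nn_integral_indicator) auto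
  finally show ?thesis by (simp add: Times_Int_Times)
qed

lemma emeasure_res:
  assumes A: "A \<in> sets X" "A \<subseteq> Y"
  shows "emeasure (res \<mu>) A = inverse (emeasure m K0) * emeasure (transverse_product \<mu>) (K0 \<times> A)"
proof -
  have "snd -` A \<inter> space (density (transverse_product \<mu>) (indicator (K0 \<times> Y))) = UNIV \<times> A"
    using A by (auto simp: space_transverse_product)
  moreover have "snd \<in> density (transverse_product \<mu>) (indicator (K0 \<times> Y)) \<rightarrow>\<^sub>M restrict_space X Y"
    by (simp cong: measurable_cong_sets add: sets_transverse_product)
  ultimately have "emeasure (res \<mu>) A = inverse (emeasure m K0)
      * emeasure (density (transverse_product \<mu>) (indicator (K0 \<times> Y))) (UNIV \<times> A)"
    unfolding res_def using A by (simp add: emeasure_distr sets_Y_iff)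
  also have "emeasure (density (transverse_product \<mu>) (indicator (K0 \<times> Y))) (UNIV \<times> A)
      = emeasure (transverse_product \<mu>) ((K0 \<inter> UNIV) \<times> (Y \<inter> A))"
    using K0 A by (intro emeasure_density_times) auto
  also have "Y \<inter> A = A" using A by auto
  finally show ?thesis by simp
qed

text \<open>For fixed A the slice taking B to the measure of \<open>B \<times> A\<close> is left
  invariant on G, and finite on compact sets because A lies in some \<open>E n\<close>. Uniqueness
  of Haar measure makes it a multiple of m, with the factor read off at \<open>K0\<close>.\<close>

lemma transverse_product_times:
  assumes \<mu>: "\<mu> \<in> M_X" and A: "A \<in> sets X" "A \<subseteq> E n" and B: "B \<in> sets borel"
  shows "emeasure (transverse_product \<mu>) (B \<times> A) * emeasure m K0
    = emeasure (transverse_product \<mu>) (K0 \<times> A) * emeasure m B"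
proof -
  have AY: "A \<subseteq> Y" using A(2) E_subset by blast
  define \<kappa> where "\<kappa> = distr (density (transverse_product \<mu>) (indicator (UNIV \<times> A))) borel fst"
  have fst: "fst \<in> density (transverse_product \<mu>) (indicator (UNIV \<times> A)) \<rightarrow>\<^sub>M borel"
    by (simp cong: measurable_cong_sets add: sets_transverse_product)
  have indA: "indicator (UNIV \<times> A) \<in> borel_measurable (transverse_product \<mu>)"
    using A(1) AY by (intro borel_measurable_indicator) (auto simp: sets_transverse_product sets_Y_iff)
  have em: "emeasure \<kappa> C = emeasure (transverse_product \<mu>) (C \<times> A)" if "C \<in> sets borel" for C
  proof -
    have "fst -` C \<inter> space (density (transverse_product \<mu>) (indicator (UNIV \<times> A))) = C \<times> Y"
      by (auto simp: space_transverse_product)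
    then have "emeasure \<kappa> C = emeasure (density (transverse_product \<mu>) (indicator (UNIV \<times> A))) (C \<times> Y)"
      unfolding \<kappa>_def using that fst by (simp add: emeasure_distr)
    also have "\<dots> = emeasure (transverse_product \<mu>) ((UNIV \<inter> C) \<times> (A \<inter> Y))"
      using A AY that by (intro emeasure_density_times) auto
    also have "A \<inter> Y = A" using AY by auto
    finally show ?thesis by simp
  qed
  have sets_l: "sets \<kappa> = sets borel" and space_l: "space \<kappa> = UNIV" unfolding \<kappa>_def by simp_all
  have "emeasure \<kappa> B * emeasure m K0 = emeasure \<kappa> K0 * emeasure m B"
  proof (rule haar_measure_unique[OF sigma_finite_m _ sets_m sets_l m_left m_right _ B K0(2,3,4)])
    show "sigma_finite_measure \<kappa>"
    proof
      show "\<exists>S. countable S \<and> S \<subseteq> sets \<kappa> \<and> \<Union>S = space \<kappa> \<and> (\<forall>a\<in>S. emeasure \<kappa> a \<noteq> \<infinity>)"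
        using K_borel K_UN transverse_product_finite[OF \<mu> K_compact A]
        by (intro exI[of _ "range K"]) (auto simp: sets_l space_l em)
    qed
  next
    fix f :: "'g \<Rightarrow> ennreal" and g assume f [measurable]: "f \<in> borel_measurable borel"
    have int: "(\<integral>\<^sup>+x. f' x \<partial>\<kappa>) = (\<integral>\<^sup>+z. indicator A (snd z) * f' (fst z) \<partial>transverse_product \<mu>)"
      if [measurable]: "f' \<in> borel_measurable borel" for f' :: "'g \<Rightarrow> ennreal"
    proof -
      have "(\<integral>\<^sup>+x. f' x \<partial>\<kappa>) = (\<integral>\<^sup>+z. f' (fst z) \<partial>density (transverse_product \<mu>) (indicator (UNIV \<times> A)))"
        unfolding \<kappa>_def using fst by (intro nn_integral_distr) simp_all
      also have "\<dots> = (\<integral>\<^sup>+z. indicator (UNIV \<times> A) z * f' (fst z) \<partial>transverse_product \<mu>)"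
        by (rule nn_integral_density[OF indA]) measurable
      also have "\<dots> = (\<integral>\<^sup>+z. indicator A (snd z) * f' (fst z) \<partial>transverse_product \<mu>)"
        by (intro nn_integral_cong) (simp add: indicator_times)
      finally show ?thesis .
    qed
    have "A \<in> sets (restrict_space X Y)" using A(1) AY by (simp add: sets_Y_iff)
    then have [measurable]: "(\<lambda>z. indicator A (snd z) * f (fst z)) \<in> borel_measurable (borel \<Otimes>\<^sub>M restrict_space X Y)"
      by measurable
    have "(\<lambda>x. f (g + x)) \<in> borel_measurable borel" by measurable
    from int[OF this] show "(\<integral>\<^sup>+x. f (g + x) \<partial>\<kappa>) = (\<integral>\<^sup>+x. f x \<partial>\<kappa>)"
      using transverse_product_left[OF \<mu>, of "\<lambda>z. indicator A (snd z) * f (fst z)" g] int[OF f] by simp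
  qed
  then show ?thesis using em B K0(2) by simp
qed

lemma sigma_finite_on_E:
  assumes \<nu>: "sets \<nu> = sets (restrict_space X Y)" "\<And>n. emeasure \<nu> (E n) \<noteq> \<infinity>"
  shows "sigma_finite_measure \<nu>"
proof
  have s: "E n \<in> sets \<nu>" for n using \<nu>(1) E_sets E_subset by (simp add: sets_Y_iff)
  have "space \<nu> = Y" using sets_eq_imp_space_eq[OF \<nu>(1)] space_Y by simp
  then show "\<exists>S. countable S \<and> S \<subseteq> sets \<nu> \<and> \<Union>S = space \<nu> \<and> (\<forall>a\<in>S. emeasure \<nu> a \<noteq> \<infinity>)"
    using s \<nu>(2) E_UN by (intro exI[of _ "range E"]) auto
qed

lemma res_finite:
  assumes \<mu>: "\<mu> \<in> M_X"
  shows "emeasure (res \<mu>) (E n) \<noteq> \<infinity>"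
proof -
  have "emeasure (transverse_product \<mu>) (K0 \<times> E n) \<noteq> \<infinity>"
    by (rule transverse_product_finite[OF \<mu> K0(1) E_sets subset_refl])
  then show ?thesis
    using K0(3) by (simp add: emeasure_res[OF E_sets E_subset] ennreal_mult_eq_top_iff)
qed

text \<open>Slices over an arbitrary A may be infinite on compact sets, so rectangles over A
  \<inter> E n are compared first and n then tends to infinity.\<close>

lemma transverse_product_eq:
  assumes \<mu>: "\<mu> \<in> M_X"
  shows "m \<Otimes>\<^sub>M res \<mu> = transverse_product \<mu>"
proof (rule pair_measure_eqI[OF sigma_finite_m sigma_finite_on_E[OF sets_res res_finite[OF \<mu>]]])
  show "sets (m \<Otimes>\<^sub>M res \<mu>) = sets (transverse_product \<mu>)"
    unfolding sets_transverse_product by (rule sets_pair_measure_cong[OF sets_m sets_res])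
  fix B A assume "B \<in> sets m" "A \<in> sets (res \<mu>)"
  then have B: "B \<in> sets borel" and A: "A \<in> sets X" "A \<subseteq> Y" by (simp_all add: sets_m sets_res sets_Y_iff)
  let ?A = "\<lambda>n. A \<inter> E n"
  have sA: "?A n \<in> sets X" for n using A E_sets by auto
  have sB: "B \<times> ?A n \<in> sets (borel \<Otimes>\<^sub>M restrict_space X Y)" for n
    using sA A by (intro pair_measureI[OF B]) (auto simp: sets_Y_iff)
  have inc: "incseq ?A" "incseq (\<lambda>n. B \<times> ?A n)"
    using incseqD[OF E_mono] unfolding incseq_def by blast+
  have "emeasure m B * emeasure (res \<mu>) (?A n) = emeasure (transverse_product \<mu>) (B \<times> ?A n)" for n
  proof -
    have "emeasure m B * emeasure (res \<mu>) (?A n) = inverse (emeasure m K0)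
        * (emeasure (transverse_product \<mu>) (K0 \<times> ?A n) * emeasure m B)"
      using sA A by (subst emeasure_res) (auto simp: mult_ac)
    also have "\<dots> = inverse (emeasure m K0) * (emeasure m K0 * emeasure (transverse_product \<mu>) (B \<times> ?A n))"
      using transverse_product_times[OF \<mu> sA _ B, of n n] by (simp add: mult.commute)
    finally show ?thesis by (simp only: K0_inverse)
  qed
  moreover have "(SUP n. emeasure m B * emeasure (res \<mu>) (?A n)) = emeasure m B * emeasure (res \<mu>) A"
  proof -
    have "(SUP n. emeasure (res \<mu>) (?A n)) = emeasure (res \<mu>) (\<Union>n. ?A n)"
      using sA A inc(1) by (intro SUP_emeasure_incseq) (auto simp: sets_res sets_Y_iff)
    also have "(\<Union>n. ?A n) = A" using A(2) E_UN by auto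
    finally show ?thesis by (simp add: SUP_mult_left_ennreal[symmetric])
  qed
  moreover have "(SUP n. emeasure (transverse_product \<mu>) (B \<times> ?A n)) = emeasure (transverse_product \<mu>) (B \<times> A)"
  proof -
    have "(SUP n. emeasure (transverse_product \<mu>) (B \<times> ?A n)) = emeasure (transverse_product \<mu>) (\<Union>n. B \<times> ?A n)"
      using inc(2) sB by (intro SUP_emeasure_incseq) (auto simp: sets_transverse_product)
    also have "(\<Union>n. B \<times> ?A n) = B \<times> A" using A(2) E_UN by auto
    finally show ?thesis .
  qed
  ultimately show "emeasure m B * emeasure (res \<mu>) A = emeasure (transverse_product \<mu>) (B \<times> A)" by simp
qed

text \<open>Formula (ii), with values in \<open>ennreal\<close>; the other properties of the pair
  (\<mu>, \<open>res \<mu>\<close>) are instances of it for suitable F.\<close>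

lemma nn_integral_product_res:
  assumes \<mu>: "\<mu> \<in> M_X" and F: "F \<in> borel_measurable (borel \<Otimes>\<^sub>M restrict_space X Y)"
  shows "(\<integral>\<^sup>+z. F z \<partial>(m \<Otimes>\<^sub>M res \<mu>)) = (\<integral>\<^sup>+x. trans_sum F x \<partial>\<mu>)"
  unfolding transverse_product_eq[OF \<mu>] by (rule nn_integral_transverse_product[OF M_X_sets[OF \<mu>] F])

text \<open>For \<open>\<phi> y = c y \<cdot> y\<close> the substitution \<open>g \<mapsto> c (g \<cdot> x) + g\<close> carries the returns of \<open>x\<close> to
  \<open>A\<close> onto its returns to \<open>B\<close>; on the product side it is a right translation of \<open>m\<close>.\<close>

lemma res_rel_invariant:
  assumes \<mu>: "\<mu> \<in> M_X"
  shows "rel_invariant_measure (cross_section_rel act Y) (res \<mu>)"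
  unfolding rel_invariant_measure_def
proof (intro ballI allI impI)
  fix A B \<phi>
  assume "A \<in> sets (res \<mu>)" "B \<in> sets (res \<mu>)"
    and *: "bij_betw \<phi> A B \<and> \<phi> \<in> restrict_space (res \<mu>) A \<rightarrow>\<^sub>M restrict_space (res \<mu>) B \<and>
      (\<forall>y\<in>A. (y, \<phi> y) \<in> cross_section_rel act Y)"
  then have A: "A \<in> sets X" "A \<subseteq> Y" and B: "B \<in> sets X" "B \<subseteq> Y" by (simp_all add: sets_res sets_Y_iff)
  have bij: "bij_betw \<phi> A B" and rel: "\<And>y. y \<in> A \<Longrightarrow> (y, \<phi> y) \<in> cross_section_rel act Y"
    and \<phi>_res: "\<phi> \<in> restrict_space (res \<mu>) A \<rightarrow>\<^sub>M restrict_space (res \<mu>) B" using * by auto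
  let ?N = "restrict_space X A"
  have sp_N: "space ?N = A" using A Y_subset by (auto simp: space_restrict_space)
  have sets_N: "sets (restrict_space (res \<mu>) A) = sets ?N"
    using A by (intro set_eqI) (auto simp: sets_restrict_space_iff sets_res sets_Y_iff space_res)
  have \<phi>B: "\<phi> y \<in> B" if "y \<in> A" for y using bij that by (auto simp: bij_betw_def)
  have \<phi>_meas: "\<phi> \<in> ?N \<rightarrow>\<^sub>M X"
  proof (rule measurableI)
    fix y assume "y \<in> space ?N"
    then show "\<phi> y \<in> space X" using \<phi>B B Y_subset sp_N by auto
  next
    fix C assume "C \<in> sets X"
    then have "C \<inter> B \<in> sets (restrict_space (res \<mu>) B)"
      using B by (auto simp: sets_restrict_space_iff sets_res sets_Y_iff space_res)
    from measurable_sets[OF \<phi>_res this]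
    have "\<phi> -` (C \<inter> B) \<inter> A \<in> sets ?N"
      using sets_N sets_eq_imp_space_eq[OF sets_N] sp_N by simp
    also have "\<phi> -` (C \<inter> B) \<inter> A = \<phi> -` C \<inter> space ?N" using \<phi>B sp_N by auto
    finally show "\<phi> -` C \<inter> space ?N \<in> sets ?N" .
  qed
  define P where "P i y \<longleftrightarrow> y \<in> cell i \<and> act (sec i y) y = \<phi> y" for i y
  \<comment> \<open>Points may have stabilisers, so several group elements can carry y to \<phi> y;
    the least suitable index makes a measurable choice. The value 0 off A is a harmless default,
    since \<open>F\<close> below vanishes there.\<close>
  define c where "c y = (if y \<in> A then sec (LEAST i. P i y) y else 0)" for y
  have P: "\<exists>i. P i y" if y: "y \<in> A" for y
  proof -
    obtain g where g: "y = act g (\<phi> y)" using rel[OF y] by (auto simp: cross_section_rel_def)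
    have sp: "\<phi> y \<in> space X" "y \<in> space X" using \<phi>B[OF y] B A y Y_subset by auto
    have eq: "act (- g) y = \<phi> y" using act_minus(1)[OF sp(1), of g] g by simp
    moreover have "\<phi> y \<in> Y" using \<phi>B[OF y] B by auto
    moreover obtain i where "- g \<in> part i" using part_UN by blast
    ultimately have "P i y" unfolding P_def using secI[OF sp(2), of "- g" i] by simp
    then show ?thesis by blast
  qed
  have c: "act (c y) y = \<phi> y" if "y \<in> A" for y
    using LeastI_ex[OF P[OF that]] that unfolding c_def P_def by simp
  have inclN: "(\<lambda>y. y) \<in> ?N \<rightarrow>\<^sub>M X"
    by (intro measurable_restrict_space1 measurable_ident_sets) simp
  have [measurable]: "sec i \<in> ?N \<rightarrow>\<^sub>M borel" for i
    by (intro measurable_restrict_space1 sec_measurable)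
  have "{y \<in> space ?N. P i y} \<in> sets ?N" for i
  proof -
    have "{y \<in> space ?N. act (sec i y) y = \<phi> y} \<in> sets ?N"
      by (intro measurable_eq_set \<phi>_meas measurable_act inclN) measurable
    moreover have "cell i \<inter> A \<in> sets ?N" using A by (auto simp: sets_restrict_space_iff)
    ultimately have "{y \<in> space ?N. act (sec i y) y = \<phi> y} \<inter> (cell i \<inter> A) \<in> sets ?N" by blast
    also have "{y \<in> space ?N. act (sec i y) y = \<phi> y} \<inter> (cell i \<inter> A) = {y \<in> space ?N. P i y}"
      using sp_N by (auto simp: P_def)
    finally show ?thesis .
  qed
  then have [measurable]: "Measurable.pred ?N (P i)" for i by (simp add: pred_def)
  have "(\<lambda>y. sec (LEAST i. P i y) y) \<in> ?N \<rightarrow>\<^sub>M borel"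
    by (rule measurable_compose_countable[where f = sec]) measurable
  moreover have "{x \<in> space X. x \<in> A} \<in> sets X" using A(1) by simp
  ultimately have c_meas: "c \<in> X \<rightarrow>\<^sub>M borel"
    unfolding c_def by (subst measurable_If_restrict_space_iff) auto
  \<comment> \<open>At the fibre point \<open>(- g, act g x)\<close> the first factor tests whether
    the inverse of the substituted return \<open>c (act g x) + g\<close> lies in
    \<open>K0\<close>.\<close>
  define F where "F z = (indicator K0 (fst z - c (snd z)) * indicator A (snd z) :: ennreal)" for z
  have [measurable]: "K0 \<in> sets borel" by (rule K0)
  have Fm: "F \<in> borel_measurable (borel \<Otimes>\<^sub>M restrict_space X Y)"
  proof (rule restrict_GY_measurable)
    note [measurable] = c_meas A(1)
    show "F \<in> borel_measurable (borel \<Otimes>\<^sub>M X)" unfolding F_def by measurable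
  qed
  have K0B: "K0 \<times> B \<in> sets (borel \<Otimes>\<^sub>M restrict_space X Y)" and K0A: "K0 \<times> A \<in> sets (borel \<Otimes>\<^sub>M restrict_space X Y)"
    using K0(2) A B by (auto simp: sets_Y_iff)
  have tr: "trans_sum (indicator (K0 \<times> B)) x = trans_sum F x" if x: "x \<in> space X" for x
  proof -
    let ?A = "{g. act g x \<in> A}" and ?B = "{g. act g x \<in> B}"
    have actc: "act (c (act g x) + g) x = \<phi> (act g x)" if "g \<in> ?A" for g
      using c[of "act g x"] that x by (simp add: act_act[symmetric])
    have "bij_betw (\<lambda>g. c (act g x) + g) ?A ?B"
    proof (rule bij_betw_imageI)
      show "inj_on (\<lambda>g. c (act g x) + g) ?A"
      proof (rule inj_onI)
        fix g h assume g: "g \<in> ?A" and h: "h \<in> ?A" and eq: "c (act g x) + g = c (act h x) + h"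
        then have "\<phi> (act g x) = \<phi> (act h x)" using actc[OF g] actc[OF h] by simp
        \<comment> \<open>Injectivity of \<phi> identifies the base points; only then do the two
          values of \<open>c\<close> agree and cancel.\<close>
        then have "act g x = act h x" using bij g h by (auto simp: bij_betw_def inj_on_def)
        then show "g = h" using eq by simp
      qed
      show "(\<lambda>g. c (act g x) + g) ` ?A = ?B"
      proof (intro equalityI subsetI)
        fix k assume k: "k \<in> ?B"
        then obtain y where y: "y \<in> A" "act k x = \<phi> y" using bij by (auto simp: bij_betw_def)
        have "act (- c y + k) x = act (- c y) (act (c y) y)"
          using x y c[OF y(1)] by (simp add: act_act[symmetric])
        also have "\<dots> = y" using y A Y_subset by (intro act_minus(1)) auto
        finally have eq: "act (- c y + k) x = y" .
        then have "k = c (act (- c y + k) x) + (- c y + k)" by (simp add: add.assoc[symmetric])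
        then show "k \<in> (\<lambda>g. c (act g x) + g) ` ?A" using eq y(1) by (intro image_eqI[of _ _ "- c y + k"]) auto
      next
        fix k assume "k \<in> (\<lambda>g. c (act g x) + g) ` ?A"
        then show "k \<in> ?B" using actc \<phi>B by auto
      qed
    qed
    then have "(\<Sum>\<^sub>\<infinity>g\<in>?A. indicator K0 (- (c (act g x) + g))) = (\<Sum>\<^sub>\<infinity>g\<in>?B. indicator K0 (- g) :: ennreal)"
      by (rule infsum_reindex_bij_betw)
    moreover have "trans_sum (indicator (K0 \<times> B)) x = (\<Sum>\<^sub>\<infinity>g\<in>?B. indicator K0 (- g))"
      unfolding trans_sum_def using B(2)
      by (intro infsum_cong_neutral) (auto simp: return_set_def indicator_def)
    moreover have "trans_sum F x = (\<Sum>\<^sub>\<infinity>g\<in>?A. indicator K0 (- (c (act g x) + g)))"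
      unfolding trans_sum_def F_def using A(2)
      by (intro infsum_cong_neutral) (auto simp: return_set_def indicator_def minus_add)
    ultimately show ?thesis by simp
  qed
  interpret r: sigma_finite_measure "res \<mu>" using sigma_finite_on_E[OF sets_res res_finite[OF \<mu>]] .
  interpret m: sigma_finite_measure m by (rule sigma_finite_m)
  interpret pair_sigma_finite m "res \<mu>" ..
  have sm: "sets (m \<Otimes>\<^sub>M res \<mu>) = sets (borel \<Otimes>\<^sub>M restrict_space X Y)"
    by (rule sets_pair_measure_cong[OF sets_m sets_res])
  have "emeasure m K0 * emeasure (res \<mu>) B = emeasure (m \<Otimes>\<^sub>M res \<mu>) (K0 \<times> B)"
    using K0(2) B by (intro r.emeasure_pair_measure_Times[symmetric]) (simp_all add: sets_m sets_res sets_Y_iff)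
  also have "\<dots> = (\<integral>\<^sup>+x. trans_sum (indicator (K0 \<times> B)) x \<partial>\<mu>)"
    using nn_integral_product_res[OF \<mu> borel_measurable_indicator[OF K0B]] K0B
    by (simp add: sm)
  also have "\<dots> = (\<integral>\<^sup>+x. trans_sum F x \<partial>\<mu>)"
    using tr M_X_space[OF \<mu>] by (intro nn_integral_cong) simp
  also have "\<dots> = (\<integral>\<^sup>+z. F z \<partial>(m \<Otimes>\<^sub>M res \<mu>))"
    by (rule nn_integral_product_res[OF \<mu> Fm, symmetric])
  also have "\<dots> = (\<integral>\<^sup>+y. (\<integral>\<^sup>+g. F (g, y) \<partial>m) \<partial>res \<mu>)"
    using Fm by (intro nn_integral_snd[symmetric]) (simp cong: measurable_cong_sets add: sm)
  also have "\<dots> = (\<integral>\<^sup>+y. emeasure m K0 * indicator A y \<partial>res \<mu>)"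
  proof (rule nn_integral_cong)
    fix y
    have "(\<integral>\<^sup>+g. F (g, y) \<partial>m) = (\<integral>\<^sup>+g. indicator K0 (g - c y) \<partial>m) * indicator A y"
      unfolding F_def fst_conv snd_conv by (rule nn_integral_multc) measurable
    also have "(\<integral>\<^sup>+g. indicator K0 (g - c y) \<partial>m) = (\<integral>\<^sup>+g. indicator K0 g \<partial>m)"
      using m_right[of "indicator K0" "- c y"] K0(2) by simp
    also have "\<dots> = emeasure m K0" using K0(2) by (simp add: sets_m)
    finally show "(\<integral>\<^sup>+g. F (g, y) \<partial>m) = emeasure m K0 * indicator A y" .
  qed
  also have "\<dots> = emeasure m K0 * emeasure (res \<mu>) A"
    using A by (intro nn_integral_cmult_indicator) (simp add: sets_res sets_Y_iff)
  finally have "emeasure m K0 * emeasure (res \<mu>) B = emeasure m K0 * emeasure (res \<mu>) A" .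
  then show "emeasure (res \<mu>) A = emeasure (res \<mu>) B"
    using K0(3,4) by (metis K0_inverse)
qed

lemma res_in: "\<mu> \<in> M_X \<Longrightarrow> res \<mu> \<in> M_Y"
  unfolding transverse_measures_def measures_finite_on_def
  using res_rel_invariant[of \<mu>] res_finite[of \<mu>] by (auto simp: sets_res less_top)

section \<open>Transverse measures and their products with m\<close>

lemma M_Y_sets: "\<nu> \<in> M_Y \<Longrightarrow> sets \<nu> = sets (restrict_space X Y)"
  and M_Y_finite: "\<nu> \<in> M_Y \<Longrightarrow> emeasure \<nu> (E n) \<noteq> \<infinity>"
  and M_Y_invariant: "\<nu> \<in> M_Y \<Longrightarrow> rel_invariant_measure (cross_section_rel act Y) \<nu>"
  unfolding transverse_measures_def measures_finite_on_def by (auto simp: less_top)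

lemma M_Y_space: "\<nu> \<in> M_Y \<Longrightarrow> space \<nu> = Y"
  using sets_eq_imp_space_eq[OF M_Y_sets] space_Y by simp

lemma M_Y_product_sets: "\<nu> \<in> M_Y \<Longrightarrow> sets (m \<Otimes>\<^sub>M \<nu>) = sets (borel \<Otimes>\<^sub>M restrict_space X Y)"
  by (intro sets_pair_measure_cong sets_m M_Y_sets)

lemma M_Y_product_measurable:
  "\<nu> \<in> M_Y \<Longrightarrow> F \<in> borel \<Otimes>\<^sub>M restrict_space X Y \<rightarrow>\<^sub>M N \<Longrightarrow> F \<in> m \<Otimes>\<^sub>M \<nu> \<rightarrow>\<^sub>M N"
  by (simp cong: measurable_cong_sets add: M_Y_product_sets)

lemma M_Y_measurable:
  assumes "\<nu> \<in> M_Y" "f \<in> X \<rightarrow>\<^sub>M N"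
  shows "f \<in> \<nu> \<rightarrow>\<^sub>M N"
  unfolding measurable_cong_sets[OF M_Y_sets[OF assms(1)] refl]
  using assms(2) by (rule measurable_restrict_space1)

lemma M_Y_pair_sigma_finite: "\<nu> \<in> M_Y \<Longrightarrow> pair_sigma_finite m \<nu>"
  by (intro pair_sigma_finite.intro sigma_finite_m sigma_finite_on_E M_Y_sets M_Y_finite)

lemma nn_integral_product:
  assumes \<nu>: "\<nu> \<in> M_Y" and F: "F \<in> borel_measurable (borel \<Otimes>\<^sub>M restrict_space X Y)"
  shows "(\<integral>\<^sup>+z. F z \<partial>(m \<Otimes>\<^sub>M \<nu>)) = (\<integral>\<^sup>+y. (\<integral>\<^sup>+g. F (g, y) \<partial>m) \<partial>\<nu>)"
  by (rule pair_sigma_finite.nn_integral_snd[OF M_Y_pair_sigma_finite[OF \<nu>] M_Y_product_measurable[OF \<nu> F], symmetric])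

section \<open>Induction from the cross section\<close>

text \<open>The returns of \<open>Y\<close> to itself split into the partial bijections \<open>move i: passage i j \<rightarrow> passage j i\<close>,
  and \<open>move j\<close> inverts \<open>move i\<close> there.\<close>

definition move :: "nat \<Rightarrow> 'x \<Rightarrow> 'x" where
  "move i x = act (sec i x) x"

definition passage :: "nat \<Rightarrow> nat \<Rightarrow> 'x set" where
  "passage i j = {y \<in> Y. y \<in> cell i \<and> - sec i y \<in> part j}"

lemma move_measurable [measurable]: "move i \<in> X \<rightarrow>\<^sub>M X"
  unfolding move_def by (intro measurable_act sec_measurable) simp

lemma passage_sets [measurable]: "passage i j \<in> sets X"
proof -
  have "{y \<in> space X. y \<in> Y \<and> y \<in> cell i \<and> - sec i y \<in> part j} \<in> sets X" by measurable
  also have "{y \<in> space X. y \<in> Y \<and> y \<in> cell i \<and> - sec i y \<in> part j} = passage i j"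
    using Y_subset by (auto simp: passage_def)
  finally show ?thesis .
qed

lemma passage_subset: "passage i j \<subseteq> Y"
  unfolding passage_def by auto

lemma move_passage:
  assumes y: "y \<in> passage i j"
  shows "move i y \<in> passage j i" "sec j (move i y) = - sec i y" "move j (move i y) = y"
proof -
  have y': "y \<in> Y" "y \<in> cell i" "- sec i y \<in> part j" "y \<in> space X"
    using y Y_subset unfolding passage_def by auto
  have mv: "move i y \<in> Y" unfolding move_def by (rule sec_act[OF y'(2)])
  have return: "act (- sec i y) (move i y) = y" unfolding move_def using y'(4) by simp
  have s: "move i y \<in> cell j" "sec j (move i y) = - sec i y"
    using secI[of "move i y" "- sec i y" j] return mv y' Y_subset by simp_all
  then show "sec j (move i y) = - sec i y" by simp
  show "move i y \<in> passage j i" using mv s sec_part[OF y'(2)] unfolding passage_def by simp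
  show "move j (move i y) = y" using return s(2) unfolding move_def[of j] by simp
qed

text \<open>R-invariance applied to every subset
  \<open>{y \<in> passage i j. move i y \<in> A}\<close>: \<open>move i\<close> pushes the
  restriction of \<nu> to \<open>passage i j\<close> forward to its restriction to
  \<open>passage j i\<close>. Both are viewed as measures on X, where H lives.\<close>

lemma nn_integral_move:
  assumes \<nu>: "\<nu> \<in> M_Y" and H: "H \<in> borel_measurable X"
  shows "(\<integral>\<^sup>+y. indicator (passage i j) y * H (move i y) \<partial>\<nu>) = (\<integral>\<^sup>+y. indicator (passage j i) y * H y \<partial>\<nu>)"
proof -
  have ind: "indicator (passage i j) \<in> borel_measurable \<nu>" for i j
    by (rule M_Y_measurable[OF \<nu> borel_measurable_indicator[OF passage_sets]])
  have pas: "passage i j \<in> sets \<nu>" for i j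
    using passage_subset by (simp add: M_Y_sets[OF \<nu>] sets_Y_iff)
  have mv: "move i \<in> \<nu> \<rightarrow>\<^sub>M X" by (rule M_Y_measurable[OF \<nu> move_measurable])
  have id: "(\<lambda>y. y) \<in> \<nu> \<rightarrow>\<^sub>M X" by (rule M_Y_measurable[OF \<nu>]) simp
  let ?N = "distr (density \<nu> (indicator (passage i j))) X (move i)"
  let ?N' = "distr (density \<nu> (indicator (passage j i))) X (\<lambda>y. y)"
  have N: "emeasure ?N A = emeasure \<nu> {y \<in> passage i j. move i y \<in> A}" if A: "A \<in> sets X" for A
  proof -
    have s: "move i -` A \<inter> space \<nu> \<in> sets \<nu>" by (rule measurable_sets[OF mv A])
    have t: "{y \<in> passage i j. move i y \<in> A} = passage i j \<inter> (move i -` A \<inter> space \<nu>)"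
      using passage_subset M_Y_space[OF \<nu>] by auto
    have "emeasure ?N A = emeasure (density \<nu> (indicator (passage i j))) (move i -` A \<inter> space \<nu>)"
      using mv A by (simp add: emeasure_distr)
    also have "\<dots> = (\<integral>\<^sup>+y. indicator (passage i j) y * indicator (move i -` A \<inter> space \<nu>) y \<partial>\<nu>)"
      by (rule emeasure_density[OF ind s])
    also have "\<dots> = (\<integral>\<^sup>+y. indicator {y \<in> passage i j. move i y \<in> A} y \<partial>\<nu>)"
      unfolding t by (simp add: indicator_inter_arith)
    also have "\<dots> = emeasure \<nu> {y \<in> passage i j. move i y \<in> A}"
      unfolding t by (rule nn_integral_indicator[OF sets.Int[OF pas s]])
    finally show ?thesis .
  qed
  have N': "emeasure ?N' A = emeasure \<nu> (passage j i \<inter> A)" if A: "A \<in> sets X" for A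
  proof -
    have s: "A \<inter> space \<nu> \<in> sets \<nu>"
      using A by (auto simp: M_Y_space[OF \<nu>] M_Y_sets[OF \<nu>] sets_Y_iff)
    have t: "passage j i \<inter> A = passage j i \<inter> (A \<inter> space \<nu>)"
      using passage_subset M_Y_space[OF \<nu>] by auto
    have "emeasure ?N' A = emeasure (density \<nu> (indicator (passage j i))) (A \<inter> space \<nu>)"
      using id A by (simp add: emeasure_distr)
    also have "\<dots> = (\<integral>\<^sup>+y. indicator (passage j i) y * indicator (A \<inter> space \<nu>) y \<partial>\<nu>)"
      by (rule emeasure_density[OF ind s])
    also have "\<dots> = (\<integral>\<^sup>+y. indicator (passage j i \<inter> A) y \<partial>\<nu>)"
      unfolding t by (simp add: indicator_inter_arith)
    also have "\<dots> = emeasure \<nu> (passage j i \<inter> A)"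
      unfolding t by (rule nn_integral_indicator[OF sets.Int[OF pas s]])
    finally show ?thesis .
  qed
  have eq: "?N = ?N'"
  proof (rule measure_eqI)
    fix A assume "A \<in> sets ?N"
    then have A: "A \<in> sets X" by simp
    let ?A = "{y \<in> passage i j. move i y \<in> A}" and ?B = "passage j i \<inter> A"
    have "?A = passage i j \<inter> (move i -` A \<inter> space X)" using passage_subset Y_subset by auto
    then have sA: "?A \<in> sets X" using measurable_sets[OF move_measurable A] by auto
    have bij: "bij_betw (move i) ?A ?B"
      by (rule bij_betw_byWitness[of _ "move j"]) (auto simp: move_passage)
    have YA: "?A \<subseteq> Y" "?B \<subseteq> Y" using passage_subset by auto
    have spA: "space (restrict_space \<nu> ?A) = ?A" using YA M_Y_space[OF \<nu>] by (auto simp: space_restrict_space)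
    have "move i \<in> restrict_space \<nu> ?A \<rightarrow>\<^sub>M restrict_space \<nu> ?B"
    proof (rule measurableI)
      fix y assume "y \<in> space (restrict_space \<nu> ?A)"
      then have "move i y \<in> ?B" unfolding spA using bij by (auto simp: bij_betw_def)
      then show "move i y \<in> space (restrict_space \<nu> ?B)"
        using YA M_Y_space[OF \<nu>] by (auto simp: space_restrict_space)
    next
      fix C assume "C \<in> sets (restrict_space \<nu> ?B)"
      then have C: "C \<in> sets X"
        using A YA by (auto simp: sets_restrict_space M_Y_sets[OF \<nu>])
      have "move i -` C \<inter> ?A = (move i -` C \<inter> space X) \<inter> ?A" using YA Y_subset by auto
      moreover have "(move i -` C \<inter> space X) \<inter> ?A \<in> sets X"
        using measurable_sets[OF move_measurable C] sA by auto
      ultimately show "move i -` C \<inter> space (restrict_space \<nu> ?A) \<in> sets (restrict_space \<nu> ?A)"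
        unfolding spA using sA YA
        by (subst sets_restrict_space_iff) (auto simp: M_Y_sets[OF \<nu>] sets_Y_iff M_Y_space[OF \<nu>])
    qed
    moreover have "(y, move i y) \<in> cross_section_rel act Y" if "y \<in> ?A" for y
    proof -
      have y: "y \<in> passage i j" using that by simp
      then have "y = act (sec j (move i y)) (move i y)"
        using move_passage(3)[OF y] unfolding move_def[of j] by simp
      then show ?thesis
        using y move_passage(1)[OF y] passage_subset unfolding cross_section_rel_def by blast
    qed
    moreover have "?A \<in> sets \<nu>" "?B \<in> sets \<nu>"
      using sA A YA by (simp_all add: M_Y_sets[OF \<nu>] sets_Y_iff)
    ultimately have "emeasure \<nu> ?A = emeasure \<nu> ?B"
      using bij M_Y_invariant[OF \<nu>, unfolded rel_invariant_measure_def, rule_format, of ?A ?B "move i"]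
      by simp
    then show "emeasure ?N A = emeasure ?N' A" by (simp add: N[OF A] N'[OF A])
  qed simp
  have "(\<integral>\<^sup>+y. H y \<partial>?N) = (\<integral>\<^sup>+y. indicator (passage i j) y * H (move i y) \<partial>\<nu>)"
  proof -
    have "(\<integral>\<^sup>+y. H y \<partial>?N) = (\<integral>\<^sup>+y. H (move i y) \<partial>density \<nu> (indicator (passage i j)))"
      using mv H by (intro nn_integral_distr) simp_all
    also have "\<dots> = (\<integral>\<^sup>+y. indicator (passage i j) y * H (move i y) \<partial>\<nu>)"
      using ind measurable_compose[OF mv H] by (rule nn_integral_density)
    finally show ?thesis .
  qed
  moreover have "(\<integral>\<^sup>+y. H y \<partial>?N') = (\<integral>\<^sup>+y. indicator (passage j i) y * H y \<partial>\<nu>)"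
  proof -
    have "(\<integral>\<^sup>+y. H y \<partial>?N') = (\<integral>\<^sup>+y. H y \<partial>density \<nu> (indicator (passage j i)))"
      using id H by (intro nn_integral_distr) simp_all
    also have "\<dots> = (\<integral>\<^sup>+y. indicator (passage j i) y * H y \<partial>\<nu>)"
      using ind measurable_compose[OF id H] by (rule nn_integral_density)
    finally show ?thesis .
  qed
  ultimately show ?thesis using eq by simp
qed

section \<open>The induced measure on X\<close>

definition ind :: "'x measure \<Rightarrow> 'x measure" where
  "ind \<nu> = distr (density (m \<Otimes>\<^sub>M \<nu>) (indicator fundamental)) X (\<lambda>z. act (fst z) (snd z))"

lemma sets_ind [measurable_cong]: "sets (ind \<nu>) = sets X"
  and space_ind: "space (ind \<nu>) = space X"
  by (simp_all add: ind_def)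

lemma nn_integral_ind:
  assumes \<nu>: "\<nu> \<in> M_Y" and k: "k \<in> borel_measurable X"
  shows "(\<integral>\<^sup>+x. k x \<partial>ind \<nu>) = (\<integral>\<^sup>+z. indicator fundamental z * k (act (fst z) (snd z)) \<partial>(m \<Otimes>\<^sub>M \<nu>))"
proof -
  have "(\<lambda>z. act (fst z) (snd z)) \<in> borel \<Otimes>\<^sub>M X \<rightarrow>\<^sub>M X" by measurable
  then have a: "(\<lambda>z. act (fst z) (snd z)) \<in> m \<Otimes>\<^sub>M \<nu> \<rightarrow>\<^sub>M X"
    by (intro M_Y_product_measurable[OF \<nu>] restrict_GY_measurable)
  have d: "indicator fundamental \<in> borel_measurable (m \<Otimes>\<^sub>M \<nu>)"
    by (intro M_Y_product_measurable[OF \<nu>] restrict_GY_measurable borel_measurable_indicator fundamental_sets)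
  have "(\<integral>\<^sup>+x. k x \<partial>ind \<nu>)
      = (\<integral>\<^sup>+z. k (act (fst z) (snd z)) \<partial>density (m \<Otimes>\<^sub>M \<nu>) (indicator fundamental))"
    unfolding ind_def using a k by (intro nn_integral_distr) simp_all
  also have "\<dots> = (\<integral>\<^sup>+z. indicator fundamental z * k (act (fst z) (snd z)) \<partial>(m \<Otimes>\<^sub>M \<nu>))"
    using d measurable_compose[OF a k] by (rule nn_integral_density)
  finally show ?thesis .
qed

lemma sum_passage:
  assumes "y \<in> Y"
  shows "(\<Sum>j. indicator (passage i j) y) = (indicator (cell i) y :: ennreal)"
proof (cases "y \<in> cell i")
  case True
  have "(\<Sum>j. indicator (passage i j) y) = (\<Sum>j. indicator (part j) (- sec i y) :: ennreal)"
    using True assms by (intro suminf_cong) (simp add: passage_def indicator_def)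
  then show ?thesis using suminf_indicator_part True by simp
qed (simp add: passage_def)

text \<open>The fibre of g.y is enumerated by the returns of y instead of those of g.y. The sections
  then do not involve g, so for fixed y the integration over g can be done term by term.\<close>

lemma trans_sum_act_eq_suminf:
  assumes y: "y \<in> space X"
  shows "trans_sum F (act g y) = (\<Sum>i. indicator (cell i) y * F (g - sec i y, move i y))"
  unfolding trans_sum_act[OF y] trans_sum_eq_suminf[OF y] by (simp add: move_def)

text \<open>Mass transport: the returns \<open>(g, y) \<mapsto> (g - sec i y, move i y)\<close> are exchanged with their
  inverses, after which the strict fundamental domain is summed out.\<close>

lemma nn_integral_trans_sum_ind_X:
  assumes \<nu>: "\<nu> \<in> M_Y" and F [measurable]: "F \<in> borel_measurable (borel \<Otimes>\<^sub>M X)"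
  shows "(\<integral>\<^sup>+x. trans_sum F x \<partial>ind \<nu>) = (\<integral>\<^sup>+z. F z \<partial>(m \<Otimes>\<^sub>M \<nu>))"
proof -
  interpret pair_sigma_finite m \<nu> by (rule M_Y_pair_sigma_finite[OF \<nu>])
  have sp: "y \<in> Y" "y \<in> space X" if "y \<in> space \<nu>" for y
    using that M_Y_space[OF \<nu>] Y_subset by auto
  have mX: "(\<lambda>y. \<integral>\<^sup>+g. G y g \<partial>m) \<in> borel_measurable X"
    if "(\<lambda>(y, g). G y g) \<in> borel_measurable (X \<Otimes>\<^sub>M borel)" for G :: "'x \<Rightarrow> 'g \<Rightarrow> ennreal"
  proof -
    have "(\<lambda>(y, g). G y g) \<in> borel_measurable (X \<Otimes>\<^sub>M m)"
      using that by (simp cong: measurable_cong_sets sets_pair_measure_cong add: sets_m sets_pair_measure_cong[OF refl sets_m])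
    then show ?thesis by (rule sigma_finite_measure.borel_measurable_nn_integral[OF sigma_finite_m])
  qed
  \<comment> \<open>The inner integral seen from the far end z = \<open>move i y\<close> of a
    passage: there \<open>sec j z\<close> is the inverse of \<open>sec i y\<close> and
    \<open>move j z\<close> is y again.\<close>
  define H where "H j z = (\<integral>\<^sup>+g. indicator fundamental (g - sec j z, move j z) * F (g, z) \<partial>m)" for j z
  have H: "H j \<in> borel_measurable X" for j
    unfolding H_def by (rule mX) measurable
  define L where "L i y = (\<integral>\<^sup>+g. indicator fundamental (g, y) * F (g - sec i y, move i y) \<partial>m)" for i y
  have L: "L i \<in> borel_measurable X" for i
    unfolding L_def by (rule mX) measurable
  have L_H: "L i y = H j (move i y)" if "y \<in> passage i j" for i j y
  proof -
    have y: "y \<in> space X" using that passage_subset Y_subset by auto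
    have "(\<lambda>g. indicator fundamental (g, y) * F (g - sec i y, move i y)) \<in> borel_measurable borel"
      using y measurable_space[OF move_measurable y] by measurable
    \<comment> \<open>The substitution of g + \<open>sec i y\<close> for g; here right invariance of
      m enters.\<close>
    from m_right[OF this, of "sec i y"]
    have "L i y = (\<integral>\<^sup>+g. indicator fundamental (g + sec i y, y) * F (g, move i y) \<partial>m)"
      unfolding L_def by simp
    also have "\<dots> = H j (move i y)"
      unfolding H_def move_passage(2,3)[OF that] by simp
    finally show ?thesis .
  qed
  have "(\<integral>\<^sup>+x. trans_sum F x \<partial>ind \<nu>)
      = (\<integral>\<^sup>+z. indicator fundamental z * trans_sum F (act (fst z) (snd z)) \<partial>(m \<Otimes>\<^sub>M \<nu>))"
    by (rule nn_integral_ind[OF \<nu> trans_sum_measurable[OF F]])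
  also have "\<dots> = (\<integral>\<^sup>+y. (\<integral>\<^sup>+g. indicator fundamental (g, y) * trans_sum F (act g y) \<partial>m) \<partial>\<nu>)"
  proof (subst nn_integral_product[OF \<nu>])
    have [measurable]: "trans_sum F \<in> borel_measurable X" by (rule trans_sum_measurable[OF F])
    have "(\<lambda>z. indicator fundamental z * trans_sum F (act (fst z) (snd z))) \<in> borel_measurable (borel \<Otimes>\<^sub>M X)"
      by measurable
    then show "(\<lambda>z. indicator fundamental z * trans_sum F (act (fst z) (snd z)))
        \<in> borel_measurable (borel \<Otimes>\<^sub>M restrict_space X Y)" by (rule restrict_GY_measurable)
  qed simp
  also have "\<dots> = (\<integral>\<^sup>+y. (\<Sum>i. \<Sum>j. indicator (passage i j) y * H j (move i y)) \<partial>\<nu>)"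
  proof (rule nn_integral_cong)
    fix y assume "y \<in> space \<nu>"
    then have y: "y \<in> Y" "y \<in> space X" using sp by auto
    have "(\<integral>\<^sup>+g. indicator fundamental (g, y) * trans_sum F (act g y) \<partial>m)
        = (\<integral>\<^sup>+g. (\<Sum>i. indicator (cell i) y * (indicator fundamental (g, y) * F (g - sec i y, move i y))) \<partial>m)"
      unfolding trans_sum_act_eq_suminf[OF y(2)] ennreal_suminf_cmult[symmetric]
      by (simp add: mult.left_commute)
    also have "\<dots> = (\<Sum>i. \<integral>\<^sup>+g. indicator (cell i) y * (indicator fundamental (g, y) * F (g - sec i y, move i y)) \<partial>m)"
      using y measurable_space[OF move_measurable y(2)] by (intro nn_integral_suminf) measurable
    also have "\<dots> = (\<Sum>i. indicator (cell i) y * L i y)"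
      unfolding L_def using y measurable_space[OF move_measurable y(2)]
      by (intro suminf_cong nn_integral_cmult) measurable
    also have "\<dots> = (\<Sum>i. \<Sum>j. indicator (passage i j) y * H j (move i y))"
    proof (rule suminf_cong)
      fix i
      have "indicator (cell i) y * L i y = (\<Sum>j. indicator (passage i j) y * L i y)"
        unfolding sum_passage[OF y(1), symmetric] by (rule ennreal_suminf_multc[symmetric])
      also have "\<dots> = (\<Sum>j. indicator (passage i j) y * H j (move i y))"
        by (rule suminf_cong) (simp add: L_H split: split_indicator)
      finally show "indicator (cell i) y * L i y = (\<Sum>j. indicator (passage i j) y * H j (move i y))" .
    qed
    finally show "(\<integral>\<^sup>+g. indicator fundamental (g, y) * trans_sum F (act g y) \<partial>m)
        = (\<Sum>i. \<Sum>j. indicator (passage i j) y * H j (move i y))" .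
  qed
  also have "\<dots> = (\<Sum>i. \<Sum>j. \<integral>\<^sup>+y. indicator (passage i j) y * H j (move i y) \<partial>\<nu>)"
  proof -
    have [measurable]: "(\<lambda>y. indicator (passage i j) y * H j (move i y)) \<in> borel_measurable \<nu>" for i j
    proof (rule M_Y_measurable[OF \<nu>])
      note [measurable] = H
      show "(\<lambda>y. indicator (passage i j) y * H j (move i y)) \<in> borel_measurable X" by measurable
    qed
    have "(\<integral>\<^sup>+y. (\<Sum>i. \<Sum>j. indicator (passage i j) y * H j (move i y)) \<partial>\<nu>)
        = (\<Sum>i. \<integral>\<^sup>+y. (\<Sum>j. indicator (passage i j) y * H j (move i y)) \<partial>\<nu>)"
      by (rule nn_integral_suminf) measurable
    also have "\<dots> = (\<Sum>i. \<Sum>j. \<integral>\<^sup>+y. indicator (passage i j) y * H j (move i y) \<partial>\<nu>)"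
      by (intro suminf_cong nn_integral_suminf) measurable
    finally show ?thesis .
  qed
  \<comment> \<open>Each passage is reversed by \<open>nn_integral_move\<close>. The integrand
    \<open>H j\<close> now depends on j alone, and summing over i fills up
    \<open>cell j\<close>.\<close>
  also have "\<dots> = (\<Sum>j. \<Sum>i. \<integral>\<^sup>+y. indicator (passage j i) y * H j y \<partial>\<nu>)"
    unfolding nn_integral_move[OF \<nu> H] by (rule suminf_swap_ennreal)
  also have "\<dots> = (\<Sum>j. \<integral>\<^sup>+y. indicator (cell j) y * H j y \<partial>\<nu>)"
  proof (rule suminf_cong)
    fix j
    have "(\<lambda>y. indicator (passage j i) y * H j y) \<in> borel_measurable \<nu>" for i
    proof (rule M_Y_measurable[OF \<nu>])
      note [measurable] = H
      show "(\<lambda>y. indicator (passage j i) y * H j y) \<in> borel_measurable X" by measurable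
    qed
    then have "(\<Sum>i. \<integral>\<^sup>+y. indicator (passage j i) y * H j y \<partial>\<nu>)
        = (\<integral>\<^sup>+y. (\<Sum>i. indicator (passage j i) y * H j y) \<partial>\<nu>)"
      by (rule nn_integral_suminf[symmetric])
    also have "\<dots> = (\<integral>\<^sup>+y. indicator (cell j) y * H j y \<partial>\<nu>)"
      using sp by (intro nn_integral_cong) (simp add: ennreal_suminf_multc sum_passage)
    finally show "(\<Sum>i. \<integral>\<^sup>+y. indicator (passage j i) y * H j y \<partial>\<nu>)
        = (\<integral>\<^sup>+y. indicator (cell j) y * H j y \<partial>\<nu>)" .
  qed
  also have "\<dots> = (\<integral>\<^sup>+y. (\<Sum>j. indicator (cell j) y * H j y) \<partial>\<nu>)"
  proof (rule nn_integral_suminf[symmetric])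
    fix j
    note [measurable] = H
    have "(\<lambda>y. indicator (cell j) y * H j y) \<in> borel_measurable X" by measurable
    then show "(\<lambda>y. indicator (cell j) y * H j y) \<in> borel_measurable \<nu>" by (rule M_Y_measurable[OF \<nu>])
  qed
  also have "\<dots> = (\<integral>\<^sup>+y. (\<integral>\<^sup>+g. F (g, y) \<partial>m) \<partial>\<nu>)"
  proof (rule nn_integral_cong)
    fix y assume "y \<in> space \<nu>"
    then have y: "y \<in> Y" "y \<in> space X" using sp by auto
    have "(\<Sum>j. indicator (cell j) y * H j y)
        = (\<Sum>j. \<integral>\<^sup>+g. indicator (cell j) y * (indicator fundamental (g - sec j y, move j y) * F (g, y)) \<partial>m)"
      unfolding H_def using y measurable_space[OF move_measurable y(2)]
      by (intro suminf_cong nn_integral_cmult[symmetric]) measurable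
    also have "\<dots> = (\<integral>\<^sup>+g. (\<Sum>j. indicator (cell j) y * (indicator fundamental (g - sec j y, move j y) * F (g, y))) \<partial>m)"
      using y measurable_space[OF move_measurable y(2)] by (intro nn_integral_suminf[symmetric]) measurable
    \<comment> \<open>The sum over j is the whole fibre sum of \<open>fundamental\<close> at g.y,
      which equals 1.\<close>
    also have "\<dots> = (\<integral>\<^sup>+g. trans_sum (indicator fundamental) (act g y) * F (g, y) \<partial>m)"
      unfolding trans_sum_act_eq_suminf[OF y(2)] ennreal_suminf_multc[symmetric]
      by (simp add: mult.assoc)
    also have "\<dots> = (\<integral>\<^sup>+g. F (g, y) \<partial>m)" using y by (simp add: trans_sum_fundamental)
    finally show "(\<Sum>j. indicator (cell j) y * H j y) = (\<integral>\<^sup>+g. F (g, y) \<partial>m)" .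
  qed
  also have "\<dots> = (\<integral>\<^sup>+z. F z \<partial>(m \<Otimes>\<^sub>M \<nu>))"
    by (rule nn_integral_product[OF \<nu> restrict_GY_measurable[OF F], symmetric])
  finally show ?thesis .
qed

text \<open>Formula (ii) for the pair (\<open>ind \<nu>\<close>, \<nu>), obtained before
  \<open>ind \<nu>\<close> is known to be invariant; finiteness of \<open>ind \<nu>\<close> and
  \<open>res_ind\<close> are read off from it.\<close>

lemma nn_integral_trans_sum_ind:
  assumes \<nu>: "\<nu> \<in> M_Y" and F: "F \<in> borel_measurable (borel \<Otimes>\<^sub>M restrict_space X Y)"
  shows "(\<integral>\<^sup>+x. trans_sum F x \<partial>ind \<nu>) = (\<integral>\<^sup>+z. F z \<partial>(m \<Otimes>\<^sub>M \<nu>))"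
proof -
  have "(\<integral>\<^sup>+x. trans_sum F x \<partial>ind \<nu>) = (\<integral>\<^sup>+x. trans_sum (\<lambda>z. F z * indicator (UNIV \<times> Y) z) x \<partial>ind \<nu>)"
    by (intro nn_integral_cong) (simp add: trans_sum_extend space_ind)
  also have "\<dots> = (\<integral>\<^sup>+z. F z * indicator (UNIV \<times> Y) z \<partial>(m \<Otimes>\<^sub>M \<nu>))"
    by (rule nn_integral_trans_sum_ind_X[OF \<nu> extend_GY_measurable[OF F]])
  also have "\<dots> = (\<integral>\<^sup>+z. F z \<partial>(m \<Otimes>\<^sub>M \<nu>))"
    by (intro nn_integral_cong) (auto simp: space_pair_measure space_m M_Y_space[OF \<nu>])
  finally show ?thesis .
qed

text \<open>The left translate of \<open>fundamental\<close> by - h also meets every fibre exactly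
  once, so the same integral can be computed over it; left invariance of m then moves the
  translation onto k.\<close>

lemma ind_invariant:
  assumes \<nu>: "\<nu> \<in> M_Y" and k [measurable]: "k \<in> borel_measurable X"
  shows "(\<integral>\<^sup>+x. k (act (- h) x) \<partial>ind \<nu>) = (\<integral>\<^sup>+x. k x \<partial>ind \<nu>)"
proof -
  let ?D = "\<lambda>z. indicator fundamental (h + fst z, snd z) :: ennreal"
  have D: "(\<lambda>z. ?D z * k (act (fst z) (snd z))) \<in> borel_measurable (borel \<Otimes>\<^sub>M X)"
    and D': "(\<lambda>z. indicator fundamental z * k (act (- h) (act (fst z) (snd z)))) \<in> borel_measurable (borel \<Otimes>\<^sub>M X)"
    by measurable
  have "(\<integral>\<^sup>+x. k x \<partial>ind \<nu>) = (\<integral>\<^sup>+x. trans_sum (\<lambda>z. ?D z * k (act (fst z) (snd z))) x \<partial>ind \<nu>)"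
  proof (rule nn_integral_cong)
    fix x assume "x \<in> space (ind \<nu>)"
    then have x: "x \<in> space X" by (simp add: space_ind)
    have "trans_sum ?D x = trans_sum (indicator fundamental) (act h x)"
      unfolding trans_sum_act[OF x] by (simp add: split_beta')
    then show "k x = trans_sum (\<lambda>z. ?D z * k (act (fst z) (snd z))) x"
      using x trans_sum_mult_right[OF x, of ?D k] by (simp add: trans_sum_fundamental)
  qed
  also have "\<dots> = (\<integral>\<^sup>+z. ?D z * k (act (fst z) (snd z)) \<partial>(m \<Otimes>\<^sub>M \<nu>))"
    by (rule nn_integral_trans_sum_ind_X[OF \<nu> D])
  also have "\<dots> = (\<integral>\<^sup>+y. (\<integral>\<^sup>+g. indicator fundamental (h + g, y) * k (act g y) \<partial>m) \<partial>\<nu>)"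
    unfolding nn_integral_product[OF \<nu> restrict_GY_measurable[OF D]] by simp
  also have "\<dots> = (\<integral>\<^sup>+y. (\<integral>\<^sup>+g. indicator fundamental (g, y) * k (act (- h) (act g y)) \<partial>m) \<partial>\<nu>)"
  proof (rule nn_integral_cong)
    fix y assume "y \<in> space \<nu>"
    then have y: "y \<in> space X" using M_Y_space[OF \<nu>] Y_subset by auto
    have "(\<lambda>g. indicator fundamental (g, y) * k (act (- h + g) y)) \<in> borel_measurable borel"
      using y by measurable
    from m_left[OF this, of h] y
    show "(\<integral>\<^sup>+g. indicator fundamental (h + g, y) * k (act g y) \<partial>m)
        = (\<integral>\<^sup>+g. indicator fundamental (g, y) * k (act (- h) (act g y)) \<partial>m)"
      by (simp add: act_act add.assoc[symmetric])
  qed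
  also have "\<dots> = (\<integral>\<^sup>+z. indicator fundamental z * k (act (- h) (act (fst z) (snd z))) \<partial>(m \<Otimes>\<^sub>M \<nu>))"
    unfolding nn_integral_product[OF \<nu> restrict_GY_measurable[OF D']] by simp
  also have "\<dots> = (\<integral>\<^sup>+x. k (act (- h) x) \<partial>ind \<nu>)"
    by (rule nn_integral_ind[OF \<nu>, symmetric]) measurable
  finally show ?thesis by simp
qed

text \<open>For finiteness, the indicator of K n.E n is dominated by the fibre count of
  \<open>K n \<times> E n\<close>, whose integral is the product of the finite numbers m(K n) and
  \<nu>(E n).\<close>

lemma ind_in:
  assumes \<nu>: "\<nu> \<in> M_Y"
  shows "ind \<nu> \<in> M_X"
proof -
  have "emeasure (ind \<nu>) (translates act (K n) (E n)) < \<infinity>" for n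
  proof -
    have EY: "E n \<inter> Y = E n" using E_subset by auto
    have tr: "translates act (K n) (E n) \<in> sets X"
      by (rule translates_sets[OF K_borel E_sets E_subset])
    have KE: "K n \<times> E n \<in> sets (borel \<Otimes>\<^sub>M restrict_space X Y)"
      using K_borel E_sets E_subset by (intro pair_measureI) (simp_all add: sets_Y_iff)
    have "emeasure (ind \<nu>) (translates act (K n) (E n))
        = (\<integral>\<^sup>+x. indicator (translates act (K n) (E n)) x \<partial>ind \<nu>)"
      using tr by (simp add: sets_ind)
    also have "\<dots> \<le> (\<integral>\<^sup>+x. trans_sum (indicator (K n \<times> E n)) x \<partial>ind \<nu>)"
      using trans_sum_translates_pos[of _ "K n" "E n"] EY
      by (intro nn_integral_mono) (simp split: split_indicator)
    also have "\<dots> = (\<integral>\<^sup>+z. indicator (K n \<times> E n) z \<partial>(m \<Otimes>\<^sub>M \<nu>))"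
      by (rule nn_integral_trans_sum_ind[OF \<nu> borel_measurable_indicator[OF KE]])
    also have "\<dots> = emeasure (m \<Otimes>\<^sub>M \<nu>) (K n \<times> E n)"
      using KE by (intro nn_integral_indicator) (simp add: M_Y_product_sets[OF \<nu>])
    also have "\<dots> = emeasure m (K n) * emeasure \<nu> (E n)"
      using K_borel E_sets E_subset
      by (intro sigma_finite_measure.emeasure_pair_measure_Times sigma_finite_on_E[OF M_Y_sets[OF \<nu>] M_Y_finite[OF \<nu>]])
        (simp_all add: sets_m M_Y_sets[OF \<nu>] sets_Y_iff)
    also have "\<dots> < \<infinity>"
      using m_compact[OF K_compact, of n] M_Y_finite[OF \<nu>, of n] by (simp add: ennreal_mult_less_top less_top)
    finally show ?thesis .
  qed
  moreover have "emeasure (ind \<nu>) (act g ` A) = emeasure (ind \<nu>) A" if A: "A \<in> sets X" for g A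
  proof -
    have im: "act g ` A = act (- g) -` A \<inter> space X"
      by (rule act_image[OF sets.sets_into_space[OF A]])
    have "(\<lambda>x. act (- g) x) \<in> X \<rightarrow>\<^sub>M X" by (rule measurable_act) simp_all
    then have "act g ` A \<in> sets X" unfolding im using A by (intro measurable_sets)
    then have "emeasure (ind \<nu>) (act g ` A) = (\<integral>\<^sup>+x. indicator (act g ` A) x \<partial>ind \<nu>)"
      by (simp add: sets_ind)
    also have "\<dots> = (\<integral>\<^sup>+x. indicator A (act (- g) x) \<partial>ind \<nu>)"
      unfolding im by (intro nn_integral_cong) (simp add: space_ind indicator_def)
    also have "\<dots> = (\<integral>\<^sup>+x. indicator A x \<partial>ind \<nu>)"
      by (rule ind_invariant[OF \<nu> borel_measurable_indicator[OF A]])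
    finally show ?thesis using A by (simp add: sets_ind)
  qed
  ultimately show ?thesis
    unfolding invariant_measures_def measures_finite_on_def invariant_measure_def
    by (simp add: sets_ind)
qed

text \<open>The fibre count of \<open>K0 \<times> A\<close> integrates to m(K0) \<nu>(A), and the
  normalisation in \<open>res\<close> cancels the first factor.\<close>

lemma res_ind:
  assumes \<nu>: "\<nu> \<in> M_Y"
  shows "res (ind \<nu>) = \<nu>"
proof (rule measure_eqI)
  show s: "sets (res (ind \<nu>)) = sets \<nu>" by (simp add: sets_res M_Y_sets[OF \<nu>])
  fix A assume "A \<in> sets (res (ind \<nu>))"
  then have A: "A \<in> sets X" "A \<subseteq> Y" by (simp_all add: sets_res sets_Y_iff)
  then have KA: "K0 \<times> A \<in> sets (borel \<Otimes>\<^sub>M restrict_space X Y)"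
    using K0(2) by (intro pair_measureI) (simp_all add: sets_Y_iff)
  have "emeasure (transverse_product (ind \<nu>)) (K0 \<times> A) = (\<integral>\<^sup>+x. trans_sum (indicator (K0 \<times> A)) x \<partial>ind \<nu>)"
    by (rule emeasure_transverse_product[OF sets_ind KA])
  also have "\<dots> = (\<integral>\<^sup>+z. indicator (K0 \<times> A) z \<partial>(m \<Otimes>\<^sub>M \<nu>))"
    by (rule nn_integral_trans_sum_ind[OF \<nu> borel_measurable_indicator[OF KA]])
  also have "\<dots> = emeasure (m \<Otimes>\<^sub>M \<nu>) (K0 \<times> A)"
    using KA by (intro nn_integral_indicator) (simp add: M_Y_product_sets[OF \<nu>])
  also have "\<dots> = emeasure m K0 * emeasure \<nu> A"
    using K0(2) A
    by (intro sigma_finite_measure.emeasure_pair_measure_Times sigma_finite_on_E[OF M_Y_sets[OF \<nu>] M_Y_finite[OF \<nu>]])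
      (simp_all add: sets_m M_Y_sets[OF \<nu>] sets_Y_iff)
  finally show "emeasure (res (ind \<nu>)) A = emeasure \<nu> A"
    using emeasure_res[OF A, of "ind \<nu>"] by (simp only: K0_inverse)
qed

text \<open>Integrating over \<open>fundamental\<close> and passing to fibre sums by formula (ii)
  leaves weight 1 at each x.\<close>

lemma ind_res:
  assumes \<mu>: "\<mu> \<in> M_X"
  shows "ind (res \<mu>) = \<mu>"
proof (rule measure_eqI)
  show "sets (ind (res \<mu>)) = sets \<mu>" by (simp add: sets_ind M_X_sets[OF \<mu>])
  fix A assume "A \<in> sets (ind (res \<mu>))"
  then have A [measurable]: "A \<in> sets X" by (simp add: sets_ind)
  let ?F = "\<lambda>z. indicator fundamental z * indicator A (act (fst z) (snd z)) :: ennreal"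
  have F: "?F \<in> borel_measurable (borel \<Otimes>\<^sub>M X)" by measurable
  have "emeasure (ind (res \<mu>)) A = (\<integral>\<^sup>+x. indicator A x \<partial>ind (res \<mu>))"
    using A by (simp add: sets_ind)
  also have "\<dots> = (\<integral>\<^sup>+z. ?F z \<partial>(m \<Otimes>\<^sub>M res \<mu>))"
    by (rule nn_integral_ind[OF res_in[OF \<mu>] borel_measurable_indicator[OF A]])
  also have "\<dots> = (\<integral>\<^sup>+x. trans_sum ?F x \<partial>\<mu>)"
    by (rule nn_integral_product_res[OF \<mu> restrict_GY_measurable[OF F]])
  also have "\<dots> = (\<integral>\<^sup>+x. indicator A x \<partial>\<mu>)"
    using M_X_space[OF \<mu>] by (intro nn_integral_cong) (simp add: trans_sum_mult_right trans_sum_fundamental)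
  also have "\<dots> = emeasure \<mu> A" using A by (simp add: M_X_sets[OF \<mu>])
  finally show "emeasure (ind (res \<mu>)) A = emeasure \<mu> A" .
qed

text \<open>Formula (ii) for the product of \<rho> and f; in the iterated integral the inner one is
  that of \<rho>, which is 1.\<close>

lemma nn_integral_res:
  fixes f :: "'x \<Rightarrow> real" and \<rho> :: "'g \<Rightarrow> real"
  assumes \<mu>: "\<mu> \<in> M_X" and f: "f \<in> borel_measurable (restrict_space X Y)" "\<And>y. y \<in> Y \<Longrightarrow> 0 \<le> f y"
    and \<rho>: "\<rho> \<in> borel_measurable borel" "\<And>g. 0 \<le> \<rho> g" "(\<integral>\<^sup>+g. ennreal (\<rho> g) \<partial>m) = 1"
  shows "trans_sum (\<lambda>z. ennreal (\<rho> (fst z) * f (snd z))) \<in> borel_measurable X"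
    and "(\<integral>\<^sup>+y. ennreal (f y) \<partial>res \<mu>) = (\<integral>\<^sup>+x. trans_sum (\<lambda>z. ennreal (\<rho> (fst z) * f (snd z))) x \<partial>\<mu>)"
proof -
  note [measurable] = f(1) \<rho>(1)
  let ?F = "\<lambda>z. ennreal (\<rho> (fst z) * f (snd z))"
  have F: "?F \<in> borel_measurable (borel \<Otimes>\<^sub>M restrict_space X Y)" by measurable
  then show "trans_sum ?F \<in> borel_measurable X" by (rule trans_sum_measurable_GY)
  have "(\<integral>\<^sup>+x. trans_sum ?F x \<partial>\<mu>) = (\<integral>\<^sup>+z. ?F z \<partial>(m \<Otimes>\<^sub>M res \<mu>))"
    by (rule nn_integral_product_res[OF \<mu> F, symmetric])
  also have "\<dots> = (\<integral>\<^sup>+y. (\<integral>\<^sup>+g. ennreal (\<rho> g * f y) \<partial>m) \<partial>res \<mu>)"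
    by (subst nn_integral_product[OF res_in[OF \<mu>] F]) simp
  also have "\<dots> = (\<integral>\<^sup>+y. ennreal (f y) \<partial>res \<mu>)"
  proof (rule nn_integral_cong)
    fix y assume "y \<in> space (res \<mu>)"
    then have "y \<in> Y" by (simp add: space_res)
    then have "(\<integral>\<^sup>+g. ennreal (\<rho> g * f y) \<partial>m) = (\<integral>\<^sup>+g. ennreal (\<rho> g) * ennreal (f y) \<partial>m)"
      using \<rho>(2) f(2) by (intro nn_integral_cong ennreal_mult) auto
    also have "\<dots> = (\<integral>\<^sup>+g. ennreal (\<rho> g) \<partial>m) * ennreal (f y)"
      by (rule nn_integral_multc) measurable
    finally show "(\<integral>\<^sup>+g. ennreal (\<rho> g * f y) \<partial>m) = ennreal (f y)" using \<rho>(3) by simp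
  qed
  finally show "(\<integral>\<^sup>+y. ennreal (f y) \<partial>res \<mu>) = (\<integral>\<^sup>+x. trans_sum ?F x \<partial>\<mu>)" by simp
qed

text \<open>Injectivity turns the fibre count of C into the indicator of its image. This gives the
  measurability of the image and, by formula (ii), its measure.\<close>

lemma emeasure_image_inj:
  assumes \<mu>: "\<mu> \<in> M_X" and C: "C \<in> sets (borel \<Otimes>\<^sub>M restrict_space X Y)"
    and inj: "inj_on (\<lambda>(g, y). act g y) C"
  shows "(\<lambda>(g, y). act g y) ` C \<in> sets X"
    and "emeasure \<mu> ((\<lambda>(g, y). act g y) ` C) = emeasure (m \<Otimes>\<^sub>M res \<mu>) C"
proof -
  let ?aC = "(\<lambda>(g, y). act g y) ` C"
  have CY: "y \<in> Y" if "(g, y) \<in> C" for g y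
    using sets.sets_into_space[OF C] that by (auto simp: space_GY)
  have aC: "?aC \<subseteq> space X" using CY Y_subset by auto
  have tr: "trans_sum (indicator C) x = indicator ?aC x" if x: "x \<in> space X" for x
  proof (cases "x \<in> ?aC")
    case True
    then obtain g y where gy: "(g, y) \<in> C" "x = act g y" by auto
    then have y: "y \<in> Y" "y = act (- g) x" using CY Y_subset by auto
    have "trans_sum (indicator C) x = indicator C (- (- g), act (- g) x)"
    proof (rule trans_sum_single)
      show "- g \<in> return_set act Y x" using y by (simp add: return_set_def)
      fix h assume h: "h \<in> return_set act Y x" "h \<noteq> - g"
      have "(- h, act h x) \<notin> C"
      proof
        assume "(- h, act h x) \<in> C"
        moreover have "act (- h) (act h x) = act g y" using x gy(2) by simp
        ultimately have "(- h, act h x) = (g, y)" using inj_onD[OF inj _ _ gy(1), of "(- h, act h x)"] by simp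
        then show False using h(2) by auto
      qed
      then show "indicator C (- h, act h x) = (0 :: ennreal)" by simp
    qed
    then show ?thesis using gy(1) y(2) True by simp
  next
    case False
    have "trans_sum (indicator C) x = 0"
    proof (rule trans_sum_0)
      fix g
      have "(- g, act g x) \<notin> C"
      proof
        assume "(- g, act g x) \<in> C"
        then have "x \<in> ?aC" using x by (intro image_eqI[of _ _ "(- g, act g x)"]) auto
        with False show False by blast
      qed
      then show "indicator C (- g, act g x) = (0 :: ennreal)" by simp
    qed
    then show ?thesis using False by simp
  qed
  have ind: "indicator C \<in> borel_measurable (borel \<Otimes>\<^sub>M restrict_space X Y)" using C by simp
  have "x \<in> ?aC \<longleftrightarrow> x \<in> trans_sum (indicator C) -` {1} \<inter> space X" for x
    using subsetD[OF aC, of x] tr[of x] by (cases "x \<in> ?aC") auto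
  then have "?aC = trans_sum (indicator C) -` {1} \<inter> space X" by (rule set_eqI)
  also have "\<dots> \<in> sets X" by (rule measurable_sets[OF trans_sum_measurable_GY[OF ind]]) simp
  finally show sC: "?aC \<in> sets X" .
  have "emeasure (m \<Otimes>\<^sub>M res \<mu>) C = (\<integral>\<^sup>+z. indicator C z \<partial>(m \<Otimes>\<^sub>M res \<mu>))"
    using C by (intro nn_integral_indicator[symmetric]) (simp add: M_Y_product_sets[OF res_in[OF \<mu>]])
  also have "\<dots> = (\<integral>\<^sup>+x. trans_sum (indicator C) x \<partial>\<mu>)"
    by (rule nn_integral_product_res[OF \<mu> ind])
  also have "\<dots> = (\<integral>\<^sup>+x. indicator ?aC x \<partial>\<mu>)"
    using tr M_X_space[OF \<mu>] by (intro nn_integral_cong) simp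
  also have "\<dots> = emeasure \<mu> ?aC" using sC by (intro nn_integral_indicator) (simp add: M_X_sets[OF \<mu>])
  finally show "emeasure \<mu> ?aC = emeasure (m \<Otimes>\<^sub>M res \<mu>) C" by simp
qed

text \<open>The fibre count of G x (B \<inter> Y) is nonzero exactly on B, since every orbit meets Y
  and B is invariant. Its integral is m(G) times the restricted measure of B \<inter> Y, and m(G),
  possibly infinite, is not 0.\<close>

lemma null_sets_correspond:
  assumes \<mu>: "\<mu> \<in> M_X" and B: "B \<in> sets X" and inv: "\<And>g. act g ` B = B"
  shows "emeasure \<mu> B = 0 \<longleftrightarrow> emeasure (res \<mu>) (B \<inter> Y) = 0"
proof -
  have BY: "UNIV \<times> (B \<inter> Y) \<in> sets (borel \<Otimes>\<^sub>M restrict_space X Y)"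
    using B by (intro pair_measureI) (auto simp: sets_Y_iff)
  let ?s = "trans_sum (indicator (UNIV \<times> (B \<inter> Y)))"
  have s [measurable]: "?s \<in> borel_measurable \<mu>"
    using trans_sum_measurable_GY[OF borel_measurable_indicator[OF BY]]
    by (simp cong: measurable_cong_sets add: M_X_sets[OF \<mu>])
  have pos: "?s x \<noteq> 0 \<longleftrightarrow> x \<in> B" if x: "x \<in> space X" for x
  proof
    assume "x \<in> B"
    obtain g where g: "g \<in> return_set act Y x" using return_set_nonempty[OF x] by blast
    have "act g x \<in> B" using inv[of g] \<open>x \<in> B\<close> by blast
    then have "1 \<le> ?s x"
      using trans_sum_ge[OF g, of "indicator (UNIV \<times> (B \<inter> Y))"] g by (simp add: return_set_def)
    then show "?s x \<noteq> 0" by auto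
  next
    assume "?s x \<noteq> 0"
    then obtain g where g: "g \<in> return_set act Y x" "indicator (UNIV \<times> (B \<inter> Y)) (- g, act g x) \<noteq> (0 :: ennreal)"
      using trans_sum_0[of x "indicator (UNIV \<times> (B \<inter> Y))"] by blast
    then have "act g x \<in> B" by (auto simp: indicator_def split: if_splits)
    then have "act (- g) (act g x) \<in> act (- g) ` B" by (rule imageI)
    then show "x \<in> B" using inv[of "- g"] x by simp
  qed
  have "emeasure m UNIV * emeasure (res \<mu>) (B \<inter> Y) = emeasure (m \<Otimes>\<^sub>M res \<mu>) (UNIV \<times> (B \<inter> Y))"
    using B
    by (intro sigma_finite_measure.emeasure_pair_measure_Times[symmetric] sigma_finite_on_E[OF sets_res res_finite[OF \<mu>]])
      (auto simp: sets_m sets_res sets_Y_iff)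
  also have "\<dots> = (\<integral>\<^sup>+z. indicator (UNIV \<times> (B \<inter> Y)) z \<partial>(m \<Otimes>\<^sub>M res \<mu>))"
    using BY by (intro nn_integral_indicator[symmetric]) (simp add: M_Y_product_sets[OF res_in[OF \<mu>]])
  also have "\<dots> = (\<integral>\<^sup>+x. ?s x \<partial>\<mu>)"
    by (rule nn_integral_product_res[OF \<mu> borel_measurable_indicator[OF BY]])
  finally have "emeasure (res \<mu>) (B \<inter> Y) = 0 \<longleftrightarrow> (\<integral>\<^sup>+x. ?s x \<partial>\<mu>) = 0"
    using m_UNIV by (metis mult_eq_0_iff)
  also have "\<dots> \<longleftrightarrow> emeasure \<mu> {x \<in> space \<mu>. ?s x \<noteq> 0} = 0"
    by (rule nn_integral_0_iff[OF s])
  also have "{x \<in> space \<mu>. ?s x \<noteq> 0} = B"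
    using pos sets.sets_into_space[OF B] M_X_space[OF \<mu>] by auto
  finally show ?thesis by simp
qed

end

theorem theorem1p14:
  fixes m :: "'g::{topological_group_add, second_countable_topology, t2_space} measure"
    and X :: "'x measure"
    and act :: "'g \<Rightarrow> 'x \<Rightarrow> 'x"
    and Y :: "'x set"
    and K :: "nat \<Rightarrow> 'g set"
    and E :: "nat \<Rightarrow> 'x set"
  assumes lc: "locally_compact_space (euclidean :: 'g topology)"
    and unimod: "unimodular TYPE('g)"
    and haar: "haar_measure m"
    and stdX: "standard_borel_space X"
    and act: "borel_action act X"
    and cross: "cross_section act X Y"
    and sep: "separated act Y"
    and exhG: "fundamental_exhaustion K"
    and exhY: "borel_exhaustion (restrict_space X Y) E"
  shows "\<exists>res ind.
    bij_betw res (invariant_measures act X K E) (transverse_measures act X Y E) \<and>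
    bij_betw ind (transverse_measures act X Y E) (invariant_measures act X K E) \<and>
    (\<forall>\<mu>\<in>invariant_measures act X K E. ind (res \<mu>) = \<mu>) \<and>
    (\<forall>\<nu>\<in>transverse_measures act X Y E. res (ind \<nu>) = \<nu>) \<and>
    (\<forall>\<mu>\<in>invariant_measures act X K E. \<forall>\<nu>. \<nu> = res \<mu> \<longrightarrow>
      (\<forall>(f :: 'x \<Rightarrow> real) c (\<rho> :: 'g \<Rightarrow> real).
         f \<in> borel_measurable (restrict_space X Y) \<and> (\<forall>y\<in>Y. 0 \<le> f y \<and> f y \<le> c) \<and>
         \<rho> \<in> borel_measurable borel \<and> (\<forall>g. 0 \<le> \<rho> g) \<and> (\<integral>\<^sup>+ g. ennreal (\<rho> g) \<partial>m) = 1 \<longrightarrow>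
         (\<lambda>x. \<Sum>\<^sub>\<infinity>g\<in>return_set act Y x. ennreal (\<rho> (- g) * f (act g x))) \<in> borel_measurable X \<and>
         (\<integral>\<^sup>+ y. ennreal (f y) \<partial>\<nu>) =
           (\<integral>\<^sup>+ x. (\<Sum>\<^sub>\<infinity>g\<in>return_set act Y x. ennreal (\<rho> (- g) * f (act g x))) \<partial>\<mu>)) \<and>
      (\<forall>(F :: 'g \<times> 'x \<Rightarrow> real) c.
         F \<in> borel_measurable (borel \<Otimes>\<^sub>M restrict_space X Y) \<and>
         (\<forall>g. \<forall>y\<in>Y. 0 \<le> F (g, y) \<and> F (g, y) \<le> c) \<longrightarrow>
         (\<lambda>x. \<Sum>\<^sub>\<infinity>g\<in>return_set act Y x. ennreal (F (- g, act g x))) \<in> borel_measurable X \<and>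
         (\<integral>\<^sup>+ z. ennreal (F z) \<partial>(m \<Otimes>\<^sub>M \<nu>)) =
           (\<integral>\<^sup>+ x. (\<Sum>\<^sub>\<infinity>g\<in>return_set act Y x. ennreal (F (- g, act g x))) \<partial>\<mu>)) \<and>
      (\<forall>C\<in>sets (borel \<Otimes>\<^sub>M restrict_space X Y).
         inj_on (\<lambda>(g, y). act g y) C \<longrightarrow>
         (\<lambda>(g, y). act g y) ` C \<in> sets X \<and>
         emeasure \<mu> ((\<lambda>(g, y). act g y) ` C) = emeasure (m \<Otimes>\<^sub>M \<nu>) C) \<and>
      (\<forall>B\<in>sets X. (\<forall>g. act g ` B = B) \<longrightarrow>
         (emeasure \<mu> B = 0 \<longleftrightarrow> emeasure \<nu> (B \<inter> Y) = 0)))"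
proof -
  interpret unimodular_action act X Y K m E
    using assms by unfold_locales
  let ?M = "invariant_measures act X K E" and ?N = "transverse_measures act X Y E"
  show ?thesis
  proof (rule exI[of _ res], rule exI[of _ ind], intro conjI ballI allI impI)
    show "bij_betw res ?M ?N"
      by (rule bij_betw_byWitness[of _ ind]) (auto simp: ind_res res_ind res_in ind_in)
    show "bij_betw ind ?N ?M"
      by (rule bij_betw_byWitness[of _ res]) (auto simp: ind_res res_ind res_in ind_in)
  next
    fix \<mu> \<nu> and f :: "'x \<Rightarrow> real" and c and \<rho> :: "'g \<Rightarrow> real"
    assume \<mu>: "\<mu> \<in> ?M" and \<nu>: "\<nu> = res \<mu>"
      and "f \<in> borel_measurable (restrict_space X Y) \<and> (\<forall>y\<in>Y. 0 \<le> f y \<and> f y \<le> c) \<and>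
         \<rho> \<in> borel_measurable borel \<and> (\<forall>g. 0 \<le> \<rho> g) \<and> (\<integral>\<^sup>+ g. ennreal (\<rho> g) \<partial>m) = 1"
    then have "f \<in> borel_measurable (restrict_space X Y)" "\<And>y. y \<in> Y \<Longrightarrow> 0 \<le> f y"
      "\<rho> \<in> borel_measurable borel" "\<And>g. 0 \<le> \<rho> g" "(\<integral>\<^sup>+ g. ennreal (\<rho> g) \<partial>m) = 1" by simp_all
    note * = nn_integral_res[OF \<mu> this, unfolded trans_sum_def[abs_def] fst_conv snd_conv]
    show "(\<lambda>x. \<Sum>\<^sub>\<infinity>g\<in>return_set act Y x. ennreal (\<rho> (- g) * f (act g x))) \<in> borel_measurable X"
      by (rule *(1))
    show "(\<integral>\<^sup>+ y. ennreal (f y) \<partial>\<nu>) =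
        (\<integral>\<^sup>+ x. (\<Sum>\<^sub>\<infinity>g\<in>return_set act Y x. ennreal (\<rho> (- g) * f (act g x))) \<partial>\<mu>)"
      using *(2) unfolding \<nu> .
  next
    fix \<mu> \<nu> and F :: "'g \<times> 'x \<Rightarrow> real" and c
    assume \<mu>: "\<mu> \<in> ?M" and \<nu>: "\<nu> = res \<mu>"
      and "F \<in> borel_measurable (borel \<Otimes>\<^sub>M restrict_space X Y) \<and>
         (\<forall>g. \<forall>y\<in>Y. 0 \<le> F (g, y) \<and> F (g, y) \<le> c)"
    then have "F \<in> borel_measurable (borel \<Otimes>\<^sub>M restrict_space X Y)" by simp
    then have F: "(\<lambda>z. ennreal (F z)) \<in> borel_measurable (borel \<Otimes>\<^sub>M restrict_space X Y)" by measurable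
    show "(\<lambda>x. \<Sum>\<^sub>\<infinity>g\<in>return_set act Y x. ennreal (F (- g, act g x))) \<in> borel_measurable X"
      using trans_sum_measurable_GY[OF F] unfolding trans_sum_def[abs_def] .
    show "(\<integral>\<^sup>+ z. ennreal (F z) \<partial>(m \<Otimes>\<^sub>M \<nu>)) =
        (\<integral>\<^sup>+ x. (\<Sum>\<^sub>\<infinity>g\<in>return_set act Y x. ennreal (F (- g, act g x))) \<partial>\<mu>)"
      using nn_integral_product_res[OF \<mu> F] unfolding \<nu> trans_sum_def .
  qed (simp_all add: ind_res res_ind emeasure_image_inj null_sets_correspond)
qed

end
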